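(* Consider, for each $n\ge 1$, the multiplicative intensity model on $E=[0,T]$ with group action $\varphi$, kernel $K$, bandwidths $(h_j)$ and baseline intensity $\alpha$ satisfying all the assumptions (G1)-(G2), (K1)-(K4), (Y1)-(Y3), (A1)-(A2) listed in the context, and let $d_{\mathrm{eff}}$ be the effective dimension. If $\alpha\in\mathcal H^s_{\mathrm{twin}}$ for some $s>0$, then there is a constant $C$, independent of $n$ and $j$, such that whenever the level $j$ is such that $h_j=n^{-1/(2s+d_{\mathrm{eff}})}$, $$\mathbb{E}\left[\|\hat\alpha_j-\alpha\|_2^2\right]\le C\,n^{-\frac{2s}{2s+d_{\mathrm{eff}}}} .$$
   Context: Model. For each $n$, $N$ is a counting process on $[0,T]$ (adapted, càdlàg, piecewise constant, jumps $+1$, $N(0)=0$) with respect to a filtration $(\mathcal F_t)$ satisfying the usual conditions, with predictable intensity $\lambda(t)=\alpha(t)Y(t)$: the process $M(t)=N(t)-\int_0^t\lambda(s)\,ds$ is a local martingale. Here $\alpha:[0,T]\to\mathbb{R}_+$ is deterministic (the unknown baseline intensity, not depending on $n$) and $Y\ge 0$ is a predictable at-risk process (depending on $n$). Put $J(s)=\mathbf 1_{Y(s)>0}$, with the convention $J(s)/Y(s)=0$ when $Y(s)=0$. Twin kernels. $E=[0,T]$ carries a metric $d$ and the reference measure $\mu$ (Lebesgue measure), and the cyclic group $G=\langle\varphi\rangle$ acts on $E$. For a decreasing sequence of bandwidths $h_j>0$, $j\ge 0$, put $K_j(t,s)=\frac1{h_j}K\big(d(\varphi^{-j}(t),\varphi^{-j}(s))/h_j\big)$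 and $\alpha_j(t)=\int K_j(t,s)\alpha(s)\,d\mu(s)$. Estimator. $\hat\alpha_j(t)=\int_0^T K_j(t,s)\frac{J(s)}{Y(s)}\,dN(s)$. $\|\cdot\|_2$ is the $L^2$ norm on $[0,T]$. Twin-Hölder class. $\alpha\in\mathcal H^s_{\mathrm{twin}}$ means: there is a constant $C_\alpha$ with $\|\alpha_j-\alpha\|_2\le C_\alpha h_j^s$ for all $j\ge0$. Effective dimension. $d_{\mathrm{eff}}\ge0$ is the exponent governing the conditional variance of the estimator: for a constant $C'$ independent of $n,j,t$, $$\mathrm{Var}(\hat\alpha_j(t)\mid Y)=\int_0^T K_j(t,s)^2\frac{J(s)}{Y(s)^2}\lambda(s)\,ds\le \frac{C'\|K\|_\infty^2\,\alpha(t)}{n\,h_j^{d_{\mathrm{eff}}}} .$$ Group assumptions. (G1) $\varphi:E\to E$ is a measurable bijection with measurable inverse. (G2) There are $c_1,c_2>0$ with $c_1\mu(A)\le\mu(\varphi(A))\le c_2\mu(A)$ for all measurable $A$. Kernel assumptions. $K:\mathbb{R}\to\mathbb{R}_+$ satisfies (K1) $\int K(u)\,du=1$; (K2) $\|K\|_\infty<\infty$; (K3) $\mathrm{supp}(K)\subseteq[-1,1]$; (K4) $K$ is Lipschitz. At-risk assumptions. (Y1) There is $y_{\min}>0$ with $Y(t)\ge n\,y_{\min}$ on $[0,T]$. (Y2) $\sup_{t\in[0,T]}|Y(t)/n-y(t)|\to0$ in probability for some deterministic $y(t)>0$. (Y3) There are constants $c_1,c_2>0$ with $c_1Y(t)\le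 Y(\varphi(t))\le c_2Y(t)$. Intensity assumptions. (A1) $\|\alpha\|_\infty<\infty$. (A2) $\alpha$ is bounded away from zero on its support. *)

theory Defs
  imports "HOL-Probability.Probability"
begin

section \<open>Processes on the time interval $[0,T]$\<close>

text \<open>
  Processes and filtrations are indexed by all reals, but only the values at times in
  \<open>{0..T}\<close> matter: a filtration on \<open>[0,T]\<close> is extended constantly outside \<open>[0,T]\<close>.
\<close>

definition usual_filtration :: "'a measure \<Rightarrow> real \<Rightarrow> (real \<Rightarrow> 'a measure) \<Rightarrow> bool" where
  "usual_filtration P T F \<longleftrightarrow>
     filtration (space P) F \<and>
     (\<forall>t. subalgebra P (F t)) \<and>
     (\<forall>t\<in>{0..<T}. sets (F t) = (\<Inter>u\<in>{t<..T}. sets (F u))) \<and>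
     (\<forall>A\<in>null_sets P. \<forall>B\<subseteq>A. B \<in> sets (F 0))"

definition adapted :: "real \<Rightarrow> (real \<Rightarrow> 'a measure) \<Rightarrow> (real \<Rightarrow> 'a \<Rightarrow> real) \<Rightarrow> bool" where
  "adapted T F X \<longleftrightarrow> (\<forall>t\<in>{0..T}. X t \<in> borel_measurable (F t))"

definition cadlag_on :: "real \<Rightarrow> (real \<Rightarrow> real) \<Rightarrow> bool" where
  "cadlag_on T f \<longleftrightarrow>
     (\<forall>t\<in>{0..<T}. continuous (at_right t) f) \<and>
     (\<forall>t\<in>{0<..T}. \<exists>l. (f \<longlongrightarrow> l) (at_left t))"

definition piecewise_constant_on :: "real \<Rightarrow> (real \<Rightarrow> real) \<Rightarrow> bool" where
  "piecewise_constant_on T f \<longleftrightarrow>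
     (\<exists>S. finite S \<and> (\<forall>s t. 0 \<le> s \<and> s \<le> t \<and> t \<le> T \<and> {s..t} \<inter> S = {} \<longrightarrow> f s = f t))"

definition counting_process ::
  "'a measure \<Rightarrow> real \<Rightarrow> (real \<Rightarrow> 'a measure) \<Rightarrow> (real \<Rightarrow> 'a \<Rightarrow> real) \<Rightarrow> bool" where
  "counting_process P T F N \<longleftrightarrow>
     adapted T F N \<and>
     (\<forall>\<omega>\<in>space P.
        N 0 \<omega> = 0 \<and>
        cadlag_on T (\<lambda>t. N t \<omega>) \<and>
        piecewise_constant_on T (\<lambda>t. N t \<omega>) \<and>
        (\<forall>t\<in>{0<..T}. N t \<omega> - Lim (at_left t) (\<lambda>u. N u \<omega>) \<in> {0, 1}))"

definition predictable_sigma :: "'a measure \<Rightarrow> real \<Rightarrow> (real \<Rightarrow> 'a measure) \<Rightarrow> (real \<times> 'a) measure" where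
  "predictable_sigma P T F =
     sigma ({0..T} \<times> space P)
       ({{0} \<times> A | A. A \<in> sets (F 0)} \<union>
        {{s<..t} \<times> A | s t A. 0 \<le> s \<and> s \<le> t \<and> t \<le> T \<and> A \<in> sets (F s)})"

definition predictable ::
  "'a measure \<Rightarrow> real \<Rightarrow> (real \<Rightarrow> 'a measure) \<Rightarrow> (real \<Rightarrow> 'a \<Rightarrow> real) \<Rightarrow> bool" where
  "predictable P T F X \<longleftrightarrow> (\<lambda>(t, \<omega>). X t \<omega>) \<in> borel_measurable (predictable_sigma P T F)"

definition martingale_on ::
  "'a measure \<Rightarrow> real \<Rightarrow> (real \<Rightarrow> 'a measure) \<Rightarrow> (real \<Rightarrow> 'a \<Rightarrow> real) \<Rightarrow> bool" where
  "martingale_on P T F X \<longleftrightarrow>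
     adapted T F X \<and>
     (\<forall>t\<in>{0..T}. integrable P (X t)) \<and>
     (\<forall>s\<in>{0..T}. \<forall>t\<in>{s..T}. AE \<omega> in P. real_cond_exp P (F s) (X t) \<omega> = X s \<omega>)"

text \<open>
  On the closed interval \<open>[0,T]\<close> a localizing sequence must reach \<open>T\<close> after finitely many
  steps, almost surely.
\<close>

definition local_martingale_on ::
  "'a measure \<Rightarrow> real \<Rightarrow> (real \<Rightarrow> 'a measure) \<Rightarrow> (real \<Rightarrow> 'a \<Rightarrow> real) \<Rightarrow> bool" where
  "local_martingale_on P T F X \<longleftrightarrow>
     (\<exists>\<tau> :: nat \<Rightarrow> 'a \<Rightarrow> real.
        (\<forall>k. stopping_time F (\<tau> k)) \<and>
        (\<forall>k. \<forall>\<omega>\<in>space P. \<tau> k \<omega> \<in> {0..T}) \<and>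
        (AE \<omega> in P. incseq (\<lambda>k. \<tau> k \<omega>)) \<and>
        (AE \<omega> in P. eventually (\<lambda>k. \<tau> k \<omega> = T) sequentially) \<and>
        (\<forall>k. martingale_on P T F (\<lambda>t \<omega>. X (min t (\<tau> k \<omega>)) \<omega>)))"

text \<open>
  The integrability clause is what makes the compensator, hence \<open>N - \<integral>\<lambda>\<close>, well defined.
\<close>

definition has_intensity ::
  "'a measure \<Rightarrow> real \<Rightarrow> (real \<Rightarrow> 'a measure) \<Rightarrow> (real \<Rightarrow> 'a \<Rightarrow> real) \<Rightarrow> (real \<Rightarrow> 'a \<Rightarrow> real) \<Rightarrow> bool"
where
  "has_intensity P T F N lam \<longleftrightarrow>
     predictable P T F lam \<and>
     (AE \<omega> in P. set_integrable lborel {0..T} (\<lambda>s. lam s \<omega>)) \<and>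
     local_martingale_on P T F (\<lambda>t \<omega>. N t \<omega> - (LINT s:{0..t}|lborel. lam s \<omega>))"

text \<open>
  Uniform convergence in probability on \<open>[0,T]\<close> of \<open>X n\<close>, living on \<open>P n\<close>, to a deterministic
  function. The outer measure avoids presupposing measurability of an uncountable supremum.
\<close>

definition unif_conv_in_prob ::
  "(nat \<Rightarrow> 'a measure) \<Rightarrow> real \<Rightarrow> (nat \<Rightarrow> real \<Rightarrow> 'a \<Rightarrow> real) \<Rightarrow> (real \<Rightarrow> real) \<Rightarrow> bool" where
  "unif_conv_in_prob P T X y \<longleftrightarrow>
     (\<forall>e>0. (\<lambda>n. outer_measure_of (P n)
        {\<omega>\<in>space (P n). (SUP t\<in>{0..T}. ereal \<bar>X n t \<omega> - y t\<bar>) > ereal e}) \<longlonglongrightarrow> 0)"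

section \<open>Norms\<close>

definition sup_norm :: "(real \<Rightarrow> real) \<Rightarrow> real" where
  "sup_norm f = (SUP u. \<bar>f u\<bar>)"

text \<open>The $L^2$ norm on $[0,T]$, with value \<open>\<infinity>\<close> for functions that are not square integrable.\<close>

definition L2_norm :: "real \<Rightarrow> (real \<Rightarrow> real) \<Rightarrow> ennreal" where
  "L2_norm T f =
     (let I = (\<integral>\<^sup>+ t\<in>{0..T}. ennreal ((f t)\<^sup>2) \<partial>lborel)
      in if I = \<infinity> then \<infinity> else ennreal (sqrt (enn2real I)))"

section \<open>Twin kernels and the estimator\<close>

definition twin_kernel ::
  "real \<Rightarrow> (real \<Rightarrow> real \<Rightarrow> real) \<Rightarrow> (real \<Rightarrow> real) \<Rightarrow> (real \<Rightarrow> real) \<Rightarrow> (nat \<Rightarrow> real)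
     \<Rightarrow> nat \<Rightarrow> real \<Rightarrow> real \<Rightarrow> real" where
  "twin_kernel T d \<phi> K h j t s =
     1 / h j * K (d ((inv_into {0..T} \<phi> ^^ j) t) ((inv_into {0..T} \<phi> ^^ j) s) / h j)"

definition twin_smooth ::
  "real \<Rightarrow> (real \<Rightarrow> real \<Rightarrow> real) \<Rightarrow> (real \<Rightarrow> real) \<Rightarrow> (real \<Rightarrow> real) \<Rightarrow> (nat \<Rightarrow> real)
     \<Rightarrow> (real \<Rightarrow> real) \<Rightarrow> nat \<Rightarrow> real \<Rightarrow> real" where
  "twin_smooth T d \<phi> K h \<alpha> j t =
     (LINT s:{0..T}|lborel. twin_kernel T d \<phi> K h j t s * \<alpha> s)"

definition at_risk_indicator :: "(real \<Rightarrow> 'a \<Rightarrow> real) \<Rightarrow> real \<Rightarrow> 'a \<Rightarrow> real" where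
  "at_risk_indicator Y s \<omega> = (if Y s \<omega> > 0 then 1 else 0)"

text \<open>
  The path of \<open>N\<close> is extended constantly outside \<open>[0,T]\<close>, so \<open>interval_measure\<close> yields its
  Lebesgue-Stieltjes measure \<open>dN\<close> on \<open>[0,T]\<close> (without an atom at \<open>0\<close>).
  The convention \<open>J / Y = 0\<close> for \<open>Y = 0\<close> is that of division in HOL.
\<close>

definition twin_estimator ::
  "real \<Rightarrow> (real \<Rightarrow> real \<Rightarrow> real) \<Rightarrow> (real \<Rightarrow> real) \<Rightarrow> (real \<Rightarrow> real) \<Rightarrow> (nat \<Rightarrow> real)
     \<Rightarrow> (real \<Rightarrow> 'a \<Rightarrow> real) \<Rightarrow> (real \<Rightarrow> 'a \<Rightarrow> real) \<Rightarrow> nat \<Rightarrow> real \<Rightarrow> 'a \<Rightarrow> real" where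
  "twin_estimator T d \<phi> K h N Y j t \<omega> =
     (LINT s:{0..T}|interval_measure (\<lambda>x. N (max 0 (min x T)) \<omega>).
        twin_kernel T d \<phi> K h j t s * (at_risk_indicator Y s \<omega> / Y s \<omega>))"

definition twin_holder ::
  "real \<Rightarrow> (real \<Rightarrow> real \<Rightarrow> real) \<Rightarrow> (real \<Rightarrow> real) \<Rightarrow> (real \<Rightarrow> real) \<Rightarrow> (nat \<Rightarrow> real)
     \<Rightarrow> real \<Rightarrow> (real \<Rightarrow> real) \<Rightarrow> bool" where
  "twin_holder T d \<phi> K h s \<alpha> \<longleftrightarrow>
     (\<exists>C. \<forall>j. L2_norm T (\<lambda>t. twin_smooth T d \<phi> K h \<alpha> j t - \<alpha> t) \<le> ennreal (C * h j powr s))"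

text \<open>
  \<open>Var(\<alpha>\<^sub>j(t) | Y)\<close> for the estimator \<open>\<alpha>\<^sub>j\<close> is given by the formula
  \<open>\<integral> K\<^sub>j(t,s)\<^sup>2 J(s) / Y(s)\<^sup>2 \<lambda>(s) ds\<close> with \<open>\<lambda> = \<alpha> Y\<close>, i.e. by the predictable
  variation at \<open>T\<close> of the martingale part of the estimator. That formula is used as its meaning.
\<close>

definition twin_cond_variance ::
  "real \<Rightarrow> (real \<Rightarrow> real \<Rightarrow> real) \<Rightarrow> (real \<Rightarrow> real) \<Rightarrow> (real \<Rightarrow> real) \<Rightarrow> (nat \<Rightarrow> real)
     \<Rightarrow> (real \<Rightarrow> real) \<Rightarrow> (real \<Rightarrow> 'a \<Rightarrow> real) \<Rightarrow> nat \<Rightarrow> real \<Rightarrow> 'a \<Rightarrow> real" where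
  "twin_cond_variance T d \<phi> K h \<alpha> Y j t \<omega> =
     (LINT s:{0..T}|lborel.
        (twin_kernel T d \<phi> K h j t s)\<^sup>2 * (at_risk_indicator Y s \<omega> / (Y s \<omega>)\<^sup>2) * (\<alpha> s * Y s \<omega>))"

definition effective_dimension ::
  "(nat \<Rightarrow> 'a measure) \<Rightarrow> real \<Rightarrow> (real \<Rightarrow> real \<Rightarrow> real) \<Rightarrow> (real \<Rightarrow> real) \<Rightarrow> (real \<Rightarrow> real)
     \<Rightarrow> (nat \<Rightarrow> real) \<Rightarrow> (real \<Rightarrow> real) \<Rightarrow> (nat \<Rightarrow> real \<Rightarrow> 'a \<Rightarrow> real) \<Rightarrow> real \<Rightarrow> bool" where
  "effective_dimension P T d \<phi> K h \<alpha> Y deff \<longleftrightarrow>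
     0 \<le> deff \<and>
     (\<exists>C. \<forall>n\<ge>1. \<forall>j. \<forall>t\<in>{0..T}. AE \<omega> in P n.
        twin_cond_variance T d \<phi> K h \<alpha> (Y n) j t \<omega>
          \<le> C * (sup_norm K)\<^sup>2 * \<alpha> t / (real n * h j powr deff))"

end

theory Submission
  imports Defs
begin

text \<open>
  The error of the estimator at \<open>t\<close> is the sum of a stochastic term, the integral of the predictable
  function \<open>H\<^sub>t u = K\<^sub>j(t,u) / Y u\<close> against the martingale \<open>M = N - \<integral> \<alpha> Y du\<close>, and of the deterministic
  bias \<open>\<alpha>\<^sub>j t - \<alpha> t\<close>. The twin-Hoelder condition bounds the squared bias in \<open>L\<^sup>2\<close> by a multiple of
  \<open>h j powr (2 * s)\<close>. The second moment of the stochastic term is at most the mean of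
  \<open>\<integral> H\<^sub>t\<^sup>2 \<alpha> Y du\<close>, the conditional variance, which by definition of the effective dimension,
  and since \<open>\<alpha>\<close> is bounded, is at most a multiple of \<open>1 / (n * h j powr deff)\<close>. The bandwidth of
  the theorem makes the two bounds equal up to a constant.

  The substance is the inequality \<open>E (\<integral> H dM)\<^sup>2 \<le> E \<integral> H\<^sup>2 \<alpha> Y du\<close> for a bounded predictable \<open>H\<close>, the lemma
  \<open>compensated_second_moment\<close>. Because the paths of \<open>N\<close> are finite sums of unit jumps, all integrals
  exist path by path. Pathwise, the square of \<open>X = \<integral> H dM\<close> equals \<open>2 \<integral> X\<^sub>- H dM + \<integral> H\<^sup>2 dN\<close>
  (lemma \<open>sqr_integral_difference\<close>). In the mean, \<open>dN\<close>
  and \<open>\<alpha> Y du\<close> agree on predictable integrands (lemma \<open>stopped_mean_eq\<close>): on the rectangles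
  \<open>(s,t] \<times> A\<close> with \<open>A\<close> known at time \<open>s\<close> this is the martingale property, and these generate the
  predictable sets. Since \<open>X\<^sub>-\<close> is predictable (lemma \<open>left_integral_predictable\<close>), the first term has
  mean zero and the second has the mean of \<open>\<integral> H\<^sup>2 \<alpha> Y du\<close>.

  The process \<open>M\<close> is only a local martingale and \<open>Y\<close> is not bounded above, so \<open>N\<close> and its compensator
  need not have finite means. The argument is therefore carried out up to stopping times at which
  both are bounded (lemma \<open>localizing_sequence\<close>), which requires optional stopping for a
  right-continuous martingale on an interval (lemma \<open>martingale_optional_stopping\<close>), and Fatou's lemma
  removes the stopping.
\<close>

section \<open>Finite kernels on the real line\<close>

text \<open>
  A finite kernel becomes a subprobability kernel after division by one plus its total mass; for
  subprobability kernels measurability of integrals is known, and the total mass is measurable as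
  the limit of the distribution function.
\<close>

lemma kernel_nn_integral_measurable:
  fixes \<kappa> :: "'b \<Rightarrow> real measure" and f :: "'b \<Rightarrow> real \<Rightarrow> ennreal"
  assumes fin: "\<And>x. x \<in> space M \<Longrightarrow> finite_measure (\<kappa> x)"
    and sets_\<kappa>: "\<And>x. x \<in> space M \<Longrightarrow> sets (\<kappa> x) = sets borel"
    and cdf: "\<And>t. (\<lambda>x. emeasure (\<kappa> x) {..t}) \<in> borel_measurable M"
    and f: "(\<lambda>(x, u). f x u) \<in> borel_measurable (M \<Otimes>\<^sub>M borel)"
  shows "(\<lambda>x. \<integral>\<^sup>+ u. f x u \<partial>\<kappa> x) \<in> borel_measurable M"
proof -
  have total: "(\<lambda>x. emeasure (\<kappa> x) UNIV) \<in> borel_measurable M"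
  proof -
    have "(\<lambda>x. SUP n::nat. emeasure (\<kappa> x) {..real n}) \<in> borel_measurable M"
      using cdf by measurable
    moreover have "emeasure (\<kappa> x) UNIV = (SUP n::nat. emeasure (\<kappa> x) {..real n})" if "x \<in> space M" for x
    proof -
      have "(SUP n::nat. emeasure (\<kappa> x) {..real n}) = emeasure (\<kappa> x) (\<Union>n::nat. {..real n})"
        by (rule SUP_emeasure_incseq) (auto simp: sets_\<kappa>[OF that] incseq_def)
      moreover have "(\<Union>n::nat. {..real n}) = UNIV"
        by (auto simp: real_arch_simple)
      ultimately show ?thesis by simp
    qed
    ultimately show ?thesis by (simp cong: measurable_cong)
  qed
  define c where "c x = 1 + emeasure (\<kappa> x) UNIV" for x
  have c_meas[measurable]: "c \<in> borel_measurable M"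
    unfolding c_def using total by measurable
  have c: "c x \<noteq> 0" "c x \<noteq> \<top>" if "x \<in> space M" for x
    using finite_measure.emeasure_finite[OF fin[OF that], of UNIV] by (auto simp: c_def)
  define L where "L x = scale_measure (1 / c x) (\<kappa> x)" for x
  have L: "L \<in> measurable M (subprob_algebra borel)"
  proof (rule measurable_subprob_algebra_generated[where G="range (\<lambda>a::real. {..a})" and \<Omega>=UNIV])
    show "sets borel = sigma_sets UNIV (range (\<lambda>a::real. {..a}))"
      by (subst borel_eq_atMost) simp
    show "Int_stable (range (\<lambda>a::real. {..a}))"
      by (auto simp: Int_stable_def intro!: image_eqI[where x="min _ _"])
    show "subprob_space (L x)" if x: "x \<in> space M" for x
    proof
      have sp: "space (\<kappa> x) = UNIV"
        using sets_eq_imp_space_eq[OF sets_\<kappa>[OF x]] by simp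
      have "emeasure (\<kappa> x) UNIV \<le> c x" by (auto simp: c_def)
      then have "1 / c x * emeasure (\<kappa> x) UNIV \<le> 1 / c x * c x"
        by (intro mult_left_mono) auto
      also have "\<dots> = 1" using c[OF x]
        by (simp add: ennreal_divide_times ennreal_divide_self less_top)
      finally show "emeasure (L x) (space (L x)) \<le> 1"
        by (simp add: L_def space_scale_measure sp)
      show "space (L x) \<noteq> {}" by (simp add: L_def space_scale_measure sp)
    qed
    show "sets (L x) = sets borel" if "x \<in> space M" for x
      using sets_\<kappa>[OF that] by (simp add: L_def)
    show "(\<lambda>x. emeasure (L x) A) \<in> borel_measurable M" if "A \<in> range (\<lambda>a::real. {..a})" for A
      using that cdf by (auto simp: L_def)
    show "(\<lambda>x. emeasure (L x) UNIV) \<in> borel_measurable M"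
      using total by (auto simp: L_def)
  qed auto
  have "(\<lambda>x. c x * (\<integral>\<^sup>+ u. f x u \<partial>L x)) \<in> borel_measurable M"
    using nn_integral_measurable_subprob_algebra2[OF f L] by measurable
  moreover have "c x * (\<integral>\<^sup>+ u. f x u \<partial>L x) = (\<integral>\<^sup>+ u. f x u \<partial>\<kappa> x)" if x: "x \<in> space M" for x
  proof -
    have "(\<lambda>u. f x u) \<in> borel_measurable (\<kappa> x)"
      using measurable_Pair2[OF f x] sets_\<kappa>[OF x] by (simp cong: measurable_cong_sets)
    then have "(\<integral>\<^sup>+ u. f x u \<partial>L x) = 1 / c x * (\<integral>\<^sup>+ u. f x u \<partial>\<kappa> x)"
      by (simp add: L_def nn_integral_scale_measure)
    then show ?thesis using c[OF x]
      by (metis (no_types, lifting) ennreal_divide_times ennreal_divide_self mult.assoc mult.commute mult_1 top.not_eq_extremum)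
  qed
  ultimately show ?thesis by (simp cong: measurable_cong)
qed

lemma integrable_bounded_borel:
  fixes g :: "real \<Rightarrow> real"
  assumes "finite_measure \<mu>" "sets \<mu> = sets borel" "g \<in> borel_measurable borel" "\<And>u. \<bar>g u\<bar> \<le> c"
  shows "integrable \<mu> g"
  using assms by (intro finite_measure.integrable_const_bound[where B=c]) (auto cong: measurable_cong_sets)

section \<open>Integration by parts for a difference of measures\<close>

text \<open>
  The product is an integral over the plane, which is cut into the two open half planes and the
  diagonal; Fubini turns the two half planes into iterated integrals.
\<close>

lemma prod_integrals_by_order:
  fixes g h :: "real \<Rightarrow> real"
  assumes fin: "finite_measure \<mu>" "finite_measure \<nu>"
    and sets: "sets \<mu> = sets borel" "sets \<nu> = sets borel"
    and meas[measurable]: "g \<in> borel_measurable borel" "h \<in> borel_measurable borel"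
    and bd: "\<And>u. \<bar>g u\<bar> \<le> c" "\<And>u. \<bar>h u\<bar> \<le> c"
  shows "(\<integral>u. g u \<partial>\<mu>) * (\<integral>v. h v \<partial>\<nu>) =
      (\<integral>u. g u * (\<integral>v. h v * indicator {..<u} v \<partial>\<nu>) \<partial>\<mu>)
    + (\<integral>v. h v * (\<integral>u. g u * indicator {..<v} u \<partial>\<mu>) \<partial>\<nu>)
    + (\<integral>u. g u * h u * measure \<nu> {u} \<partial>\<mu>)"
proof -
  interpret M: finite_measure \<mu> by fact
  interpret N: finite_measure \<nu> by fact
  interpret pair_sigma_finite \<mu> \<nu> ..
  note [measurable_cong] = sets
  have c: "0 \<le> c" using bd(1)[of 0] by linarith
  have fin_pair: "finite_measure (\<mu> \<Otimes>\<^sub>M \<nu>)"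
    by (intro finite_measure_pair_measure) fact+
  have bint: "integrable (\<mu> \<Otimes>\<^sub>M \<nu>) k" if "k \<in> borel_measurable (\<mu> \<Otimes>\<^sub>M \<nu>)" "\<And>x. \<bar>k x\<bar> \<le> c * c"
    for k :: "real \<times> real \<Rightarrow> real"
    using that by (intro finite_measure.integrable_const_bound[OF fin_pair, where B="c*c"]) auto
  have gh: "\<bar>g u * h v * indicator A w\<bar> \<le> c * c" for u v w and A :: "real set"
    using mult_mono[OF bd(1)[of u] bd(2)[of v]] c by (auto simp: abs_mult indicator_def)
  define k1 where "k1 u v = g u * h v * indicator {..<u} v" for u v
  define k2 where "k2 u v = g u * h v * indicator {u} v" for u v
  define k3 where "k3 u v = g u * h v * indicator {..<v} u" for u v
  have k1m[measurable]: "case_prod k1 \<in> borel_measurable (\<mu> \<Otimes>\<^sub>M \<nu>)"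
    unfolding k1_def indicator_def lessThan_def mem_Collect_eq by measurable
  have k2m[measurable]: "case_prod k2 \<in> borel_measurable (\<mu> \<Otimes>\<^sub>M \<nu>)"
    unfolding k2_def indicator_def singleton_iff by measurable
  have k3m[measurable]: "case_prod k3 \<in> borel_measurable (\<mu> \<Otimes>\<^sub>M \<nu>)"
    unfolding k3_def indicator_def lessThan_def mem_Collect_eq by measurable
  have i: "integrable (\<mu> \<Otimes>\<^sub>M \<nu>) (case_prod k1)" "integrable (\<mu> \<Otimes>\<^sub>M \<nu>) (case_prod k2)"
    "integrable (\<mu> \<Otimes>\<^sub>M \<nu>) (case_prod k3)"
    by (auto intro!: bint gh k1m k2m k3m simp: k1_def k2_def k3_def)
  have sec: "integrable \<nu> (k1 u)" "integrable \<nu> (k2 u)" "integrable \<nu> (k3 u)" for u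
  proof -
    have "k1 u \<in> borel_measurable borel" "k2 u \<in> borel_measurable borel" "k3 u \<in> borel_measurable borel"
      using measurable_Pair2[OF k1m, of u] measurable_Pair2[OF k2m, of u] measurable_Pair2[OF k3m, of u]
        sets_eq_imp_space_eq[OF sets(1)] by (auto cong: measurable_cong_sets)
    then show "integrable \<nu> (k1 u)" "integrable \<nu> (k2 u)" "integrable \<nu> (k3 u)"
      by (auto intro!: integrable_bounded_borel[where c="c*c"] fin sets gh simp: k1_def k2_def k3_def)
  qed
  have "(\<integral>u. g u \<partial>\<mu>) * (\<integral>v. h v \<partial>\<nu>) = (\<integral>u. (\<integral>v. g u * h v \<partial>\<nu>) \<partial>\<mu>)"
    by simp
  also have "\<dots> = (\<integral>u. (\<integral>v. k1 u v \<partial>\<nu>) + (\<integral>v. k2 u v \<partial>\<nu>) + (\<integral>v. k3 u v \<partial>\<nu>) \<partial>\<mu>)"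
  proof (rule Bochner_Integration.integral_cong[OF refl])
    fix u
    have "(\<integral>v. g u * h v \<partial>\<nu>) = (\<integral>v. k1 u v + k2 u v + k3 u v \<partial>\<nu>)"
      by (rule Bochner_Integration.integral_cong) (auto simp: k1_def k2_def k3_def indicator_def)
    also have "\<dots> = (\<integral>v. k1 u v \<partial>\<nu>) + (\<integral>v. k2 u v \<partial>\<nu>) + (\<integral>v. k3 u v \<partial>\<nu>)"
      using sec by simp
    finally show "(\<integral>v. g u * h v \<partial>\<nu>) = (\<integral>v. k1 u v \<partial>\<nu>) + (\<integral>v. k2 u v \<partial>\<nu>) + (\<integral>v. k3 u v \<partial>\<nu>)" .
  qed
  also have "\<dots> = (\<integral>u. (\<integral>v. k1 u v \<partial>\<nu>) \<partial>\<mu>) + (\<integral>u. (\<integral>v. k2 u v \<partial>\<nu>) \<partial>\<mu>) + (\<integral>u. (\<integral>v. k3 u v \<partial>\<nu>) \<partial>\<mu>)"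
    using integrable_fst'[OF i(1)] integrable_fst'[OF i(2)] integrable_fst'[OF i(3)] by simp
  also have "(\<integral>u. (\<integral>v. k3 u v \<partial>\<nu>) \<partial>\<mu>) = (\<integral>v. (\<integral>u. k3 u v \<partial>\<mu>) \<partial>\<nu>)"
    using Fubini_integral[OF i(3)] by simp
  also have "\<dots> = (\<integral>v. h v * (\<integral>u. g u * indicator {..<v} u \<partial>\<mu>) \<partial>\<nu>)"
    unfolding k3_def by (intro Bochner_Integration.integral_cong refl)
      (simp flip: Bochner_Integration.integral_mult_right_zero add: ac_simps)
  also have "(\<integral>u. (\<integral>v. k1 u v \<partial>\<nu>) \<partial>\<mu>) = (\<integral>u. g u * (\<integral>v. h v * indicator {..<u} v \<partial>\<nu>) \<partial>\<mu>)"
    unfolding k1_def by (intro Bochner_Integration.integral_cong refl)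
      (simp flip: Bochner_Integration.integral_mult_right_zero add: ac_simps)
  also have "(\<integral>u. (\<integral>v. k2 u v \<partial>\<nu>) \<partial>\<mu>) = (\<integral>u. g u * h u * measure \<nu> {u} \<partial>\<mu>)"
  proof (intro Bochner_Integration.integral_cong refl)
    fix u
    have "(\<integral>v. k2 u v \<partial>\<nu>) = (\<integral>v. g u * h u * indicator {u} v \<partial>\<nu>)"
      by (intro Bochner_Integration.integral_cong refl) (auto simp: k2_def indicator_def)
    also have "\<dots> = g u * h u * measure \<nu> {u}"
      using sets_eq_imp_space_eq[OF sets(2)] by simp
    finally show "(\<integral>v. k2 u v \<partial>\<nu>) = g u * h u * measure \<nu> {u}" .
  qed
  finally show ?thesis by simp
qed

text \<open>
  This is the pathwise formula \<open>X\<^sup>2 = 2 \<integral> X\<^sub>- dX + [X]\<close> for \<open>X = \<integral> g d(\<nu> - l)\<close>: the measure \<open>\<nu>\<close>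
  is carried by atoms of mass one and \<open>l\<close> has none, so the quadratic variation is \<open>\<integral> g\<^sup>2 d\<nu>\<close>. In
  the proof the three products that make up the square are ordered separately; only the square of
  the \<open>\<nu>\<close>-integral sees the diagonal.
\<close>

lemma sqr_integral_difference:
  fixes g :: "real \<Rightarrow> real"
  assumes fin: "finite_measure \<nu>" "finite_measure l"
    and sets: "sets \<nu> = sets borel" "sets l = sets borel"
    and meas[measurable]: "g \<in> borel_measurable borel"
    and bd: "\<And>u. \<bar>g u\<bar> \<le> c"
    and atoms: "AE u in \<nu>. measure \<nu> {u} = 1" and diffuse: "\<And>u. measure l {u} = 0"
  defines "X \<equiv> \<lambda>s. (\<integral>u. g u * indicator {..<s} u \<partial>\<nu>) - (\<integral>u. g u * indicator {..<s} u \<partial>l)"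
  shows "((\<integral>u. g u \<partial>\<nu>) - (\<integral>u. g u \<partial>l))\<^sup>2 =
    2 * ((\<integral>s. g s * X s \<partial>\<nu>) - (\<integral>s. g s * X s \<partial>l)) + (\<integral>u. (g u)\<^sup>2 \<partial>\<nu>)"
proof -
  interpret N: finite_measure \<nu> by fact
  interpret L: finite_measure l by fact
  define A where "A s = (\<integral>u. g u * indicator {..<s} u \<partial>\<nu>)" for s
  define B where "B s = (\<integral>u. g u * indicator {..<s} u \<partial>l)" for s
  have c: "0 \<le> c" using bd[of 0] by linarith
  have part: "(\<lambda>s. \<integral>u. g u * indicator {..<s} u \<partial>m) \<in> borel_measurable borel"
    "\<bar>\<integral>u. g u * indicator {..<s} u \<partial>m\<bar> \<le> c * measure m UNIV"
    if m: "finite_measure m" "sets m = sets borel" for m s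
  proof -
    interpret finite_measure m by fact
    have [measurable_cong]: "sets m = sets borel" by fact
    have "(\<lambda>(s, u). g u * indicator {..<s} u) \<in> borel_measurable (borel \<Otimes>\<^sub>M m)"
      unfolding indicator_def lessThan_def mem_Collect_eq by measurable
    then show "(\<lambda>s. \<integral>u. g u * indicator {..<s} u \<partial>m) \<in> borel_measurable borel"
      by (rule borel_measurable_lebesgue_integral)
    have "\<bar>\<integral>u. g u * indicator {..<s} u \<partial>m\<bar> \<le> (\<integral>u. \<bar>g u * indicator {..<s} u\<bar> \<partial>m)"
      using integral_norm_bound[of m "\<lambda>u. g u * indicator {..<s} u"] by simp
    also have "\<dots> \<le> (\<integral>u. c \<partial>m)"
      using bd c by (intro integral_mono_AE integrable_bounded_borel[where c=c] m)
        (auto simp: indicator_def)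
    also have "\<dots> = c * measure m UNIV" using sets_eq_imp_space_eq[OF m(2)] by simp
    finally show "\<bar>\<integral>u. g u * indicator {..<s} u \<partial>m\<bar> \<le> c * measure m UNIV" .
  qed
  have [measurable]: "A \<in> borel_measurable borel" "B \<in> borel_measurable borel"
    using part(1)[OF fin(1) sets(1)] part(1)[OF fin(2) sets(2)] by (simp_all add: A_def[abs_def] B_def[abs_def])
  have bdA: "\<bar>g s * A s\<bar> \<le> c * (c * measure \<nu> UNIV)" "\<bar>g s * B s\<bar> \<le> c * (c * measure l UNIV)" for s
    using part(2)[OF fin(1) sets(1), of s] part(2)[OF fin(2) sets(2), of s] bd[of s] c
    by (auto simp: A_def B_def abs_mult intro!: mult_mono)
  have int: "integrable m (\<lambda>s. g s * A s)" "integrable m (\<lambda>s. g s * B s)"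
    if "finite_measure m" "sets m = sets borel" for m
    using that bdA by (auto intro!: integrable_bounded_borel)
  have aa: "(\<integral>u. g u \<partial>\<nu>)\<^sup>2 = 2 * (\<integral>s. g s * A s \<partial>\<nu>) + (\<integral>u. (g u)\<^sup>2 \<partial>\<nu>)"
  proof -
    have [measurable_cong]: "sets \<nu> = sets borel" by fact
    have "(\<lambda>(u, v). indicator {u} v :: real) \<in> borel_measurable (borel \<Otimes>\<^sub>M \<nu>)"
      unfolding indicator_def singleton_iff by measurable
    from N.borel_measurable_lebesgue_integral[OF this]
    have [measurable]: "(\<lambda>u. measure \<nu> {u}) \<in> borel_measurable borel"
      using sets_eq_imp_space_eq[OF sets(1)] by simp
    have "(\<integral>u. g u * g u * measure \<nu> {u} \<partial>\<nu>) = (\<integral>u. (g u)\<^sup>2 \<partial>\<nu>)"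
      using atoms sets(1)
      by (intro integral_cong_AE)
        (auto simp: power2_eq_square cong: measurable_cong_sets intro!: borel_measurable_times)
    then show ?thesis
      using prod_integrals_by_order[OF fin(1) fin(1) sets(1) sets(1) meas meas bd bd]
      by (simp add: A_def power2_eq_square)
  qed
  have bb: "(\<integral>u. g u \<partial>l)\<^sup>2 = 2 * (\<integral>s. g s * B s \<partial>l)"
    using prod_integrals_by_order[OF fin(2) fin(2) sets(2) sets(2) meas meas bd bd]
    by (simp add: B_def power2_eq_square diffuse)
  have ab: "(\<integral>u. g u \<partial>\<nu>) * (\<integral>u. g u \<partial>l) = (\<integral>s. g s * B s \<partial>\<nu>) + (\<integral>s. g s * A s \<partial>l)"
    using prod_integrals_by_order[OF fin(1) fin(2) sets(1) sets(2) meas meas bd bd]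
    by (simp add: A_def B_def diffuse)
  have X: "X s = A s - B s" for s by (simp add: X_def A_def B_def)
  show ?thesis
    using aa bb ab int[OF fin(1) sets(1)] int[OF fin(2) sets(2)]
    by (simp add: X power2_diff right_diff_distrib algebra_simps)
qed

section \<open>Counting paths as sums of unit point masses\<close>

text \<open>
  Between two points of the finite exceptional set a path is constant, and right-continuity extends
  this to the left end point. So a path changes only at exceptional points, where it jumps by zero or
  one; the induction removes the last exceptional point up to \<open>t\<close>.
\<close>

lemma counting_path_mono:
  fixes f :: "real \<Rightarrow> real"
  assumes cadlag: "cadlag_on T f" and pc: "piecewise_constant_on T f"
    and jumps: "\<And>t. t \<in> {0<..T} \<Longrightarrow> f t - Lim (at_left t) f \<in> {0, 1}"
    and st: "0 \<le> s" "s \<le> t" "t \<le> T"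
  shows "f s \<le> f t"
proof -
  obtain S where S: "finite S"
    "\<And>s t. 0 \<le> s \<Longrightarrow> s \<le> t \<Longrightarrow> t \<le> T \<Longrightarrow> {s..t} \<inter> S = {} \<Longrightarrow> f s = f t"
    using pc unfolding piecewise_constant_on_def by blast
  have flat: "f s = f t" if "0 \<le> s" "s \<le> t" "t \<le> T" "S \<inter> {s<..t} = {}" for s t
  proof (cases "s = t")
    case False
    with that have lt: "s < t" by simp
    have "(f \<longlongrightarrow> f s) (at_right s)"
      using cadlag that lt by (auto simp: cadlag_on_def continuous_within)
    moreover have "\<forall>\<^sub>F r in at_right s. f r = f t"
      unfolding eventually_at_right_field
      using lt that by (intro exI[of _ t]) (auto intro!: S(2))
    then have "(f \<longlongrightarrow> f t) (at_right s)" by (rule tendsto_eventually)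
    ultimately show ?thesis by (rule tendsto_unique[rotated]) simp
  qed simp
  show ?thesis using st
  proof (induction "card (S \<inter> {s<..t})" arbitrary: t rule: less_induct)
    case less
    show ?case
    proof (cases "S \<inter> {s<..t} = {}")
      case True
      with flat[of s t] less.prems show ?thesis by simp
    next
      case False
      define u where "u = Max (S \<inter> {s<..t})"
      have uM: "u \<in> S \<inter> {s<..t}" unfolding u_def using S(1) False by (intro Max_in) auto
      have umax: "r \<le> u" if "r \<in> S" "s < r" "r \<le> t" for r
        unfolding u_def using S(1) that by (intro Max_ge) auto
      have ut: "f u = f t"
      proof (rule flat)
        show "S \<inter> {u<..t} = {}"
        proof (rule equals0I)
          fix r assume "r \<in> S \<inter> {u<..t}"
          with umax[of r] uM show False by simp
        qed
      qed (use uM less.prems in simp_all)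
      define v where "v = Max (insert s (S \<inter> {s<..<u}))"
      have vM: "v \<in> insert s (S \<inter> {s<..<u})" unfolding v_def using S(1) by (intro Max_in) auto
      then have vu: "v < u" "s \<le> v" using uM by auto
      have vmax: "r \<le> v" if "r \<in> S" "s < r" "r < u" for r
        unfolding v_def using S(1) that by (intro Max_ge) auto
      define r0 where "r0 = (v + u) / 2"
      have r0: "v < r0" "r0 < u" using vu by (auto simp: r0_def)
      have const: "f r = f r0" if that: "r0 \<le> r" "r < u" for r
      proof (rule flat[symmetric])
        show "S \<inter> {r0<..r} = {}"
        proof (rule equals0I)
          fix x assume "x \<in> S \<inter> {r0<..r}"
          with vmax[of x] that r0 vu show False by simp
        qed
      qed (use that r0 vu uM less.prems in simp_all)
      have "\<forall>\<^sub>F r in at_left u. f r = f r0"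
        unfolding eventually_at_left_field
        by (intro exI[of _ r0] conjI allI impI const) (use r0 in auto)
      then have "(f \<longlongrightarrow> f r0) (at_left u)" by (rule tendsto_eventually)
      then have "Lim (at_left u) f = f r0" by (intro tendsto_Lim) auto
      then have "f r0 \<le> f u" using jumps[of u] uM less.prems by auto
      moreover have "f s \<le> f r0"
      proof (rule less.hyps)
        show "card (S \<inter> {s<..r0}) < card (S \<inter> {s<..t})"
        proof (rule psubset_card_mono)
          have "u \<notin> S \<inter> {s<..r0}" using r0 by simp
          then show "S \<inter> {s<..r0} \<subset> S \<inter> {s<..t}"
            using uM r0 by (intro psubsetI notI) (simp add: subset_iff, blast)
        qed (use S(1) in simp)
      qed (use r0 vu uM less.prems in auto)
      ultimately show ?thesis using ut by simp
    qed
  qed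
qed

text \<open>
  The Lebesgue-Stieltjes measure of a counting path is a finite sum of unit point masses: an atom has
  the size of the jump there, which is zero or one, and no mass lies off the exceptional set.
\<close>

lemma counting_path_measure:
  fixes f :: "real \<Rightarrow> real"
  assumes T: "0 < T" and f0: "f 0 = 0" and cadlag: "cadlag_on T f" and pc: "piecewise_constant_on T f"
    and jumps: "\<And>t. t \<in> {0<..T} \<Longrightarrow> f t - Lim (at_left t) f \<in> {0, 1}"
  defines "\<nu> \<equiv> interval_measure (\<lambda>x. f (max 0 (min x T)))"
  shows "finite_measure \<nu>"
    and "emeasure \<nu> {..t} = ennreal (f (max 0 (min t T)))"
    and "measure \<nu> {t} \<le> 1"
    and "AE u in \<nu>. measure \<nu> {u} = 1"
proof -
  define g where "g x = f (max 0 (min x T))" for x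
  have mono: "g x \<le> g y" if "x \<le> y" for x y
    unfolding g_def using that T by (intro counting_path_mono[OF cadlag pc jumps]) auto
  have rc: "continuous (at_right a) g" for a
  proof -
    consider "a < 0" | "0 \<le> a" "a < T" | "T \<le> a" by linarith
    then show ?thesis
    proof cases
      case 1
      then have "\<forall>\<^sub>F r in at_right a. g r = g a"
        unfolding eventually_at_right_field using T by (intro exI[of _ 0]) (auto simp: g_def max_def)
      then show ?thesis unfolding continuous_within by (rule tendsto_eventually)
    next
      case 2
      then have "(f \<longlongrightarrow> f a) (at_right a)"
        using cadlag by (auto simp: cadlag_on_def continuous_within)
      moreover have "\<forall>\<^sub>F r in at_right a. f r = g r"
        unfolding eventually_at_right_field using 2 by (intro exI[of _ T]) (auto simp: g_def max_def)
      ultimately have "(g \<longlongrightarrow> f a) (at_right a)" by (rule Lim_transform_eventually)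
      then show ?thesis using 2 by (simp add: continuous_within g_def max_def)
    next
      case 3
      then have "\<forall>\<^sub>F r in at_right a. g r = g a"
        unfolding eventually_at_right_field by (intro exI[of _ "a + 1"]) (auto simp: g_def max_def)
      then show ?thesis unfolding continuous_within by (rule tendsto_eventually)
    qed
  qed
  have bot: "(g \<longlongrightarrow> 0) at_bot"
  proof (rule tendsto_eventually)
    show "\<forall>\<^sub>F x in at_bot. g x = 0"
      unfolding eventually_at_bot_linorder using T f0 by (intro exI[of _ 0]) (auto simp: g_def max_def)
  qed
  have top: "(g \<longlongrightarrow> g T) at_top"
  proof (rule tendsto_eventually)
    show "\<forall>\<^sub>F x in at_top. g x = g T"
      unfolding eventually_at_top_linorder by (intro exI[of _ T]) (auto simp: g_def min_def)
  qed
  have g0: "g x = 0" if "x \<le> 0" for x using that T f0 by (simp add: g_def max_def)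
  have gnn: "0 \<le> g x" for x using mono[of "min x 0" x] g0[of "min x 0"] by auto
  have \<nu>: "\<nu> = interval_measure g" by (simp add: \<nu>_def g_def[abs_def])
  interpret finite_borel_measure \<nu>
    unfolding \<nu> by (rule finite_borel_measure_interval_measure[OF mono rc bot top]) (use gnn in auto)
  show "finite_measure \<nu>" by unfold_locales
  have Iic: "emeasure \<nu> {..x} = ennreal (g x)" for x
    unfolding \<nu> by (rule emeasure_interval_measure_Iic[OF mono rc bot])
  then show "emeasure \<nu> {..t} = ennreal (f (max 0 (min t T)))" by (simp add: g_def)
  have cdf: "cdf \<nu> = g"
    unfolding \<nu> by (rule cdf_interval_measure[OF mono rc bot])
  have atom: "measure \<nu> {u} = g u - measure \<nu> {..<u}" for u
  proof -
    have "{..u} = {..<u} \<union> {u}" by auto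
    then have "measure \<nu> {..u} = measure \<nu> {..<u} + measure \<nu> {u}"
      using finite_measure_Union[of "{..<u}" "{u}"] by (simp add: M_is_borel)
    then show ?thesis using fun_cong[OF cdf, of u] by (simp add: cdf_def)
  qed
  have left: "(g \<longlongrightarrow> measure \<nu> {..<u}) (at_left u)" for u
    using cdf_at_left[of u] by (simp add: cdf)
  have atom01: "measure \<nu> {u} \<in> {0, 1}" for u
  proof -
    consider "u \<le> 0" | "0 < u" "u \<le> T" | "T < u" by linarith
    then show ?thesis
    proof cases
      case 1
      have "measure \<nu> {u} \<le> g u" by (simp add: atom)
      then show ?thesis using g0[OF 1] measure_nonneg[of \<nu> "{u}"] by auto
    next
      case 2
      have "\<forall>\<^sub>F r in at_left u. g r = f r"
        unfolding eventually_at_left_field using 2 by (intro exI[of _ 0]) (auto simp: g_def max_def)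
      with left[of u] have "(f \<longlongrightarrow> measure \<nu> {..<u}) (at_left u)" by (rule Lim_transform_eventually)
      then have "Lim (at_left u) f = measure \<nu> {..<u}" by (intro tendsto_Lim) auto
      moreover have "g u = f u" using 2 by (simp add: g_def)
      ultimately show ?thesis using jumps[of u] 2 by (simp add: atom)
    next
      case 3
      have "\<forall>\<^sub>F r in at_left u. g r = g u"
        unfolding eventually_at_left_field using 3 by (intro exI[of _ T]) (auto simp: g_def max_def)
      then have "(g \<longlongrightarrow> g u) (at_left u)" by (rule tendsto_eventually)
      with left[of u] have "measure \<nu> {..<u} = g u" by (rule tendsto_unique[rotated]) simp
      then show ?thesis by (simp add: atom)
    qed
  qed
  show "measure \<nu> {t} \<le> 1" using atom01[of t] by auto
  have Ioc0: "emeasure \<nu> {p<..q} = 0" if "g p = g q" for p q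
    using that by (cases "p \<le> q") (auto simp: \<nu> emeasure_interval_measure_Ioc[OF _ mono rc])
  obtain S where S: "finite S"
    "\<And>s t. 0 \<le> s \<Longrightarrow> s \<le> t \<Longrightarrow> t \<le> T \<Longrightarrow> {s..t} \<inter> S = {} \<Longrightarrow> f s = f t"
    using pc unfolding piecewise_constant_on_def by blast
  \<comment> \<open>Countably many intervals on which the path is flat cover the complement of \<open>S\<close> in \<open>(0,T]\<close>.
    The end point \<open>T\<close> is admitted on the right since it need not be rational.\<close>
  define I where "I = {(p, q). p \<in> \<rat> \<and> q \<in> insert T \<rat> \<and> 0 \<le> p \<and> p \<le> q \<and> q \<le> T \<and> {p..q} \<inter> S = {}}"
  have "countable I"
    by (rule countable_subset[of _ "\<rat> \<times> insert T \<rat>"]) (auto simp: I_def intro!: countable_SIGMA countable_insert countable_rat)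
  moreover have "emeasure \<nu> {fst i<..snd i} = 0" if "i \<in> I" for i
    using that S(2)[of "fst i" "snd i"] by (intro Ioc0) (auto simp: I_def g_def split: prod.splits)
  ultimately have "AE u in \<nu>. \<forall>i\<in>I. u \<notin> {fst i<..snd i}"
    by (simp only: AE_ball_countable) (intro ballI AE_not_in, simp add: null_sets_def M_is_borel)
  moreover have "AE u in \<nu>. u \<notin> {..0}"
    by (intro AE_not_in) (auto simp: null_sets_def Iic g0 M_is_borel)
  moreover have "AE u in \<nu>. u \<notin> {T<..}"
  proof -
    have "{T<..} = (\<Union>n::nat. {T<..real n})" by (auto simp: real_arch_simple)
    moreover have "emeasure \<nu> {T<..real n} = 0" for n
      using Ioc0[of T "real n"] by (cases "real n \<le> T") (auto simp: g_def)
    then have "(\<Union>n::nat. {T<..real n}) \<in> null_sets \<nu>"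
      by (intro null_sets_UN) (simp add: null_sets_def M_is_borel)
    ultimately have "{T<..} \<in> null_sets \<nu>" by simp
    then show ?thesis by (rule AE_not_in)
  qed
  moreover have "AE u in \<nu>. \<forall>x\<in>{x\<in>S. measure \<nu> {x} = 0}. u \<noteq> x"
  proof (subst AE_ball_countable)
    show "countable {x \<in> S. measure \<nu> {x} = 0}" using S(1) by (simp add: countable_finite)
    have "AE u in \<nu>. u \<notin> {x}" if "measure \<nu> {x} = 0" for x
      using that by (intro AE_not_in) (simp add: null_sets_def M_is_borel emeasure_eq_measure)
    then show "\<forall>x\<in>{x \<in> S. measure \<nu> {x} = 0}. AE u in \<nu>. u \<noteq> x" by simp
  qed
  ultimately show "AE u in \<nu>. measure \<nu> {u} = 1"
  proof eventually_elim
    case (elim u)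
    have "u \<in> S"
    proof (rule ccontr)
      assume "u \<notin> S"
      have "open (- S)" using S(1) by (simp add: finite_imp_closed open_Compl)
      then obtain e where e: "e > 0" "ball u e \<subseteq> - S"
        using \<open>u \<notin> S\<close> by (meson ComplI open_contains_ball)
      obtain p where p: "p \<in> \<rat>" "max 0 (u - e) < p" "p < u"
        using Rats_dense_in_real[of "max 0 (u - e)" u] elim e by auto
      obtain q where q: "q \<in> insert T \<rat>" "u \<le> q" "q < u + e" "q \<le> T"
      proof (cases "u = T")
        case True
        then show ?thesis using that[of T] e by auto
      next
        case False
        then obtain q where "q \<in> \<rat>" "u < q" "q < min T (u + e)"
          using Rats_dense_in_real[of u "min T (u + e)"] elim e by auto
        then show ?thesis using that[of q] by auto
      qed
      have "{p..q} \<subseteq> ball u e" using p q by (auto simp: dist_real_def)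
      then have "(p, q) \<in> I" using p q e by (auto simp: I_def)
      with elim have "u \<notin> {fst (p, q)<..snd (p, q)}" by blast
      then show False using p q by simp
    qed
    then show ?case using elim atom01[of u] by auto
  qed
qed

section \<open>Predictable sets\<close>

locale filtered_prob_space = prob_space P for P :: "'a measure" +
  fixes T :: real and F :: "real \<Rightarrow> 'a measure"
  assumes T_pos: "0 < T" and usual: "usual_filtration P T F"
begin

abbreviation "pred_sigma \<equiv> predictable_sigma P T F"

lemma space_F: "space (F t) = space P"
  using usual by (auto simp: usual_filtration_def subalgebra_def)

lemma sets_F_P: "A \<in> sets (F t) \<Longrightarrow> A \<in> sets P"
  using usual by (auto simp: usual_filtration_def subalgebra_def)

lemma sets_F_mono: "s \<le> t \<Longrightarrow> A \<in> sets (F s) \<Longrightarrow> A \<in> sets (F t)"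
  using usual filtration.sets_F_mono[of "space P" F s t] by (auto simp: usual_filtration_def)

lemma measurable_F_mono: "s \<le> t \<Longrightarrow> f \<in> measurable (F s) N \<Longrightarrow> f \<in> measurable (F t) N"
  by (auto simp: measurable_def space_F intro: sets_F_mono)

lemma measurable_F_P: "f \<in> measurable (F s) N \<Longrightarrow> f \<in> measurable P N"
  by (auto simp: measurable_def space_F intro: sets_F_P)

definition "pred_rectangles =
  {{0} \<times> A | A. A \<in> sets (F 0)} \<union>
  {{s<..t} \<times> A | s t A. 0 \<le> s \<and> s \<le> t \<and> t \<le> T \<and> A \<in> sets (F s)}"

lemma pred_rectangles_cases:
  assumes "R \<in> pred_rectangles"
  obtains A where "R = {0} \<times> A" "A \<in> sets (F 0)"
  | s t A where "R = {s<..t} \<times> A" "0 \<le> s" "s \<le> t" "t \<le> T" "A \<in> sets (F s)"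
  using assms unfolding pred_rectangles_def by blast

lemma pred_rectanglesI:
  "A \<in> sets (F 0) \<Longrightarrow> {0} \<times> A \<in> pred_rectangles"
  "0 \<le> s \<Longrightarrow> s \<le> t \<Longrightarrow> t \<le> T \<Longrightarrow> A \<in> sets (F s) \<Longrightarrow> {s<..t} \<times> A \<in> pred_rectangles"
  unfolding pred_rectangles_def by blast+

lemma sets_F_into_space: "A \<in> sets (F t) \<Longrightarrow> A \<subseteq> space P"
  using sets.sets_into_space[of A "F t"] by (simp add: space_F)

lemma pred_rectangles_Pow: "pred_rectangles \<subseteq> Pow ({0..T} \<times> space P)"
proof
  fix R assume "R \<in> pred_rectangles"
  then show "R \<in> Pow ({0..T} \<times> space P)"
    using T_pos by (cases rule: pred_rectangles_cases) (auto dest: sets_F_into_space)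
qed

lemma space_pred: "space pred_sigma = {0..T} \<times> space P"
  unfolding predictable_sigma_def by (simp add: space_measure_of_conv)

lemma sets_pred: "sets pred_sigma = sigma_sets ({0..T} \<times> space P) pred_rectangles"
  unfolding predictable_sigma_def using pred_rectangles_Pow
  by (simp add: sets_measure_of pred_rectangles_def)

lemma pred_rectangles_Int_stable: "Int_stable pred_rectangles"
proof (rule Int_stableI)
  fix A B assume A: "A \<in> pred_rectangles" and B: "B \<in> pred_rectangles"
  have emp: "{} \<in> pred_rectangles" using pred_rectanglesI(1)[of "{}"] by simp
  from A show "A \<inter> B \<in> pred_rectangles"
  proof (cases rule: pred_rectangles_cases)
    case A: (1 A')
    from B show ?thesis
    proof (cases rule: pred_rectangles_cases)
      case (1 B')
      with A have "A \<inter> B = {0} \<times> (A' \<inter> B')" by auto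
      with A 1 show ?thesis by (simp add: pred_rectanglesI)
    next
      case 2
      with A have "A \<inter> B = {}" by auto
      with emp show ?thesis by simp
    qed
  next
    case A: (2 s t A')
    from B show ?thesis
    proof (cases rule: pred_rectangles_cases)
      case 1
      with A have "A \<inter> B = {}" by auto
      with emp show ?thesis by simp
    next
      case B: (2 s' t' B')
      show ?thesis
      proof (cases "max s s' \<le> min t t'")
        case True
        have "A \<inter> B = {max s s'<..min t t'} \<times> (A' \<inter> B')" using A(1) B(1) by auto
        moreover have "A' \<inter> B' \<in> sets (F (max s s'))"
          using A B sets_F_mono[of s "max s s'" A'] sets_F_mono[of s' "max s s'" B'] by auto
        ultimately show ?thesis using A B True by (simp add: pred_rectanglesI)
      next
        case False
        then have "A \<inter> B = {}" using A(1) B(1) by auto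
        with emp show ?thesis by simp
      qed
    qed
  qed
qed

text \<open>
  A predictable set is progressively measurable: up to time \<open>t\<close> it only looks at \<open>F t\<close>. This holds
  for the generating rectangles and passes to complements and unions.
\<close>

lemma pred_product_sets:
  assumes "A \<in> sets pred_sigma" "t \<in> {0..T}"
  shows "A \<inter> ({0..t} \<times> space P) \<in> sets (borel \<Otimes>\<^sub>M F t)"
  using assms(1) unfolding sets_pred
proof (induction rule: sigma_sets.induct)
  case (Basic a)
  then show ?case
  proof (cases rule: pred_rectangles_cases)
    case (1 A')
    then have "a \<inter> ({0..t} \<times> space P) = {0} \<times> A'"
      using assms(2) sets.sets_into_space[OF 1(2)] by (auto simp: space_F)
    then show ?thesis using 1 assms(2) sets_F_mono[of 0 t A'] by auto
  next
    case (2 s r A')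
    show ?thesis
    proof (cases "s \<le> t")
      case True
      have "a \<inter> ({0..t} \<times> space P) = {s<..min r t} \<times> A'"
        using 2 sets.sets_into_space[OF 2(5)] by (auto simp: space_F)
      then show ?thesis using 2 sets_F_mono[OF True 2(5)] by auto
    next
      case False
      then have "a \<inter> ({0..t} \<times> space P) = {}" using 2 by auto
      then show ?thesis by simp
    qed
  qed
next
  case (Compl a)
  have "({0..T} \<times> space P - a) \<inter> ({0..t} \<times> space P) = {0..t} \<times> space P - a \<inter> ({0..t} \<times> space P)"
    using assms(2) by auto
  moreover have "{0..t} \<times> space P \<in> sets (borel \<Otimes>\<^sub>M F t)"
    using sets.top[of "F t"] by (auto simp: space_F)
  ultimately show ?case using Compl.IH by auto
next
  case (Union a)
  have "(\<Union>i. a i) \<inter> ({0..t} \<times> space P) = (\<Union>i. a i \<inter> ({0..t} \<times> space P))" by auto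
  then show ?case using Union.IH by (simp only:) blast
qed simp

lemma pred_measurable_product:
  fixes f :: "real \<times> 'a \<Rightarrow> 'b::{topological_space, zero}"
  assumes f: "f \<in> borel_measurable pred_sigma" and t: "t \<in> {0..T}"
  shows "(\<lambda>x. if x \<in> {0..t} \<times> space P then f x else 0) \<in> borel_measurable (borel \<Otimes>\<^sub>M F t)"
proof -
  have sp: "{0..t} \<times> space P \<in> sets (borel \<Otimes>\<^sub>M F t)"
    using sets.top[of "F t"] by (auto simp: space_F)
  have "(\<lambda>x. x) \<in> measurable (restrict_space (borel \<Otimes>\<^sub>M F t) ({0..t} \<times> space P)) pred_sigma"
  proof (rule measurableI)
    fix A assume A: "A \<in> sets pred_sigma"
    have "(\<lambda>x. x) -` A \<inter> space (restrict_space (borel \<Otimes>\<^sub>M F t) ({0..t} \<times> space P))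
        = A \<inter> ({0..t} \<times> space P)"
      by (auto simp: space_restrict_space space_pair_measure space_F)
    then show "(\<lambda>x. x) -` A \<inter> space (restrict_space (borel \<Otimes>\<^sub>M F t) ({0..t} \<times> space P))
      \<in> sets (restrict_space (borel \<Otimes>\<^sub>M F t) ({0..t} \<times> space P))"
      using pred_product_sets[OF A t] sp by (auto simp: sets_restrict_space)
  qed (use t in \<open>auto simp: space_restrict_space space_pred\<close>)
  from measurable_compose[OF this f] show ?thesis
    using sp by (subst (asm) measurable_restrict_space_iff) auto
qed

lemma pred_measurable_product_P:
  fixes f :: "real \<times> 'a \<Rightarrow> 'b::{topological_space, zero}"
  assumes f: "f \<in> borel_measurable pred_sigma"
  shows "(\<lambda>x. if x \<in> {0..T} \<times> space P then f x else 0) \<in> borel_measurable (borel \<Otimes>\<^sub>M P)"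
proof -
  have "(\<lambda>x. x) \<in> measurable (borel \<Otimes>\<^sub>M P) (borel \<Otimes>\<^sub>M F T)"
    using sets_F_P by (intro measurable_pair_measureI)
      (auto simp: space_pair_measure space_F)
  from measurable_compose[OF this pred_measurable_product[OF f]] show ?thesis
    using T_pos by simp
qed

lemma pred_section:
  fixes f :: "real \<times> 'a \<Rightarrow> 'b::{topological_space, zero}"
  assumes f: "f \<in> borel_measurable pred_sigma" and w: "w \<in> space P"
  shows "(\<lambda>u. if u \<in> {0..T} then f (u, w) else 0) \<in> borel_measurable borel"
  using measurable_compose[OF measurable_Pair2'[OF w] pred_measurable_product_P[OF f]] w
  by (simp cong: if_cong)

end

context filtered_prob_space begin

lemma pred_section_sets:
  assumes "A \<in> sets pred_sigma"
  shows "(\<lambda>u. (u, w)) -` A \<in> sets borel"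
proof -
  have "A \<subseteq> {0..T} \<times> space P"
    using sets.sets_into_space[OF assms] by (simp add: space_pred)
  then have "A \<inter> ({0..T} \<times> space P) = A" by auto
  with pred_product_sets[OF assms, of T] T_pos have "A \<in> sets (borel \<Otimes>\<^sub>M F T)" by simp
  then show ?thesis by (rule sets_Pair2)
qed

lemma pred_rectangleI:
  assumes "0 \<le> s" "s \<le> t" "t \<le> T" "A \<in> sets (F s)"
  shows "{s<..t} \<times> A \<in> sets pred_sigma"
  unfolding sets_pred by (intro sigma_sets.Basic pred_rectanglesI assms)

text \<open>
  The section of \<open>f\<close> at \<open>w\<close>, restricted to the times strictly before \<open>s\<close>. Its integrals are left
  limits of integral processes, and these are the predictable ones.
\<close>

definition cut :: "(real \<times> 'a \<Rightarrow> 'b::zero) \<Rightarrow> real \<Rightarrow> 'a \<Rightarrow> real \<Rightarrow> 'b" where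
  "cut f s w u = (if u \<in> {0..T} \<and> u < s then f (u, w) else 0)"

end

section \<open>Adapted random measures\<close>

text \<open>
  Both the jump measure of the counting process and its compensator are of this kind, so that
  everything that does not need their connection is proved once.
\<close>

locale adapted_random_measure = filtered_prob_space P T F
  for P :: "'a measure" and T F +
  fixes \<kappa> :: "'a \<Rightarrow> real measure"
  assumes finite_\<kappa>: "w \<in> space P \<Longrightarrow> finite_measure (\<kappa> w)"
    and sets_\<kappa>: "w \<in> space P \<Longrightarrow> sets (\<kappa> w) = sets borel"
    and \<kappa>_atMost_0: "w \<in> space P \<Longrightarrow> emeasure (\<kappa> w) {..0} = 0"
    and \<kappa>_greaterThan_T: "w \<in> space P \<Longrightarrow> emeasure (\<kappa> w) {T<..} = 0"
    and adapted_\<kappa>: "t \<in> {0..T} \<Longrightarrow> (\<lambda>w. emeasure (\<kappa> w) {..t}) \<in> borel_measurable (F t)"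
begin

lemma emeasure_Ioc_adapted:
  assumes "0 \<le> s" "s \<le> t" "t \<le> T"
  shows "(\<lambda>w. emeasure (\<kappa> w) {s<..t}) \<in> borel_measurable (F t)"
proof -
  have "(\<lambda>w. emeasure (\<kappa> w) {..t} - emeasure (\<kappa> w) {..s}) \<in> borel_measurable (F t)"
    using adapted_\<kappa>[of t] measurable_F_mono[OF assms(2) adapted_\<kappa>[of s]] assms
    by (intro borel_measurable_minus_ennreal) auto
  moreover have "emeasure (\<kappa> w) {s<..t} = emeasure (\<kappa> w) {..t} - emeasure (\<kappa> w) {..s}"
    if "w \<in> space (F t)" for w
  proof -
    have w: "w \<in> space P" using that by (simp add: space_F)
    interpret finite_measure "\<kappa> w" by (rule finite_\<kappa>[OF w])
    have "{s<..t} = {..t} - {..s}" by auto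
    then show ?thesis using assms sets_\<kappa>[OF w] by (simp add: emeasure_Diff)
  qed
  ultimately show ?thesis by (simp cong: measurable_cong)
qed

text \<open>
  For a rectangle \<open>(a,b] \<times> A\<close> the left limit at \<open>s\<close> exceeds \<open>c\<close> if and only if the mass of
  \<open>(a, min b q]\<close> does so for some rational \<open>q < s\<close>. This event is known at time \<open>q\<close>, which exhibits the
  superlevel set as a countable union of predictable rectangles. Dynkin's argument extends the claim
  to all predictable sets.
\<close>

lemma left_emeasure_predictable:
  assumes "A \<in> sets pred_sigma"
  shows "(\<lambda>(s, w). emeasure (\<kappa> w) ((\<lambda>u. (u, w)) -` A \<inter> {..<s})) \<in> borel_measurable pred_sigma"
proof -
  let ?Q = "\<lambda>A. (\<lambda>(s, w). emeasure (\<kappa> w) ((\<lambda>u. (u, w)) -` A \<inter> {..<s})) \<in> borel_measurable pred_sigma"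
  have rect: "?Q ({a<..b} \<times> A)" if ab: "0 \<le> a" "a \<le> b" "b \<le> T" and A: "A \<in> sets (F a)" for a b A
  proof (rule borel_measurableI_greater)
    fix c :: ennreal
    have sec: "(\<lambda>u. (u, w)) -` ({a<..b} \<times> A) \<inter> {..<s} = (if w \<in> A then {a<..b} \<inter> {..<s} else {})" for s w
      by auto
    define E where "E q = {w \<in> space P. c < emeasure (\<kappa> w) {a<..min b q}} \<inter> A" for q
    have E: "E q \<in> sets (F q)" if q: "q \<in> {a..T}" for q
    proof -
      have "(\<lambda>w. emeasure (\<kappa> w) {a<..min b q}) \<in> borel_measurable (F q)"
        using q ab by (intro measurable_F_mono[OF _ emeasure_Ioc_adapted]) auto
      then have "{w \<in> space (F q). c < emeasure (\<kappa> w) {a<..min b q}} \<in> sets (F q)" by measurable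
      moreover have "A \<in> sets (F q)" using A q sets_F_mono[of a q A] by simp
      ultimately show ?thesis unfolding E_def space_F[of q] by (rule sets.Int)
    qed
    have "{x \<in> space pred_sigma. c < (case x of (s, w) \<Rightarrow> emeasure (\<kappa> w) ((\<lambda>u. (u, w)) -` ({a<..b} \<times> A) \<inter> {..<s}))}
        = (\<Union>q\<in>\<rat> \<inter> {a..T}. {q<..T} \<times> E q)" (is "?L = ?R")
    proof (intro equalityI subsetI)
      fix x assume x: "x \<in> ?L"
      obtain s w where [simp]: "x = (s, w)" by (cases x)
      from x have sw: "0 \<le> s" "s \<le> T" "w \<in> space P" "w \<in> A"
        and less: "c < emeasure (\<kappa> w) ({a<..b} \<inter> {..<s})"
        by (auto simp: space_pred sec split: if_splits)
      have "({a<..b} \<inter> {..<s}) = (\<Union>n::nat. {a<..b} \<inter> {..s - 1 / Suc n})"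
      proof -
        have "\<exists>n::nat. u \<le> s - 1 / Suc n" if us: "u < s" for u
        proof -
          obtain n where "inverse (real (Suc n)) < s - u" using reals_Archimedean[of "s - u"] us by auto
          then show ?thesis by (intro exI[of _ n]) (simp add: inverse_eq_divide)
        qed
        moreover have "u < s" if "u \<le> s - 1 / (1 + real n)" for u n
          using that by (smt (verit) divide_pos_pos of_nat_0_le_iff)
        ultimately show ?thesis by fastforce
      qed
      moreover have "(SUP n::nat. emeasure (\<kappa> w) ({a<..b} \<inter> {..s - 1 / Suc n}))
          = emeasure (\<kappa> w) (\<Union>n::nat. {a<..b} \<inter> {..s - 1 / Suc n})"
      proof (rule SUP_emeasure_incseq)
        have "s - 1 / real (Suc m) \<le> s - 1 / real (Suc n)" if "m \<le> n" for m n
          using that by (simp add: frac_le)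
        then show "incseq (\<lambda>n. {a<..b} \<inter> {..s - 1 / real (Suc n)})"
          unfolding incseq_def by (fastforce intro: order_trans)
      qed (auto simp: sets_\<kappa>[OF sw(3)])
      ultimately have "c < (SUP n::nat. emeasure (\<kappa> w) ({a<..b} \<inter> {..s - 1 / Suc n}))"
        using less by (simp only:)
      then obtain n :: nat where n: "c < emeasure (\<kappa> w) ({a<..b} \<inter> {..s - 1 / Suc n})"
        by (auto simp only: less_SUP_iff)
      have "s - 1 / Suc n < s" by simp
      then obtain q where q: "q \<in> \<rat>" "s - 1 / Suc n < q" "q < s"
        using Rats_dense_in_real by blast
      have "{a<..b} \<inter> {..s - 1 / Suc n} \<noteq> {}" using n by (metis emeasure_empty not_less_zero)
      then have "a < q" using q by auto
      moreover have "c < emeasure (\<kappa> w) {a<..min b q}"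
        by (rule less_le_trans[OF n], rule emeasure_mono) (use q sw in \<open>auto simp: sets_\<kappa>\<close>)
      ultimately show "x \<in> ?R" using q sw by (auto simp: E_def)
    next
      fix x assume "x \<in> ?R"
      then obtain q s w where q: "x = (s, w)" "a \<le> q" "q < s" "s \<le> T" "w \<in> A" "w \<in> space P"
        "c < emeasure (\<kappa> w) {a<..min b q}"
        by (auto simp: E_def)
      then have "c < emeasure (\<kappa> w) ({a<..b} \<inter> {..<s})"
        by (elim less_le_trans, intro emeasure_mono) (auto simp: sets_\<kappa>)
      then show "x \<in> ?L" using q ab by (auto simp: space_pred sec)
    qed
    moreover have "?R \<in> sets pred_sigma"
      using ab by (intro sets.countable_UN' countable_Int1 countable_rat)
        (auto intro!: pred_rectangleI E)
    ultimately show "?L \<in> sets pred_sigma" by simp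
  qed
  have zero: "?Q ({0} \<times> A)" for A
  proof -
    have "emeasure (\<kappa> w) ((\<lambda>u. (u, w)) -` ({0} \<times> A) \<inter> {..<s}) = 0" if "w \<in> space P" for s w
    proof -
      have "emeasure (\<kappa> w) ((\<lambda>u. (u, w)) -` ({0} \<times> A) \<inter> {..<s}) \<le> emeasure (\<kappa> w) {..0}"
        by (intro emeasure_mono) (auto simp: sets_\<kappa>[OF that])
      then show ?thesis using \<kappa>_atMost_0[OF that] by simp
    qed
    then have "(case x of (s, w) \<Rightarrow> emeasure (\<kappa> w) ((\<lambda>u. (u, w)) -` ({0} \<times> A) \<inter> {..<s})) = 0"
      if "x \<in> space pred_sigma" for x using that by (auto simp: space_pred)
    then show ?thesis by (simp cong: measurable_cong)
  qed
  have whole: "?Q ({0..T} \<times> space P)"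
  proof -
    have "(case x of (s, w) \<Rightarrow> emeasure (\<kappa> w) ((\<lambda>u. (u, w)) -` ({0<..T} \<times> space P) \<inter> {..<s})) =
      (case x of (s, w) \<Rightarrow> emeasure (\<kappa> w) ((\<lambda>u. (u, w)) -` ({0..T} \<times> space P) \<inter> {..<s}))"
      if x: "x \<in> space pred_sigma" for x
    proof -
      obtain s w where [simp]: "x = (s, w)" by (cases x)
      with x have w: "w \<in> space P" by (simp add: space_pred)
      have "AE u in \<kappa> w. u \<notin> {..0}"
        using \<kappa>_atMost_0[OF w] by (intro AE_not_in) (auto simp: null_sets_def sets_\<kappa>[OF w])
      then have "AE u in \<kappa> w. (u \<in> {0<..T} \<inter> {..<s}) = (u \<in> {0..T} \<inter> {..<s})"
        by eventually_elim auto
      then have "emeasure (\<kappa> w) ({0<..T} \<inter> {..<s}) = emeasure (\<kappa> w) ({0..T} \<inter> {..<s})"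
        by (intro emeasure_eq_AE) (auto simp: sets_\<kappa>[OF w])
      moreover have "(\<lambda>u. (u, w)) -` (B \<times> space P) = B" for B :: "real set" using w by auto
      ultimately show ?thesis by simp
    qed
    then show ?thesis
      using rect[of 0 T "space P"] T_pos sets.top[of "F 0"] by (simp add: space_F cong: measurable_cong)
  qed
  show ?thesis
    using pred_rectangles_Int_stable pred_rectangles_Pow assms[unfolded sets_pred]
  proof (induction rule: sigma_sets_induct_disjoint)
    case (basic A)
    then show ?case by (cases rule: pred_rectangles_cases) (auto simp only: intro!: rect zero)
  next
    case empty
    then show ?case by simp
  next
    case (compl A)
    have "(\<lambda>x. (case x of (s, w) \<Rightarrow> emeasure (\<kappa> w) ((\<lambda>u. (u, w)) -` ({0..T} \<times> space P) \<inter> {..<s}))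
      - (case x of (s, w) \<Rightarrow> emeasure (\<kappa> w) ((\<lambda>u. (u, w)) -` A \<inter> {..<s}))) \<in> borel_measurable pred_sigma"
      by (rule borel_measurable_minus_ennreal[OF whole compl(2)])
    moreover have "(case x of (s, w) \<Rightarrow> emeasure (\<kappa> w) ((\<lambda>u. (u, w)) -` ({0..T} \<times> space P) \<inter> {..<s}))
      - (case x of (s, w) \<Rightarrow> emeasure (\<kappa> w) ((\<lambda>u. (u, w)) -` A \<inter> {..<s}))
      = (case x of (s, w) \<Rightarrow> emeasure (\<kappa> w) ((\<lambda>u. (u, w)) -` ({0..T} \<times> space P - A) \<inter> {..<s}))"
      if x: "x \<in> space pred_sigma" for x
    proof -
      obtain s w where [simp]: "x = (s, w)" by (cases x)
      with x have w: "w \<in> space P" by (simp add: space_pred)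
      interpret finite_measure "\<kappa> w" by (rule finite_\<kappa>[OF w])
      have A: "A \<in> sets pred_sigma" using compl(1) by (simp add: sets_pred)
      have "A \<subseteq> {0..T} \<times> space P" using sets.sets_into_space[OF A] by (simp add: space_pred)
      then have sub: "(\<lambda>u. (u, w)) -` A \<inter> {..<s} \<subseteq> (\<lambda>u. (u, w)) -` ({0..T} \<times> space P) \<inter> {..<s}"
        by auto
      have eq: "(\<lambda>u. (u, w)) -` ({0..T} \<times> space P - A) \<inter> {..<s} =
        ((\<lambda>u. (u, w)) -` ({0..T} \<times> space P) \<inter> {..<s}) - ((\<lambda>u. (u, w)) -` A \<inter> {..<s})" by auto
      have m: "(\<lambda>u. (u, w)) -` ({0..T} \<times> space P) \<inter> {..<s} \<in> sets (\<kappa> w)"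
        "(\<lambda>u. (u, w)) -` A \<inter> {..<s} \<in> sets (\<kappa> w)"
        using pred_section_sets[OF A] pred_section_sets[OF sets.top] sets_\<kappa>[OF w] by (auto simp: space_pred)
      show ?thesis by (simp only: \<open>x = (s, w)\<close> prod.case eq emeasure_Diff[OF emeasure_finite[folded infinity_ennreal_def] m sub])
    qed
    ultimately show ?case by (simp cong: measurable_cong)
  next
    case (union A)
    have "(\<lambda>x. \<Sum>i. (case x of (s, w) \<Rightarrow> emeasure (\<kappa> w) ((\<lambda>u. (u, w)) -` A i \<inter> {..<s}))) \<in> borel_measurable pred_sigma"
      using union(3) by (intro borel_measurable_suminf_order)
    moreover have "(\<Sum>i. (case x of (s, w) \<Rightarrow> emeasure (\<kappa> w) ((\<lambda>u. (u, w)) -` A i \<inter> {..<s})))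
      = (case x of (s, w) \<Rightarrow> emeasure (\<kappa> w) ((\<lambda>u. (u, w)) -` (\<Union>i. A i) \<inter> {..<s}))"
      if x: "x \<in> space pred_sigma" for x
    proof -
      obtain s w where [simp]: "x = (s, w)" by (cases x)
      with x have w: "w \<in> space P" by (simp add: space_pred)
      have "A i \<in> sets pred_sigma" for i using union(2) by (auto simp: sets_pred)
      then have "(\<lambda>u. (u, w)) -` A i \<inter> {..<s} \<in> sets (\<kappa> w)" for i
        using pred_section_sets sets_\<kappa>[OF w] by auto
      then have "(\<Sum>i. emeasure (\<kappa> w) ((\<lambda>u. (u, w)) -` A i \<inter> {..<s}))
        = emeasure (\<kappa> w) (\<Union>i. (\<lambda>u. (u, w)) -` A i \<inter> {..<s})"
        using union(1) by (intro suminf_emeasure) (auto simp: disjoint_family_on_def)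
      also have "(\<Union>i. (\<lambda>u. (u, w)) -` A i \<inter> {..<s}) = (\<lambda>u. (u, w)) -` (\<Union>i. A i) \<inter> {..<s}" by auto
      finally show ?thesis by simp
    qed
    ultimately show ?case by (simp cong: measurable_cong)
  qed
qed

lemma cut_measurable:
  fixes f :: "real \<times> 'a \<Rightarrow> 'b::{topological_space, zero}"
  assumes "f \<in> borel_measurable pred_sigma" "w \<in> space P"
  shows "cut f s w \<in> borel_measurable (\<kappa> w)"
proof -
  have "(\<lambda>u. if u < s then (if u \<in> {0..T} then f (u, w) else 0) else 0) \<in> borel_measurable borel"
    using pred_section[OF assms] by measurable
  also have "(\<lambda>u. if u < s then (if u \<in> {0..T} then f (u, w) else 0) else 0) = cut f s w"
    by (auto simp: cut_def)
  finally show ?thesis using sets_\<kappa>[OF assms(2)] by (simp cong: measurable_cong_sets)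
qed

lemma left_nn_integral_predictable:
  fixes f :: "real \<times> 'a \<Rightarrow> ennreal"
  assumes "f \<in> borel_measurable pred_sigma"
  shows "(\<lambda>(s, w). \<integral>\<^sup>+u. cut f s w u \<partial>\<kappa> w) \<in> borel_measurable pred_sigma"
  using assms
proof (induction rule: borel_measurable_induct)
  case (cong f g)
  have "cut f s w = cut g s w" if "w \<in> space P" for s w
    using that cong(3) by (auto simp: cut_def space_pred)
  then have "(case x of (s, w) \<Rightarrow> \<integral>\<^sup>+u. cut f s w u \<partial>\<kappa> w) = (case x of (s, w) \<Rightarrow> \<integral>\<^sup>+u. cut g s w u \<partial>\<kappa> w)"
    if "x \<in> space pred_sigma" for x
    using that by (auto simp: space_pred)
  then show ?case using cong(4) by (simp cong: measurable_cong)
next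
  case (set A)
  have "(\<integral>\<^sup>+u. cut (indicator A) s w u \<partial>\<kappa> w) = emeasure (\<kappa> w) ((\<lambda>u. (u, w)) -` A \<inter> {..<s})"
    if w: "w \<in> space P" for s w
  proof -
    have sub: "A \<subseteq> {0..T} \<times> space P"
      using sets.sets_into_space[OF set] by (simp add: space_pred)
    have "cut (indicator A) s w = (indicator ((\<lambda>u. (u, w)) -` A \<inter> {..<s}) :: real \<Rightarrow> ennreal)"
      using sub w by (fastforce simp: cut_def indicator_def fun_eq_iff)
    then show ?thesis using pred_section_sets[OF set] sets_\<kappa>[OF w] by simp
  qed
  then have "(case x of (s, w) \<Rightarrow> \<integral>\<^sup>+u. cut (indicator A) s w u \<partial>\<kappa> w) =
      (case x of (s, w) \<Rightarrow> emeasure (\<kappa> w) ((\<lambda>u. (u, w)) -` A \<inter> {..<s}))"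
    if "x \<in> space pred_sigma" for x
    using that by (auto simp: space_pred)
  then show ?case using left_emeasure_predictable[OF set] by (simp cong: measurable_cong)
next
  case (mult u c)
  have "(\<integral>\<^sup>+v. cut (\<lambda>x. c * u x) s w v \<partial>\<kappa> w) = c * (\<integral>\<^sup>+v. cut u s w v \<partial>\<kappa> w)"
    if w: "w \<in> space P" for s w
  proof -
    have "cut (\<lambda>x. c * u x) s w = (\<lambda>v. c * cut u s w v)" by (auto simp: cut_def)
    then show ?thesis using cut_measurable[OF mult(2) w] by (simp add: nn_integral_cmult)
  qed
  then have "(case x of (s, w) \<Rightarrow> \<integral>\<^sup>+v. cut (\<lambda>x. c * u x) s w v \<partial>\<kappa> w) =
      c * (case x of (s, w) \<Rightarrow> \<integral>\<^sup>+v. cut u s w v \<partial>\<kappa> w)"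
    if "x \<in> space pred_sigma" for x
    using that by (auto simp: space_pred)
  then show ?case using mult(4) by (simp cong: measurable_cong)
next
  case (add u v)
  have "(\<integral>\<^sup>+r. cut (\<lambda>x. v x + u x) s w r \<partial>\<kappa> w) = (\<integral>\<^sup>+r. cut v s w r \<partial>\<kappa> w) + (\<integral>\<^sup>+r. cut u s w r \<partial>\<kappa> w)"
    if w: "w \<in> space P" for s w
  proof -
    have "cut (\<lambda>x. v x + u x) s w = (\<lambda>r. cut v s w r + cut u s w r)" by (auto simp: cut_def)
    then show ?thesis using cut_measurable[OF add.hyps(1) w] cut_measurable[OF add.hyps(3) w]
      by (simp add: nn_integral_add)
  qed
  then have "(case x of (s, w) \<Rightarrow> \<integral>\<^sup>+r. cut (\<lambda>x. v x + u x) s w r \<partial>\<kappa> w) =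
      (case x of (s, w) \<Rightarrow> \<integral>\<^sup>+r. cut v s w r \<partial>\<kappa> w) + (case x of (s, w) \<Rightarrow> \<integral>\<^sup>+r. cut u s w r \<partial>\<kappa> w)"
    if "x \<in> space pred_sigma" for x
    using that by (auto simp: space_pred)
  then show ?case using add.IH by (simp cong: measurable_cong)
next
  case (seq U)
  have "(\<integral>\<^sup>+r. cut (SUP i. U i) s w r \<partial>\<kappa> w) = (SUP i. \<integral>\<^sup>+r. cut (U i) s w r \<partial>\<kappa> w)"
    if w: "w \<in> space P" for s w
  proof -
    have "cut (SUP i. U i) s w r = (SUP i. cut (U i) s w r)" for r
      by (simp add: cut_def image_comp)
    moreover have "incseq (\<lambda>i. cut (U i) s w)"
      using seq.hyps(3) by (auto simp: incseq_def le_fun_def cut_def)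
    ultimately show ?thesis
      using cut_measurable[OF seq(1) w] by (simp add: nn_integral_monotone_convergence_SUP)
  qed
  then have eq: "(case x of (s, w) \<Rightarrow> \<integral>\<^sup>+r. cut (SUP i. U i) s w r \<partial>\<kappa> w) =
      (SUP i. case x of (s, w) \<Rightarrow> \<integral>\<^sup>+r. cut (U i) s w r \<partial>\<kappa> w)"
    if "x \<in> space pred_sigma" for x
    using that by (auto simp: space_pred)
  have "(\<lambda>x. SUP i. case x of (s, w) \<Rightarrow> \<integral>\<^sup>+r. cut (U i) s w r \<partial>\<kappa> w) \<in> borel_measurable pred_sigma"
    by (intro borel_measurable_SUP seq.IH) simp
  then show ?case by (rule measurable_cong[THEN iffD2, OF eq, rotated])
qed

text \<open>
  This makes \<open>X\<^sub>-\<close>, the left limit of an integral process, admissible as an integrand in the formula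
  for the square of a stochastic integral.
\<close>

lemma left_integral_predictable:
  fixes f :: "real \<times> 'a \<Rightarrow> real"
  assumes f: "f \<in> borel_measurable pred_sigma" and bd: "\<And>x. x \<in> space pred_sigma \<Longrightarrow> \<bar>f x\<bar> \<le> c"
  shows "(\<lambda>(s, w). \<integral>u. cut f s w u \<partial>\<kappa> w) \<in> borel_measurable pred_sigma"
proof -
  have "(\<lambda>x. enn2real (case x of (s, w) \<Rightarrow> \<integral>\<^sup>+u. cut (\<lambda>x. ennreal (f x)) s w u \<partial>\<kappa> w)
      - enn2real (case x of (s, w) \<Rightarrow> \<integral>\<^sup>+u. cut (\<lambda>x. ennreal (- f x)) s w u \<partial>\<kappa> w)) \<in> borel_measurable pred_sigma"
    using f by (intro borel_measurable_diff borel_measurable_enn2real left_nn_integral_predictable) auto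
  moreover have "enn2real (case x of (s, w) \<Rightarrow> \<integral>\<^sup>+u. cut (\<lambda>x. ennreal (f x)) s w u \<partial>\<kappa> w)
      - enn2real (case x of (s, w) \<Rightarrow> \<integral>\<^sup>+u. cut (\<lambda>x. ennreal (- f x)) s w u \<partial>\<kappa> w)
      = (case x of (s, w) \<Rightarrow> \<integral>u. cut f s w u \<partial>\<kappa> w)"
    if x: "x \<in> space pred_sigma" for x
  proof -
    obtain s w where [simp]: "x = (s, w)" by (cases x)
    with x have w: "w \<in> space P" by (simp add: space_pred)
    interpret finite_measure "\<kappa> w" by (rule finite_\<kappa>[OF w])
    have "\<bar>cut f s w u\<bar> \<le> \<bar>c\<bar>" for u
      using bd[of "(u, w)"] w by (auto simp: cut_def space_pred)
    then have "integrable (\<kappa> w) (cut f s w)"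
      using cut_measurable[OF f w] by (intro integrable_const_bound[where B="\<bar>c\<bar>"]) auto
    moreover have "cut (\<lambda>x. ennreal (f x)) s w = (\<lambda>u. ennreal (cut f s w u))"
      "cut (\<lambda>x. ennreal (- f x)) s w = (\<lambda>u. ennreal (- cut f s w u))"
      by (auto simp: cut_def)
    ultimately show ?thesis by (simp add: real_lebesgue_integral_def)
  qed
  ultimately show ?thesis by (simp cong: measurable_cong)
qed

lemma emeasure_atMost_measurable: "(\<lambda>w. emeasure (\<kappa> w) {..t}) \<in> borel_measurable P"
proof -
  consider "t < 0" | "t \<in> {0..T}" | "T < t" by fastforce
  then show ?thesis
  proof cases
    case 1
    have "emeasure (\<kappa> w) {..t} = 0" if w: "w \<in> space P" for w
    proof -
      have "emeasure (\<kappa> w) {..t} \<le> emeasure (\<kappa> w) {..0}"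
        using 1 by (intro emeasure_mono) (auto simp: sets_\<kappa>[OF w])
      then show ?thesis using \<kappa>_atMost_0[OF w] by simp
    qed
    then show ?thesis by (simp cong: measurable_cong)
  next
    case 2
    then show ?thesis using adapted_\<kappa> measurable_F_P by blast
  next
    case 3
    have "emeasure (\<kappa> w) {..t} = emeasure (\<kappa> w) {..T}" if w: "w \<in> space P" for w
    proof -
      have "AE u in \<kappa> w. u \<notin> {T<..}"
        using \<kappa>_greaterThan_T[OF w] by (intro AE_not_in) (auto simp: null_sets_def sets_\<kappa>[OF w])
      then have "AE u in \<kappa> w. (u \<in> {..t}) = (u \<in> {..T})"
        by eventually_elim (use 3 in auto)
      then show ?thesis by (intro emeasure_eq_AE) (auto simp: sets_\<kappa>[OF w])
    qed
    then show ?thesis using measurable_F_P[OF adapted_\<kappa>[of T]] T_pos by (simp cong: measurable_cong)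
  qed
qed

lemma nn_integral_kernel_measurable:
  fixes f :: "'b \<Rightarrow> real \<Rightarrow> ennreal"
  assumes X: "X \<in> M \<rightarrow>\<^sub>M P" and f: "(\<lambda>(x, u). f x u) \<in> borel_measurable (M \<Otimes>\<^sub>M borel)"
  shows "(\<lambda>x. \<integral>\<^sup>+u. f x u \<partial>\<kappa> (X x)) \<in> borel_measurable M"
proof (rule kernel_nn_integral_measurable[OF _ _ _ f])
  show "(\<lambda>x. emeasure (\<kappa> (X x)) {..t}) \<in> borel_measurable M" for t
    using measurable_compose[OF X emeasure_atMost_measurable] .
qed (use measurable_space[OF X] finite_\<kappa> sets_\<kappa> in auto)

lemma integral_kernel_measurable:
  fixes f :: "'b \<Rightarrow> real \<Rightarrow> real"
  assumes X: "X \<in> M \<rightarrow>\<^sub>M P" and f[measurable]: "(\<lambda>(x, u). f x u) \<in> borel_measurable (M \<Otimes>\<^sub>M borel)"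
    and bd: "\<And>x u. x \<in> space M \<Longrightarrow> \<bar>f x u\<bar> \<le> c"
  shows "(\<lambda>x. \<integral>u. f x u \<partial>\<kappa> (X x)) \<in> borel_measurable M"
proof -
  have "(\<lambda>x. enn2real (\<integral>\<^sup>+u. ennreal (f x u) \<partial>\<kappa> (X x)) - enn2real (\<integral>\<^sup>+u. ennreal (- f x u) \<partial>\<kappa> (X x)))
      \<in> borel_measurable M"
    by (intro borel_measurable_diff borel_measurable_enn2real nn_integral_kernel_measurable X) measurable
  moreover have "enn2real (\<integral>\<^sup>+u. ennreal (f x u) \<partial>\<kappa> (X x)) - enn2real (\<integral>\<^sup>+u. ennreal (- f x u) \<partial>\<kappa> (X x))
      = (\<integral>u. f x u \<partial>\<kappa> (X x))" if x: "x \<in> space M" for x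
  proof -
    have w: "X x \<in> space P" using measurable_space[OF X x] .
    have "f x \<in> borel_measurable borel" using measurable_Pair2[OF f x] by simp
    then have "integrable (\<kappa> (X x)) (f x)"
      using bd[OF x] by (intro integrable_bounded_borel[OF finite_\<kappa>[OF w] sets_\<kappa>[OF w]])
    then show ?thesis by (simp add: real_lebesgue_integral_def)
  qed
  ultimately show ?thesis by (simp cong: measurable_cong)
qed

end

section \<open>Optional stopping\<close>

text \<open>
  The excesses \<open>(\<bar>Z\<bar> - c)\<^sup>+\<close> of an integrable \<open>Z\<close> have small mean for large \<open>c\<close>, so the bound on the
  excesses of the \<open>f n\<close> is a form of uniform integrability. Truncation at \<open>c\<close> costs little uniformly
  in \<open>n\<close>, and the truncated functions converge by dominated convergence.
\<close>

lemma (in finite_measure) integral_limit_of_excess_bound: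
  fixes f :: "nat \<Rightarrow> 'a \<Rightarrow> real"
  assumes f: "\<And>n. integrable M (f n)" and g: "integrable M g" and Z: "integrable M Z"
    and lim: "AE x in M. (\<lambda>n. f n x) \<longlonglongrightarrow> g x"
    and excess: "\<And>n c. 0 \<le> c \<Longrightarrow> (\<integral>x. max 0 (\<bar>f n x\<bar> - c) \<partial>M) \<le> (\<integral>x. max 0 (\<bar>Z x\<bar> - c) \<partial>M)"
  shows "(\<lambda>n. \<integral>x. f n x \<partial>M) \<longlonglongrightarrow> (\<integral>x. g x \<partial>M)"
proof (rule LIMSEQ_I)
  fix e :: real assume e: "0 < e"
  define R where "R c = (\<lambda>x. max 0 (\<bar>Z x\<bar> - c) + max 0 (\<bar>g x\<bar> - c))" for c
  have R0: "(\<lambda>m. \<integral>x. R (real m) x \<partial>M) \<longlonglongrightarrow> (\<integral>x. 0 \<partial>M)"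
  proof (rule integral_dominated_convergence[where w="\<lambda>x. \<bar>Z x\<bar> + \<bar>g x\<bar>"])
    show "AE x in M. (\<lambda>m. R (real m) x) \<longlonglongrightarrow> 0"
    proof (rule AE_I2)
      fix x
      obtain m0 where m0: "\<bar>Z x\<bar> + \<bar>g x\<bar> \<le> real m0" using real_arch_simple by blast
      have "R (real m) x = 0" if "m \<ge> m0" for m
        using m0 of_nat_mono[OF that, where ?'a=real] unfolding R_def by linarith
      then have "\<forall>\<^sub>F m in sequentially. R (real m) x = 0"
        unfolding eventually_sequentially by blast
      then show "(\<lambda>m. R (real m) x) \<longlonglongrightarrow> 0" by (rule tendsto_eventually)
    qed
  qed (use Z g in \<open>auto simp: R_def\<close>)
  then have "\<forall>\<^sub>F m in sequentially. (\<integral>x. R (real m) x \<partial>M) < e / 2"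
    by (rule order_tendstoD) (use e in simp)
  then obtain m :: nat where m: "(\<integral>x. R (real m) x \<partial>M) < e / 2"
    unfolding eventually_sequentially by blast
  define c where "c = real m"
  have c: "0 \<le> c" by (simp add: c_def)
  define \<phi> where "\<phi> y = max (- c) (min c y)" for y :: real
  have \<phi>: "\<bar>y - \<phi> y\<bar> = max 0 (\<bar>y\<bar> - c)" for y using c by (auto simp: \<phi>_def max_def min_def)
  have \<phi>_cont: "isCont \<phi> y" for y unfolding \<phi>_def by (intro continuous_intros)
  have \<phi>_meas[measurable]: "\<phi> \<in> borel_measurable borel" unfolding \<phi>_def by measurable
  have \<phi>_bd: "\<bar>\<phi> y\<bar> \<le> c" for y using c by (auto simp: \<phi>_def)
  have [measurable]: "f n \<in> borel_measurable M" "g \<in> borel_measurable M" "Z \<in> borel_measurable M" for n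
    using f g Z by auto
  have int\<phi>: "integrable M (\<lambda>x. \<phi> (k x))" if [measurable]: "k \<in> borel_measurable M" for k
    using \<phi>_bd by (intro integrable_const_bound[where B=c]) auto
  have "(\<lambda>n. \<integral>x. \<phi> (f n x) \<partial>M) \<longlonglongrightarrow> (\<integral>x. \<phi> (g x) \<partial>M)"
  proof (rule integral_dominated_convergence[where w="\<lambda>_. c"])
    show "AE x in M. (\<lambda>n. \<phi> (f n x)) \<longlonglongrightarrow> \<phi> (g x)"
      using lim by eventually_elim (rule isCont_tendsto_compose[OF \<phi>_cont])
  qed (use \<phi>_bd in auto)
  then obtain n0 where n0: "\<And>n. n \<ge> n0 \<Longrightarrow> \<bar>(\<integral>x. \<phi> (f n x) \<partial>M) - (\<integral>x. \<phi> (g x) \<partial>M)\<bar> < e / 2"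
    using LIMSEQ_D[of _ _ "e / 2"] e by (metis half_gt_zero real_norm_def)
  have near: "\<bar>(\<integral>x. k x \<partial>M) - (\<integral>x. \<phi> (k x) \<partial>M)\<bar> \<le> (\<integral>x. max 0 (\<bar>k x\<bar> - c) \<partial>M)"
    if k: "integrable M k" for k
  proof -
    have [measurable]: "k \<in> borel_measurable M" using k by auto
    have "(\<integral>x. k x \<partial>M) - (\<integral>x. \<phi> (k x) \<partial>M) = (\<integral>x. k x - \<phi> (k x) \<partial>M)"
      using k int\<phi> by simp
    also have "\<bar>\<dots>\<bar> \<le> (\<integral>x. \<bar>k x - \<phi> (k x)\<bar> \<partial>M)"
      using integral_norm_bound[of M "\<lambda>x. k x - \<phi> (k x)"] by simp
    finally show ?thesis by (simp add: \<phi>)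
  qed
  have "(\<integral>x. R c x \<partial>M) = (\<integral>x. max 0 (\<bar>Z x\<bar> - c) \<partial>M) + (\<integral>x. max 0 (\<bar>g x\<bar> - c) \<partial>M)"
    unfolding R_def using Z g by simp
  then have "\<bar>(\<integral>x. f n x \<partial>M) - (\<integral>x. g x \<partial>M)\<bar> < e" if "n \<ge> n0" for n
    using n0[OF that] near[OF f[of n]] near[OF g] excess[OF c, of n] m unfolding c_def by linarith
  then show "\<exists>no. \<forall>n\<ge>no. norm ((\<integral>x. f n x \<partial>M) - (\<integral>x. g x \<partial>M)) < e"
    by (intro exI[of _ n0]) simp
qed

context filtered_prob_space begin

lemma integrable_indicator_mult:
  fixes f :: "'a \<Rightarrow> real"
  assumes "A \<in> sets P" "integrable P f"
  shows "integrable P (\<lambda>w. indicator A w * f w)"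
  using integrable_mult_indicator[OF assms] by simp

lemma martingale_integral:
  assumes X: "martingale_on P T F X" and rt: "0 \<le> r" "r \<le> t" "t \<le> T" and A: "A \<in> sets (F r)"
  shows "(\<integral>w. indicator A w * X t w \<partial>P) = (\<integral>w. indicator A w * X r w \<partial>P)"
proof -
  interpret finite_measure_subalgebra P "F r"
    using usual by unfold_locales (auto simp: usual_filtration_def)
  have int: "integrable P (X t)" and ce: "AE w in P. real_cond_exp P (F r) (X t) w = X r w"
    and m: "X r \<in> borel_measurable (F r)"
    using X rt by (auto simp: martingale_on_def adapted_def)
  have "(\<integral>w. indicator A w * X t w \<partial>P) = (\<integral>w. indicator A w * real_cond_exp P (F r) (X t) w \<partial>P)"
    using real_cond_exp_intA[OF int A] by (simp add: set_lebesgue_integral_def)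
  also have "\<dots> = (\<integral>w. indicator A w * X r w \<partial>P)"
    using ce measurable_F_P[OF m] sets_F_P[OF A]
    by (intro integral_cong_AE) (auto intro!: borel_measurable_times)
  finally show ?thesis .
qed

text \<open>
  The submartingale property of \<open>(\<bar>X\<bar> - c)\<^sup>+\<close>, obtained without conditional Jensen: on the sets
  \<open>{X r > c}\<close> and \<open>{X r < -c}\<close>, which are known at time \<open>r\<close>, the excess is affine in \<open>X\<close>.
\<close>

lemma martingale_excess:
  assumes X: "martingale_on P T F X" and rt: "0 \<le> r" "r \<le> t" "t \<le> T" and A: "A \<in> sets (F r)" and c: "0 \<le> c"
  shows "(\<integral>w. indicator A w * max 0 (\<bar>X r w\<bar> - c) \<partial>P) \<le> (\<integral>w. indicator A w * max 0 (\<bar>X t w\<bar> - c) \<partial>P)"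
proof -
  have m: "X r \<in> borel_measurable (F r)" and ir: "integrable P (X r)" and it: "integrable P (X t)"
    using X rt by (auto simp: martingale_on_def adapted_def)
  define U where "U = {w \<in> space (F r). c < X r w} \<inter> A"
  define V where "V = {w \<in> space (F r). X r w < - c} \<inter> A"
  have UV: "U \<in> sets (F r)" "V \<in> sets (F r)" using m A unfolding U_def V_def by measurable
  have UVP: "U \<in> sets P" "V \<in> sets P" "A \<in> sets P" using UV A by (auto intro: sets_F_P)
  have int: "integrable P (\<lambda>w. indicator B w * k w)" if "B \<in> sets P" "integrable P k" for B and k :: "'a \<Rightarrow> real"
    using that by (rule integrable_indicator_mult)
  have split: "(\<integral>w. indicator U w * (Y w - c) + indicator V w * (- Y w - c) \<partial>P) =
      (\<integral>w. indicator U w * Y w \<partial>P) - c * (\<integral>w. indicator U w \<partial>P)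
      - (\<integral>w. indicator V w * Y w \<partial>P) - c * (\<integral>w. indicator V w \<partial>P)" if Y: "integrable P Y" for Y
  proof -
    have i: "integrable P (\<lambda>w. indicator U w * Y w)" "integrable P (\<lambda>w. indicator V w * Y w)"
      "integrable P (\<lambda>w. c * indicator U w)" "integrable P (\<lambda>w. c * indicator V w)"
      using int[OF UVP(1) Y] int[OF UVP(2) Y] UVP
      by (auto intro!: integrable_real_indicator simp: less_top[symmetric])
    have "(\<integral>w. indicator U w * (Y w - c) + indicator V w * (- Y w - c) \<partial>P) =
      (\<integral>w. indicator U w * Y w - c * indicator U w - indicator V w * Y w - c * indicator V w \<partial>P)"
      by (intro Bochner_Integration.integral_cong) (auto simp: algebra_simps)
    then show ?thesis using i by simp
  qed
  have "(\<integral>w. indicator A w * max 0 (\<bar>X r w\<bar> - c) \<partial>P) =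
      (\<integral>w. indicator U w * (X r w - c) + indicator V w * (- X r w - c) \<partial>P)"
    using c sets_F_into_space[OF A]
    by (intro Bochner_Integration.integral_cong refl) (auto simp: U_def V_def indicator_def max_def space_F)
  also have "\<dots> = (\<integral>w. indicator U w * (X t w - c) + indicator V w * (- X t w - c) \<partial>P)"
    by (simp add: split[OF ir] split[OF it] martingale_integral[OF X rt UV(1)] martingale_integral[OF X rt UV(2)])
  also have "\<dots> \<le> (\<integral>w. indicator A w * max 0 (\<bar>X t w\<bar> - c) \<partial>P)"
  proof (rule integral_mono)
    show "integrable P (\<lambda>w. indicator U w * (X t w - c) + indicator V w * (- X t w - c))"
      using it UVP by (intro Bochner_Integration.integrable_add int) auto
    show "integrable P (\<lambda>w. indicator A w * max 0 (\<bar>X t w\<bar> - c))"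
      using it UVP by (intro int) auto
    show "indicator U w * (X t w - c) + indicator V w * (- X t w - c) \<le> indicator A w * max 0 (\<bar>X t w\<bar> - c)" for w
      using c by (auto simp: U_def V_def indicator_def)
  qed
  finally show ?thesis .
qed

text \<open>
  The stopping time is approximated from the right by times with values in a finite grid, for which
  the claim is a finite sum of martingale identities. The stopped values converge by right-continuity,
  and their means converge because lemma \<open>martingale_excess\<close> bounds their excesses by those of \<open>X t\<close>.
\<close>

lemma martingale_optional_stopping:
  assumes X: "martingale_on P T F X"
    and rc: "\<And>w x r. w \<in> space P \<Longrightarrow> r \<longlonglongrightarrow> x \<Longrightarrow> 0 \<le> x \<Longrightarrow> (\<And>n. x \<le> r n \<and> r n \<le> T) \<Longrightarrow> (\<lambda>n. X (r n) w) \<longlonglongrightarrow> X x w"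
    and \<sigma>: "stopping_time F \<sigma>"
    and st: "0 \<le> s" "s \<le> t" "t \<le> T"
    and B: "B \<in> sets (F s)" "\<And>w. w \<in> B \<Longrightarrow> s < \<sigma> w"
    and int: "integrable P (\<lambda>w. X (min t (\<sigma> w)) w)"
  shows "(\<integral>w. indicator B w * X (min t (\<sigma> w)) w \<partial>P) = (\<integral>w. indicator B w * X s w \<partial>P)"
proof (cases "s = t")
  case True
  then have "(\<lambda>w. indicator B w * X (min t (\<sigma> w)) w) = (\<lambda>w. indicator B w * X s w)"
    using B(2) by (fastforce simp: indicator_def min_def)
  then show ?thesis by simp
next
  case False
  with st have lt: "s < t" by simp
  define x where "x w = min t (\<sigma> w)" for w
  \<comment> \<open>The grid has mesh \<open>\<delta> n\<close>; \<open>k n w\<close> is the index of the first grid point at or after the stopping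
    time, and \<open>A n i\<close> is the event that this index is \<open>i\<close>.\<close>
  define \<delta> where "\<delta> n = (t - s) / real (Suc n)" for n
  define k where "k n w = nat \<lceil>(x w - s) / \<delta> n\<rceil>" for n w
  define u where "u n i = min t (s + \<delta> n * real i)" for n i
  define A where "A n i = {w \<in> B. k n w = i}" for n i
  define f where "f n w = (\<Sum>i\<le>Suc n. indicator (A n i) w * X (u n i) w)" for n w
  have \<delta>: "0 < \<delta> n" for n using lt by (simp add: \<delta>_def)
  have uT: "0 \<le> u n i" "u n i \<le> t" "s \<le> u n i" for n i
    using st lt \<delta>[of n] by (auto simp: u_def)
  have x: "s < x w" "x w \<le> t" if "w \<in> B" for w using B(2)[OF that] lt by (auto simp: x_def)
  have k_le: "k n w \<le> i \<longleftrightarrow> x w \<le> s + \<delta> n * real i" for n w i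
    unfolding k_def nat_ceiling_le_eq using \<delta>[of n] by (simp add: pos_divide_le_eq algebra_simps)
  have k_bd: "k n w \<le> Suc n" if "w \<in> B" for n w
    unfolding k_le using x[OF that] by (simp add: \<delta>_def)
  have A_F: "A n i \<in> sets (F (u n i))" for n i
  proof -
    have le: "{w \<in> B. k n w \<le> j} \<in> sets (F (u n j))" for j
    proof -
      have "stopping_time F (\<lambda>w. min t (\<sigma> w))"
        by (intro stopping_time_min stopping_time_const \<sigma>)
      then have "{w \<in> space (F (u n j)). x w \<le> u n j} \<in> sets (F (u n j))"
        unfolding x_def by (auto dest: stopping_timeD[where t="u n j"])
      moreover have "B \<in> sets (F (u n j))" using sets_F_mono[OF uT(3) B(1)] .
      moreover have "{w \<in> B. k n w \<le> j} = B \<inter> {w \<in> space (F (u n j)). x w \<le> u n j}"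
        using sets_F_into_space[OF B(1)] by (auto simp: k_le u_def x_def space_F)
      ultimately show ?thesis by auto
    qed
    have "{w \<in> B. k n w \<le> j} \<in> sets (F (u n i))" if "j \<le> i" for j
    proof (rule sets_F_mono[OF _ le])
      show "u n j \<le> u n i" using that \<delta>[of n]
        unfolding u_def by (intro min.mono add_left_mono mult_left_mono) auto
    qed
    then have "{w \<in> B. k n w \<le> i} - (\<Union>j<i. {w \<in> B. k n w \<le> j}) \<in> sets (F (u n i))"
      by (intro sets.Diff sets.finite_UN) auto
    also have "{w \<in> B. k n w \<le> i} - (\<Union>j<i. {w \<in> B. k n w \<le> j}) = A n i"
    proof -
      have "k n w \<le> i \<and> (\<forall>j<i. \<not> k n w \<le> j) \<longleftrightarrow> k n w = i" for w
        by (metis le_neq_implies_less order_refl not_le)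
      then show ?thesis unfolding A_def by blast
    qed
    finally show ?thesis .
  qed
  have A_P: "A n i \<in> sets P" for n i using sets_F_P[OF A_F] .
  have B_P: "B \<in> sets P" using sets_F_P[OF B(1)] .
  have single: "(\<Sum>i\<le>Suc n. indicator (A n i) w * h i) = indicator B w * h (k n w)" for n w and h :: "nat \<Rightarrow> real"
  proof (cases "w \<in> B")
    case True
    have "(\<Sum>i\<le>Suc n. indicator (A n i) w * h i) = (\<Sum>i\<le>Suc n. if i = k n w then h i else 0)"
      using True by (intro sum.cong) (auto simp: A_def)
    then show ?thesis using True k_bd[OF True, of n] by simp
  qed (simp add: A_def)
  have iX: "integrable P (X r)" if "0 \<le> r" "r \<le> T" for r
    using X that by (auto simp: martingale_on_def)
  have iu: "integrable P (X (u n i))" for n i using uT[of n i] st by (intro iX) auto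
  have f_int: "integrable P (f n)" for n
    unfolding f_def by (intro Bochner_Integration.integrable_sum integrable_indicator_mult A_P iu)
  have sumA: "(\<Sum>i\<le>Suc n. \<integral>w. indicator (A n i) w * h w \<partial>P) = (\<integral>w. indicator B w * h w \<partial>P)"
    if "integrable P h" for n and h :: "'a \<Rightarrow> real"
  proof -
    have "(\<Sum>i\<le>Suc n. \<integral>w. indicator (A n i) w * h w \<partial>P) = (\<integral>w. (\<Sum>i\<le>Suc n. indicator (A n i) w * h w) \<partial>P)"
      by (intro Bochner_Integration.integral_sum[symmetric] integrable_indicator_mult A_P that)
    then show ?thesis by (simp only: single)
  qed
  have f_const: "(\<integral>w. f n w \<partial>P) = (\<integral>w. indicator B w * X t w \<partial>P)" for n
  proof -
    have "(\<integral>w. f n w \<partial>P) = (\<Sum>i\<le>Suc n. \<integral>w. indicator (A n i) w * X (u n i) w \<partial>P)"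
      unfolding f_def by (intro Bochner_Integration.integral_sum integrable_indicator_mult A_P iu)
    also have "\<dots> = (\<Sum>i\<le>Suc n. \<integral>w. indicator (A n i) w * X t w \<partial>P)"
      by (intro sum.cong refl martingale_integral[OF X, symmetric] uT st A_F)
    finally show ?thesis using st by (simp only: sumA iX)
  qed
  have "(\<lambda>n. \<integral>w. f n w \<partial>P) \<longlonglongrightarrow> (\<integral>w. indicator B w * X (x w) w \<partial>P)"
  proof (rule integral_limit_of_excess_bound[OF f_int, where Z="\<lambda>w. indicator B w * X t w"])
    show "integrable P (\<lambda>w. indicator B w * X (x w) w)"
      using int B_P unfolding x_def by (intro integrable_indicator_mult)
    show "integrable P (\<lambda>w. indicator B w * X t w)"
      using B_P iX st by (intro integrable_indicator_mult) auto
    show "AE w in P. (\<lambda>n. f n w) \<longlonglongrightarrow> indicator B w * X (x w) w"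
    proof (rule AE_I2)
      fix w assume w: "w \<in> space P"
      show "(\<lambda>n. f n w) \<longlonglongrightarrow> indicator B w * X (x w) w"
      proof (cases "w \<in> B")
        case True
        have up: "u n (k n w) \<le> x w + \<delta> n" for n
        proof -
          have "0 < (x w - s) / \<delta> n" using x[OF True] \<delta>[of n] by simp
          then have "real (k n w) < (x w - s) / \<delta> n + 1"
            unfolding k_def by linarith
          then have "\<delta> n * real (k n w) < x w - s + \<delta> n"
            using \<delta>[of n] by (simp add: field_simps)
          then show ?thesis by (simp add: u_def)
        qed
        have lo: "x w \<le> u n (k n w)" for n
          using k_le[of n w "k n w"] x[OF True] by (simp add: u_def)
        have "(\<lambda>n. (t - s) / real (Suc n)) \<longlonglongrightarrow> 0"
          by (intro LIMSEQ_Suc lim_const_over_n)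
        then have \<delta>0: "\<delta> \<longlonglongrightarrow> 0" unfolding \<delta>_def .
        have "(\<lambda>n. x w + \<delta> n) \<longlonglongrightarrow> x w + 0" by (intro tendsto_intros \<delta>0)
        then have up_lim: "(\<lambda>n. x w + \<delta> n) \<longlonglongrightarrow> x w" by simp
        have "(\<lambda>n. u n (k n w)) \<longlonglongrightarrow> x w"
          by (rule tendsto_sandwich[OF always_eventually always_eventually tendsto_const up_lim])
            (use lo up in blast)+
        then have "(\<lambda>n. X (u n (k n w)) w) \<longlonglongrightarrow> X (x w) w"
          using lo uT(2) st x[OF True] by (intro rc[OF w]) (auto intro: order_trans)
        then show ?thesis using True unfolding f_def single by simp
      next
        case False
        then show ?thesis unfolding f_def single by simp
      qed
    qed
    fix n and c :: real assume c: "0 \<le> c"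
    have "(\<integral>w. max 0 (\<bar>f n w\<bar> - c) \<partial>P) = (\<integral>w. (\<Sum>i\<le>Suc n. indicator (A n i) w * max 0 (\<bar>X (u n i) w\<bar> - c)) \<partial>P)"
      using c unfolding f_def single by (intro Bochner_Integration.integral_cong) (auto simp: indicator_def)
    also have "\<dots> = (\<Sum>i\<le>Suc n. \<integral>w. indicator (A n i) w * max 0 (\<bar>X (u n i) w\<bar> - c) \<partial>P)"
      using iu by (intro Bochner_Integration.integral_sum integrable_indicator_mult A_P) auto
    also have "\<dots> \<le> (\<Sum>i\<le>Suc n. \<integral>w. indicator (A n i) w * max 0 (\<bar>X t w\<bar> - c) \<partial>P)"
      by (intro sum_mono martingale_excess[OF X] uT st A_F c)
    also have "\<dots> = (\<integral>w. indicator B w * max 0 (\<bar>X t w\<bar> - c) \<partial>P)"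
      using iX[of t] st by (intro sumA) auto
    also have "\<dots> = (\<integral>w. max 0 (\<bar>indicator B w * X t w\<bar> - c) \<partial>P)"
      using c by (intro Bochner_Integration.integral_cong) (auto simp: indicator_def)
    finally show "(\<integral>w. max 0 (\<bar>f n w\<bar> - c) \<partial>P) \<le> (\<integral>w. max 0 (\<bar>indicator B w * X t w\<bar> - c) \<partial>P)" .
  qed
  then have "(\<integral>w. indicator B w * X (x w) w \<partial>P) = (\<integral>w. indicator B w * X t w \<partial>P)"
    unfolding f_const by (simp add: LIMSEQ_const_iff)
  then show ?thesis
    unfolding x_def using martingale_integral[OF X st B(1)] by simp
qed

end

section \<open>Counting processes with an intensity\<close>

text \<open>
  The compensator is integrable on every path, not only almost surely, so that it is a finite measure
  everywhere; a general intensity is brought into this form by setting it to zero on a null set.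
\<close>

locale counting_model = filtered_prob_space P T F for P :: "'a measure" and T F +
  fixes N lam :: "real \<Rightarrow> 'a \<Rightarrow> real"
  assumes counting: "counting_process P T F N"
    and intensity: "has_intensity P T F N lam"
    and lam_nonneg: "t \<in> {0..T} \<Longrightarrow> w \<in> space P \<Longrightarrow> 0 \<le> lam t w"
    and lam_integrable: "w \<in> space P \<Longrightarrow> set_integrable lborel {0..T} (\<lambda>s. lam s w)"
begin

definition jump_measure :: "'a \<Rightarrow> real measure" where
  "jump_measure w = interval_measure (\<lambda>x. N (max 0 (min x T)) w)"

definition comp_measure :: "'a \<Rightarrow> real measure" where
  "comp_measure w = density lborel (\<lambda>u. if u \<in> {0..T} then ennreal (lam u w) else 0)"

lemma N_path:
  assumes "w \<in> space P"
  shows "N 0 w = 0" "cadlag_on T (\<lambda>t. N t w)" "piecewise_constant_on T (\<lambda>t. N t w)"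
    "\<And>t. t \<in> {0<..T} \<Longrightarrow> N t w - Lim (at_left t) (\<lambda>u. N u w) \<in> {0, 1}"
  using counting assms unfolding counting_process_def by blast+

lemma jump_measure_path:
  assumes w: "w \<in> space P"
  shows "finite_measure (jump_measure w)"
    and "emeasure (jump_measure w) {..t} = ennreal (N (max 0 (min t T)) w)"
    and "measure (jump_measure w) {t} \<le> 1"
    and "AE u in jump_measure w. measure (jump_measure w) {u} = 1"
  unfolding jump_measure_def
  using counting_path_measure[of T "\<lambda>t. N t w", OF T_pos N_path[OF w]] by auto

lemma N_nonneg: "w \<in> space P \<Longrightarrow> 0 \<le> t \<Longrightarrow> t \<le> T \<Longrightarrow> 0 \<le> N t w"
  using counting_path_mono[of T "\<lambda>t. N t w" 0 t, OF N_path(2-4)] N_path(1) by auto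

lemma measure_jump_atMost: "w \<in> space P \<Longrightarrow> 0 \<le> t \<Longrightarrow> t \<le> T \<Longrightarrow> measure (jump_measure w) {..t} = N t w"
  by (simp add: measure_def jump_measure_path N_nonneg max_def min_def)

lemma sets_jump [simp]: "sets (jump_measure w) = sets borel" by (simp add: jump_measure_def)

lemma sets_comp [simp]: "sets (comp_measure w) = sets borel" by (simp add: comp_measure_def)

lemma lam_pred: "(\<lambda>(t, w). lam t w) \<in> borel_measurable pred_sigma"
  using intensity by (simp add: has_intensity_def predictable_def)

lemma lam_section:
  assumes "w \<in> space P"
  shows "(\<lambda>u. if u \<in> {0..T} then lam u w else 0) \<in> borel_measurable borel"
  using pred_section[OF lam_pred assms] by (simp only: prod.case)

lemma ennreal_lam_section:
  assumes "w \<in> space P"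
  shows "(\<lambda>u. if u \<in> {0..T} then ennreal (lam u w) else 0) \<in> borel_measurable borel"
proof -
  have "(\<lambda>u. ennreal (if u \<in> {0..T} then lam u w else 0)) \<in> borel_measurable borel"
    using lam_section[OF assms] by measurable
  then show ?thesis by (simp add: if_distrib cong: if_cong)
qed

lemma nn_integral_comp:
  assumes w: "w \<in> space P" and f: "f \<in> borel_measurable borel"
  shows "(\<integral>\<^sup>+u. f u \<partial>comp_measure w) = (\<integral>\<^sup>+u\<in>{0..T}. ennreal (lam u w) * f u \<partial>lborel)"
proof -
  have "(\<integral>\<^sup>+u. f u \<partial>comp_measure w) = (\<integral>\<^sup>+u. (if u \<in> {0..T} then ennreal (lam u w) else 0) * f u \<partial>lborel)"
    unfolding comp_measure_def using ennreal_lam_section[OF w] f by (subst nn_integral_density) auto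
  also have "\<dots> = (\<integral>\<^sup>+u\<in>{0..T}. ennreal (lam u w) * f u \<partial>lborel)"
    by (intro nn_integral_cong) (auto simp: indicator_def)
  finally show ?thesis .
qed

lemma emeasure_comp:
  assumes w: "w \<in> space P" and A: "A \<in> sets borel"
  shows "emeasure (comp_measure w) A = (\<integral>\<^sup>+u\<in>{0..T} \<inter> A. ennreal (lam u w) \<partial>lborel)"
proof -
  have "emeasure (comp_measure w) A = (\<integral>\<^sup>+u. indicator A u \<partial>comp_measure w)"
    using A by simp
  also have "\<dots> = (\<integral>\<^sup>+u\<in>{0..T} \<inter> A. ennreal (lam u w) \<partial>lborel)"
    using A by (subst nn_integral_comp[OF w]) (auto simp: indicator_inter_arith ac_simps)
  finally show ?thesis .
qed

lemma nn_integral_lam: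
  assumes w: "w \<in> space P" and t: "0 \<le> t" "t \<le> T"
  shows "(\<integral>\<^sup>+u\<in>{0..t}. ennreal (lam u w) \<partial>lborel) = ennreal (LINT s:{0..t}|lborel. lam s w)"
proof -
  have int: "set_integrable lborel {0..t} (\<lambda>s. lam s w)"
    using t by (intro set_integrable_subset[OF lam_integrable[OF w]]) auto
  have "(\<integral>\<^sup>+u. ennreal (indicator {0..t} u * lam u w) \<partial>lborel) = ennreal (LINT s|lborel. indicator {0..t} s * lam s w)"
    using int t lam_nonneg w unfolding set_integrable_def
    by (intro nn_integral_eq_integral) (auto simp: indicator_def)
  moreover have "(\<integral>\<^sup>+u\<in>{0..t}. ennreal (lam u w) \<partial>lborel) = (\<integral>\<^sup>+u. ennreal (indicator {0..t} u * lam u w) \<partial>lborel)"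
    by (intro nn_integral_cong) (auto simp: indicator_def)
  ultimately show ?thesis by (simp add: set_lebesgue_integral_def)
qed

lemma finite_comp:
  assumes w: "w \<in> space P"
  shows "finite_measure (comp_measure w)"
proof
  have "emeasure (comp_measure w) UNIV = (\<integral>\<^sup>+u\<in>{0..T}. ennreal (lam u w) \<partial>lborel)"
    by (simp add: emeasure_comp[OF w])
  also have "\<dots> = ennreal (LINT s:{0..T}|lborel. lam s w)"
    using T_pos by (intro nn_integral_lam w) auto
  finally show "emeasure (comp_measure w) (space (comp_measure w)) \<noteq> \<infinity>" by (simp add: comp_measure_def)
qed

lemma emeasure_comp_singleton:
  assumes w: "w \<in> space P"
  shows "emeasure (comp_measure w) {t} = 0"
proof -
  have "AE u in lborel. u \<noteq> t" by (intro AE_lborel_singleton)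
  then have "AE u in lborel. ennreal (lam u w) * indicator ({0..T} \<inter> {t}) u = 0"
    by eventually_elim (auto simp: indicator_def)
  then have "(\<integral>\<^sup>+u\<in>{0..T} \<inter> {t}. ennreal (lam u w) \<partial>lborel) = (\<integral>\<^sup>+u. 0 \<partial>(lborel :: real measure))"
    by (rule nn_integral_cong_AE)
  then show ?thesis by (simp add: emeasure_comp[OF w])
qed

lemma measure_comp_atMost:
  assumes w: "w \<in> space P" and t: "0 \<le> t" "t \<le> T"
  shows "measure (comp_measure w) {..t} = (LINT s:{0..t}|lborel. lam s w)"
proof -
  have "{0..T} \<inter> {..t} = {0..t}" using t by auto
  then have "emeasure (comp_measure w) {..t} = ennreal (LINT s:{0..t}|lborel. lam s w)"
    using t by (simp add: emeasure_comp[OF w] nn_integral_lam[OF w])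
  moreover have "0 \<le> (LINT s:{0..t}|lborel. lam s w)"
    using t lam_nonneg[OF _ w] unfolding set_lebesgue_integral_def
    by (intro Bochner_Integration.integral_nonneg) (auto simp: indicator_def)
  ultimately show ?thesis by (simp add: measure_def)
qed

sublocale jump: adapted_random_measure P T F jump_measure
proof (intro adapted_random_measure.intro adapted_random_measure_axioms.intro filtered_prob_space_axioms)
  fix w assume w: "w \<in> space P"
  show "finite_measure (jump_measure w)" by (rule jump_measure_path[OF w])
  show "sets (jump_measure w) = sets borel" by simp
  have "N 0 w = 0" by (rule N_path[OF w])
  then show "emeasure (jump_measure w) {..0} = 0"
    using T_pos by (simp add: jump_measure_path[OF w])
  interpret finite_measure "jump_measure w" by (rule jump_measure_path[OF w])
  have "emeasure (jump_measure w) {T<..} = 0"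
  proof -
    have null: "emeasure (jump_measure w) {T<..real n} = 0" for n
    proof -
      have "emeasure (jump_measure w) ({..max T (real n)} - {..T}) = 0"
        using T_pos by (subst emeasure_Diff) (auto simp: jump_measure_path(2)[OF w])
      moreover have "{..max T (real n)} - {..T} = {T<..real n}" by (auto simp: max_def)
      ultimately show ?thesis by simp
    qed
    have "(\<Union>n::nat. {T<..real n}) \<in> null_sets (jump_measure w)"
      using null by (intro null_sets_UN) (auto simp: null_sets_def)
    moreover have "(\<Union>n::nat. {T<..real n}) = {T<..}" by (auto simp: real_arch_simple)
    ultimately show ?thesis by auto
  qed
  then show "emeasure (jump_measure w) {T<..} = 0" .
next
  fix t assume t: "t \<in> {0..T}"
  have "N t \<in> borel_measurable (F t)"
    using counting t by (auto simp: counting_process_def adapted_def)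
  then have "(\<lambda>w. ennreal (N t w)) \<in> borel_measurable (F t)" by measurable
  moreover have "emeasure (jump_measure w) {..t} = ennreal (N t w)" if "w \<in> space (F t)" for w
    using that t jump_measure_path(2)[of w t] by (simp add: space_F max_def min_def)
  ultimately show "(\<lambda>w. emeasure (jump_measure w) {..t}) \<in> borel_measurable (F t)"
    by (simp cong: measurable_cong)
qed

sublocale comp: adapted_random_measure P T F comp_measure
proof (intro adapted_random_measure.intro adapted_random_measure_axioms.intro filtered_prob_space_axioms)
  fix w assume w: "w \<in> space P"
  show "finite_measure (comp_measure w)" by (rule finite_comp[OF w])
  have "{0..T} \<inter> {..0} = {0..T} \<inter> {0}" using T_pos by auto
  then show "emeasure (comp_measure w) {..0} = 0"
    using emeasure_comp_singleton[OF w, of 0] by (simp add: emeasure_comp[OF w])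
  have "{0..T} \<inter> {T<..} = {}" by auto
  then show "emeasure (comp_measure w) {T<..} = 0" by (simp add: emeasure_comp[OF w])
next
  fix t assume t: "t \<in> {0..T}"
  define f where "f x = ennreal (if x \<in> {0..t} \<times> space P then (case x of (u, w) \<Rightarrow> lam u w) else 0)" for x
  have "f \<in> borel_measurable (borel \<Otimes>\<^sub>M F t)"
    unfolding f_def using pred_measurable_product[OF lam_pred t] by measurable
  then have "f \<in> borel_measurable (lborel \<Otimes>\<^sub>M F t)"
    by (simp only: measurable_cong_sets[OF sets_pair_measure_cong[OF sets_lborel refl] refl])
  from measurable_compose[OF measurable_pair_swap' this]
  have "(\<lambda>(w, u). f (u, w)) \<in> borel_measurable (F t \<Otimes>\<^sub>M lborel)"
    by (simp add: case_prod_beta')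
  then have "(\<lambda>w. \<integral>\<^sup>+u. f (u, w) \<partial>lborel) \<in> borel_measurable (F t)"
    by (rule lborel.borel_measurable_nn_integral)
  moreover have "emeasure (comp_measure w) {..t} = (\<integral>\<^sup>+u. f (u, w) \<partial>lborel)" if "w \<in> space (F t)" for w
    using that t by (simp add: space_F emeasure_comp, intro nn_integral_cong) (auto simp: f_def indicator_def)
  ultimately show "(\<lambda>w. emeasure (comp_measure w) {..t}) \<in> borel_measurable (F t)"
    by (simp cong: measurable_cong)
qed simp

end

context adapted_random_measure begin

abbreviation mass :: "real \<Rightarrow> 'a \<Rightarrow> real" where
  "mass t w \<equiv> measure (\<kappa> w) {..t}"

lemma finite_borel_\<kappa>: "w \<in> space P \<Longrightarrow> finite_borel_measure (\<kappa> w)"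
  using finite_\<kappa> sets_\<kappa> by (simp add: finite_borel_measure_def finite_borel_measure_axioms_def)

lemma measure_atMost_adapted: "t \<in> {0..T} \<Longrightarrow> (\<lambda>w. mass t w) \<in> borel_measurable (F t)"
  unfolding measure_def by (intro borel_measurable_enn2real adapted_\<kappa>)

lemma measure_atMost_right_seq:
  assumes w: "w \<in> space P" and r: "r \<longlonglongrightarrow> x" "\<And>n. x \<le> r n"
  shows "(\<lambda>n. mass (r n) w) \<longlonglongrightarrow> mass x w"
proof -
  interpret finite_borel_measure "\<kappa> w" by (rule finite_borel_\<kappa>[OF w])
  have "continuous (at x within {x..}) (cdf (\<kappa> w))"
    using cdf_is_right_cont[of x] by (simp add: continuous_within at_within_Ici_at_right)
  from continuous_within_tendsto_compose'[OF this _ r(1)] r(2) show ?thesis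
    by (simp add: cdf_def)
qed

lemma measure_mono_\<kappa>: "w \<in> space P \<Longrightarrow> A \<subseteq> B \<Longrightarrow> B \<in> sets borel \<Longrightarrow> measure (\<kappa> w) A \<le> measure (\<kappa> w) B"
  using finite_\<kappa> sets_\<kappa> by (intro finite_measure.finite_measure_mono) auto

lemma measure_random_atMost_measurable:
  assumes [measurable]: "\<rho> \<in> borel_measurable P"
  shows "(\<lambda>w. mass (\<rho> w) w) \<in> borel_measurable P"
proof -
  have "(\<lambda>(w, u). indicator {..\<rho> w} u :: ennreal) \<in> borel_measurable (P \<Otimes>\<^sub>M borel)"
    unfolding indicator_def atMost_def mem_Collect_eq by measurable
  then have "(\<lambda>w. enn2real (\<integral>\<^sup>+u. indicator {..\<rho> w} u \<partial>\<kappa> w)) \<in> borel_measurable P"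
    using nn_integral_kernel_measurable[of "\<lambda>w. w" P] by measurable
  moreover have "enn2real (\<integral>\<^sup>+u. indicator {..\<rho> w} u \<partial>\<kappa> w) = mass (\<rho> w) w" if "w \<in> space P" for w
    using sets_\<kappa>[OF that] by (simp add: measure_def)
  ultimately show ?thesis by (simp cong: measurable_cong)
qed

end

context counting_model begin

section \<open>Localization\<close>

abbreviation total_mass :: "real \<Rightarrow> 'a \<Rightarrow> real" where
  "total_mass t w \<equiv> jump.mass t w + comp.mass t w"

text \<open>
  The first time at which jumps and compensator together reach the level \<open>m\<close>. Adding \<open>T\<close> to the set
  makes it the value when the level is not reached.
\<close>

definition level_time :: "nat \<Rightarrow> 'a \<Rightarrow> real" where
  "level_time m w = Inf (insert T {t \<in> {0..T}. real m \<le> total_mass t w})"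

lemma level_time_bounds: "0 \<le> level_time m w" "level_time m w \<le> T"
proof -
  have bdd: "bdd_below (insert T {t \<in> {0..T}. real m \<le> total_mass t w})"
    using T_pos by (intro bdd_belowI[of _ 0]) auto
  then show "level_time m w \<le> T" unfolding level_time_def by (intro cInf_lower) auto
  show "0 \<le> level_time m w" unfolding level_time_def using T_pos by (intro cInf_greatest) auto
qed

text \<open>
  By right-continuity of the mass the level is attained at the infimum. The bound \<open>t < T\<close> excludes the
  default value \<open>T\<close>.
\<close>

lemma level_time_le_iff:
  assumes w: "w \<in> space P" and t: "0 \<le> t" "t < T"
  shows "level_time m w \<le> t \<longleftrightarrow> real m \<le> total_mass t w"
proof
  assume m: "real m \<le> total_mass t w"
  have "bdd_below (insert T {t \<in> {0..T}. real m \<le> total_mass t w})"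
    using T_pos by (intro bdd_belowI[of _ 0]) auto
  then show "level_time m w \<le> t" unfolding level_time_def using m t by (intro cInf_lower) auto
next
  assume le: "level_time m w \<le> t"
  have "\<exists>r\<in>insert T {t \<in> {0..T}. real m \<le> total_mass t w}. r < t + (T - t) / real (Suc n)" for n
    using le t unfolding level_time_def
    by (intro cInf_lessD) (auto intro: le_less_trans)
  then have "\<exists>r. \<forall>n. r n \<in> insert T {t \<in> {0..T}. real m \<le> total_mass t w} \<and> r n < t + (T - t) / real (Suc n)"
    by (intro choice) blast
  then obtain r where r: "\<And>n. r n \<in> insert T {t \<in> {0..T}. real m \<le> total_mass t w}"
    "\<And>n. r n < t + (T - t) / real (Suc n)" by blast
  define q where "q n = max t (r n)" for n
  have "(\<lambda>n. (T - t) / real (Suc n)) \<longlonglongrightarrow> 0" by (intro LIMSEQ_Suc lim_const_over_n)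
  then have "(\<lambda>n. t + (T - t) / real (Suc n)) \<longlonglongrightarrow> t + 0" by (intro tendsto_add tendsto_const)
  then have up: "(\<lambda>n. t + (T - t) / real (Suc n)) \<longlonglongrightarrow> t" by simp
  have "q \<longlonglongrightarrow> t"
  proof (rule tendsto_sandwich[OF always_eventually always_eventually tendsto_const up])
    show "\<forall>n. t \<le> q n" by (simp add: q_def)
    show "\<forall>n. q n \<le> t + (T - t) / real (Suc n)"
    proof
      fix n
      have "0 \<le> (T - t) / real (Suc n)" using t by simp
      then show "q n \<le> t + (T - t) / real (Suc n)" using r(2)[of n] by (simp add: q_def)
    qed
  qed
  moreover have "t \<le> q n" for n by (simp add: q_def)
  ultimately have lim: "(\<lambda>n. total_mass (q n) w) \<longlonglongrightarrow> total_mass t w"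
    by (intro tendsto_add jump.measure_atMost_right_seq comp.measure_atMost_right_seq w)
  have ge: "real m \<le> total_mass (q n) w" if "1 \<le> n" for n
  proof -
    have "r n \<noteq> T"
    proof -
      have "(T - t) / real (Suc n) \<le> (T - t) / 1" using that t by (intro divide_left_mono) auto
      then show ?thesis using r(2)[of n] by auto
    qed
    then have "real m \<le> total_mass (r n) w" using r(1)[of n] by auto
    also have "\<dots> \<le> total_mass (q n) w"
      by (intro add_mono jump.measure_mono_\<kappa> comp.measure_mono_\<kappa> w) (auto simp: q_def)
    finally show ?thesis .
  qed
  show "real m \<le> total_mass t w"
    by (rule LIMSEQ_le_const[OF lim]) (use ge in blast)
qed

lemma level_time_stopping: "stopping_time F (level_time m)"
proof
  fix t
  consider "t < 0" | "0 \<le> t" "t < T" | "T \<le> t" by linarith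
  then show "Measurable.pred (F t) (\<lambda>w. level_time m w \<le> t)"
  proof cases
    case 1
    then have "\<not> level_time m w \<le> t" for w using level_time_bounds(1)[of m w] by auto
    then show ?thesis by simp
  next
    case 2
    have "(\<lambda>w. total_mass t w) \<in> borel_measurable (F t)"
      using 2 by (intro borel_measurable_add jump.measure_atMost_adapted comp.measure_atMost_adapted) auto
    then have "Measurable.pred (F t) (\<lambda>w. real m \<le> total_mass t w)" by measurable
    moreover have "(level_time m w \<le> t) = (real m \<le> total_mass t w)" if "w \<in> space (F t)" for w
      using that level_time_le_iff[OF _ 2] by (simp add: space_F)
    ultimately show ?thesis by (simp cong: measurable_cong)
  next
    case 3
    then have "level_time m w \<le> t" for w using level_time_bounds(2)[of m w] by auto
    then show ?thesis by simp
  qed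
qed

text \<open>
  Strictly before the level time the mass is below the level, and the time itself adds at most one
  jump since the compensator has no atoms.
\<close>

lemma mass_level_time:
  assumes w: "w \<in> space P"
  shows "total_mass (level_time m w) w \<le> real m + 1"
proof -
  interpret J: finite_borel_measure "jump_measure w" by (rule jump.finite_borel_\<kappa>[OF w])
  interpret C: finite_borel_measure "comp_measure w" by (rule comp.finite_borel_\<kappa>[OF w])
  let ?l = "level_time m w"
  have before: "total_mass r w \<le> real m" if "r < ?l" for r
  proof (cases "0 \<le> r")
    case True
    then show ?thesis using level_time_le_iff[OF w True, of m] that level_time_bounds(2)[of m w] by auto
  next
    case False
    then have "total_mass r w \<le> total_mass 0 w"
      by (intro add_mono jump.measure_mono_\<kappa> comp.measure_mono_\<kappa> w) auto
    also have "total_mass 0 w = 0"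
      using jump.\<kappa>_atMost_0[OF w] comp.\<kappa>_atMost_0[OF w] by (simp add: measure_def)
    finally show ?thesis by simp
  qed
  have "((\<lambda>r. cdf (jump_measure w) r + cdf (comp_measure w) r) \<longlongrightarrow>
      measure (jump_measure w) {..<?l} + measure (comp_measure w) {..<?l}) (at_left ?l)"
    by (intro tendsto_add J.cdf_at_left C.cdf_at_left)
  moreover have "\<forall>\<^sub>F r in at_left ?l. cdf (jump_measure w) r + cdf (comp_measure w) r \<le> real m"
    unfolding cdf_def eventually_at_left_field by (intro exI[of _ "?l - 1"]) (use before in auto)
  ultimately have "measure (jump_measure w) {..<?l} + measure (comp_measure w) {..<?l} \<le> real m"
    by (rule tendsto_upperbound) simp
  moreover have "{..?l} = {..<?l} \<union> {?l}" by auto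
  then have "jump.mass ?l w = measure (jump_measure w) {..<?l} + measure (jump_measure w) {?l}"
    "comp.mass ?l w = measure (comp_measure w) {..<?l} + measure (comp_measure w) {?l}"
    using J.finite_measure_Union[of "{..<?l}" "{?l}"] C.finite_measure_Union[of "{..<?l}" "{?l}"] by auto
  moreover have "measure (comp_measure w) {?l} = 0"
    using emeasure_comp_singleton[OF w, of ?l] by (simp add: measure_def)
  ultimately show ?thesis using jump_measure_path(3)[OF w, of ?l] by linarith
qed

lemma compensated_eq:
  assumes "w \<in> space P" "0 \<le> t" "t \<le> T"
  shows "N t w - (LINT s:{0..t}|lborel. lam s w) = jump.mass t w - comp.mass t w"
  using assms by (simp add: measure_jump_atMost measure_comp_atMost)

text \<open>
  The given localizing times only make \<open>N - \<integral> lam\<close> a martingale, whose two parts need not be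
  integrable separately. Stopping in addition at the level times bounds both parts, and optional
  stopping preserves the identity between the means of their increments.
\<close>

lemma localizing_sequence:
  obtains \<rho> :: "nat \<Rightarrow> 'a \<Rightarrow> real" where
    "\<And>k. stopping_time F (\<rho> k)"
    "\<And>k w. w \<in> space P \<Longrightarrow> \<rho> k w \<in> {0..T}"
    "AE w in P. \<forall>\<^sub>F k in sequentially. \<rho> k w = T"
    "\<And>k w. w \<in> space P \<Longrightarrow> total_mass (\<rho> k w) w \<le> real k + 1"
    "\<And>k s t A. 0 \<le> s \<Longrightarrow> s \<le> t \<Longrightarrow> t \<le> T \<Longrightarrow> A \<in> sets (F s) \<Longrightarrow>
      (\<integral>w. indicator A w * (jump.mass (min t (\<rho> k w)) w - jump.mass (min s (\<rho> k w)) w) \<partial>P) =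
      (\<integral>w. indicator A w * (comp.mass (min t (\<rho> k w)) w - comp.mass (min s (\<rho> k w)) w) \<partial>P)"
proof -
  define M where "M t w = N t w - (LINT s:{0..t}|lborel. lam s w)" for t w
  obtain \<tau> :: "nat \<Rightarrow> 'a \<Rightarrow> real" where \<tau>: "\<And>k. stopping_time F (\<tau> k)"
    "\<And>k w. w \<in> space P \<Longrightarrow> \<tau> k w \<in> {0..T}"
    "AE w in P. \<forall>\<^sub>F k in sequentially. \<tau> k w = T"
    "\<And>k. martingale_on P T F (\<lambda>t w. M (min t (\<tau> k w)) w)"
    using intensity unfolding has_intensity_def local_martingale_on_def M_def by blast
  define \<rho> where "\<rho> k w = min (\<tau> k w) (level_time k w)" for k w
  have \<rho>: "stopping_time F (\<rho> k)" for k
    unfolding \<rho>_def by (intro stopping_time_min \<tau> level_time_stopping)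
  have \<rho>T: "0 \<le> \<rho> k w" "\<rho> k w \<le> T" if "w \<in> space P" for k w
    using \<tau>(2)[OF that, of k] level_time_bounds[of k w] by (auto simp: \<rho>_def)
  have [measurable]: "\<rho> k \<in> borel_measurable P" for k
    using \<rho> by (rule measurable_stopping_time) (auto simp: space_F intro: sets_F_P)
  have mass: "total_mass r w \<le> real k + 1" if w: "w \<in> space P" and r: "r \<le> \<rho> k w" for r w k
  proof -
    have "total_mass r w \<le> total_mass (level_time k w) w"
      using r by (intro add_mono jump.measure_mono_\<kappa> comp.measure_mono_\<kappa> w) (auto simp: \<rho>_def)
    then show ?thesis using mass_level_time[OF w, of k] by linarith
  qed
  have M: "M t w = jump.mass t w - comp.mass t w"
    if "w \<in> space P" "0 \<le> t" "t \<le> T" for t w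
    using compensated_eq[OF that] by (simp add: M_def)
  have int: "integrable P (\<lambda>w. jump.mass (min t (\<rho> k w)) w)"
    "integrable P (\<lambda>w. comp.mass (min t (\<rho> k w)) w)" for t k
  proof -
    have bd: "AE w in P. norm (jump.mass (min t (\<rho> k w)) w) \<le> real k + 1"
      "AE w in P. norm (comp.mass (min t (\<rho> k w)) w) \<le> real k + 1"
    proof (rule_tac [!] AE_I2)
      fix w assume w: "w \<in> space P"
      show "norm (jump.mass (min t (\<rho> k w)) w) \<le> real k + 1"
        "norm (comp.mass (min t (\<rho> k w)) w) \<le> real k + 1"
        using mass[OF w, of "min t (\<rho> k w)" k]
          measure_nonneg[of "jump_measure w" "{..min t (\<rho> k w)}"]
          measure_nonneg[of "comp_measure w" "{..min t (\<rho> k w)}"]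
        unfolding real_norm_def abs_of_nonneg[OF measure_nonneg] by linarith+
    qed
    show "integrable P (\<lambda>w. jump.mass (min t (\<rho> k w)) w)"
      by (rule integrable_const_bound[OF bd(1)]) (intro jump.measure_random_atMost_measurable, measurable)
    show "integrable P (\<lambda>w. comp.mass (min t (\<rho> k w)) w)"
      by (rule integrable_const_bound[OF bd(2)]) (intro comp.measure_random_atMost_measurable, measurable)
  qed
  have iM: "integrable P (\<lambda>w. M (min t (\<rho> k w)) w)" if t: "0 \<le> t" "t \<le> T" for t k
  proof -
    have "integrable P (\<lambda>w. jump.mass (min t (\<rho> k w)) w - comp.mass (min t (\<rho> k w)) w)"
      using int by (intro Bochner_Integration.integrable_diff)
    moreover have "M (min t (\<rho> k w)) w = jump.mass (min t (\<rho> k w)) w - comp.mass (min t (\<rho> k w)) w"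
      if "w \<in> space P" for w
      using \<rho>T[OF that, of k] t that by (intro M) auto
    ultimately show ?thesis by (simp cong: Bochner_Integration.integrable_cong)
  qed
  show thesis
  proof (rule that[of \<rho>])
    show "stopping_time F (\<rho> k)" for k by (rule \<rho>)
    show "\<rho> k w \<in> {0..T}" if "w \<in> space P" for k w using \<rho>T[OF that] by auto
    show "total_mass (\<rho> k w) w \<le> real k + 1" if "w \<in> space P" for k w using mass[OF that, of "\<rho> k w" k] by simp
    show "AE w in P. \<forall>\<^sub>F k in sequentially. \<rho> k w = T"
      using \<tau>(3) AE_space
    proof eventually_elim
      case (elim w)
      obtain k0 where k0: "total_mass T w < real k0" using reals_Archimedean2 by blast
      have "level_time k w = T" if "k \<ge> k0" for k
      proof -
        have lt: "total_mass T w < real k" using k0 that by (meson less_le_trans of_nat_mono)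
        have "\<not> real k \<le> total_mass r w" if "r \<le> T" for r
        proof -
          have "total_mass r w \<le> total_mass T w"
            using that elim by (intro add_mono jump.measure_mono_\<kappa> comp.measure_mono_\<kappa>) auto
          then show ?thesis using lt by linarith
        qed
        then have "insert T {t \<in> {0..T}. real k \<le> total_mass t w} = {T}" by auto
        then show ?thesis unfolding level_time_def by (simp only: cInf_singleton)
      qed
      then have "\<forall>\<^sub>F k in sequentially. level_time k w = T"
        unfolding eventually_sequentially by blast
      with elim(1) show ?case by eventually_elim (simp add: \<rho>_def)
    qed
    fix k s t A assume st: "0 \<le> s" "s \<le> t" "t \<le> T" and A: "A \<in> sets (F s)"
    \<comment> \<open>Off \<open>B\<close> the level was reached before \<open>s\<close>, so both stopped increments vanish.\<close>
    define B where "B = A \<inter> {w \<in> space (F s). s < level_time k w}"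
    have B: "B \<in> sets (F s)"
      using A stopping_timeD2[OF level_time_stopping[of k], of s] unfolding B_def by (auto simp: pred_def)
    define X where "X t w = M (min t (\<tau> k w)) w" for t w
    have "(\<integral>w. indicator B w * X (min t (level_time k w)) w \<partial>P) = (\<integral>w. indicator B w * X s w \<partial>P)"
    proof (rule martingale_optional_stopping[OF _ _ level_time_stopping st B])
      show "martingale_on P T F X" unfolding X_def by (rule \<tau>)
      show "\<And>w. w \<in> B \<Longrightarrow> s < level_time k w" by (simp add: B_def)
      show "integrable P (\<lambda>w. X (min t (level_time k w)) w)"
        using iM[of t k] st unfolding X_def \<rho>_def by (simp add: ac_simps)
      fix w x and r :: "nat \<Rightarrow> real"
      assume w: "w \<in> space P" and r: "r \<longlonglongrightarrow> x" and x: "0 \<le> x" and rx: "\<And>n. x \<le> r n \<and> r n \<le> T"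
      have x_le: "x \<le> T" using rx[of 0] by simp
      have "(\<lambda>n. jump.mass (min (r n) (\<tau> k w)) w - comp.mass (min (r n) (\<tau> k w)) w)
          \<longlonglongrightarrow> jump.mass (min x (\<tau> k w)) w - comp.mass (min x (\<tau> k w)) w"
        using rx by (intro tendsto_diff jump.measure_atMost_right_seq comp.measure_atMost_right_seq w tendsto_min r tendsto_const)
          (auto intro: min.coboundedI1)
      moreover have "X y w = jump.mass (min y (\<tau> k w)) w - comp.mass (min y (\<tau> k w)) w"
        if "x \<le> y" "y \<le> T" for y
        unfolding X_def using \<tau>(2)[OF w, of k] x that by (intro M w) auto
      ultimately show "(\<lambda>n. X (r n) w) \<longlonglongrightarrow> X x w" using rx x_le by simp
    qed
    moreover have "(\<lambda>w. indicator B w * X s w) = (\<lambda>w. indicator B w * M (min s (\<rho> k w)) w)"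
      by (auto simp: B_def X_def \<rho>_def indicator_def min_def)
    moreover have "(\<lambda>w. X (min t (level_time k w)) w) = (\<lambda>w. M (min t (\<rho> k w)) w)"
      by (simp add: X_def \<rho>_def ac_simps)
    ultimately have "(\<integral>w. indicator B w * M (min t (\<rho> k w)) w \<partial>P) = (\<integral>w. indicator B w * M (min s (\<rho> k w)) w \<partial>P)"
      by (simp only: fun_eq_iff)
    moreover have "B \<in> sets P" "A \<in> sets P" using A B by (auto intro: sets_F_P)
    moreover have "0 \<le> t" "s \<le> T" using st by auto
    ultimately have 0: "(\<integral>w. indicator B w * M (min t (\<rho> k w)) w - indicator B w * M (min s (\<rho> k w)) w \<partial>P) = 0"
      using st by (subst Bochner_Integration.integral_diff) (auto intro!: integrable_indicator_mult iM)
    have "(\<integral>w. indicator A w * (jump.mass (min t (\<rho> k w)) w - jump.mass (min s (\<rho> k w)) w)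
      - indicator A w * (comp.mass (min t (\<rho> k w)) w - comp.mass (min s (\<rho> k w)) w) \<partial>P) = 0"
    proof (subst 0[symmetric], rule Bochner_Integration.integral_cong[OF refl])
      fix w assume w: "w \<in> space P"
      show "indicator A w * (jump.mass (min t (\<rho> k w)) w - jump.mass (min s (\<rho> k w)) w)
        - indicator A w * (comp.mass (min t (\<rho> k w)) w - comp.mass (min s (\<rho> k w)) w)
        = indicator B w * M (min t (\<rho> k w)) w - indicator B w * M (min s (\<rho> k w)) w"
      proof (cases "s < level_time k w")
        case True
        have Mr: "M (min r (\<rho> k w)) w = jump.mass (min r (\<rho> k w)) w - comp.mass (min r (\<rho> k w)) w"
          if "0 \<le> r" "r \<le> T" for r
          using \<rho>T[OF w, of k] that by (intro M w) auto
        have AB: "indicator A w = (indicator B w :: real)"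
          using True w by (simp add: B_def indicator_def space_F)
        have "0 \<le> t" "s \<le> T" using st by auto
        then show ?thesis using st unfolding AB by (simp add: Mr right_diff_distrib)
      next
        case False
        then have "min t (\<rho> k w) = min s (\<rho> k w)" using st by (auto simp: \<rho>_def min_def)
        then show ?thesis by simp
      qed
    qed
    moreover have "A \<in> sets P" using A by (rule sets_F_P)
    ultimately show "(\<integral>w. indicator A w * (jump.mass (min t (\<rho> k w)) w - jump.mass (min s (\<rho> k w)) w) \<partial>P) =
      (\<integral>w. indicator A w * (comp.mass (min t (\<rho> k w)) w - comp.mass (min s (\<rho> k w)) w) \<partial>P)"
      using int by (subst (asm) Bochner_Integration.integral_diff)
        (auto intro!: integrable_indicator_mult Bochner_Integration.integrable_diff)
  qed
qed

end

context filtered_prob_space begin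

text \<open>
  The section of \<open>f\<close> at \<open>w\<close>, restricted to the times up to and including \<open>r\<close>; for a random \<open>r\<close> its
  integral is the integral process stopped at \<open>r\<close>.
\<close>

definition upto :: "(real \<times> 'a \<Rightarrow> 'b::zero) \<Rightarrow> real \<Rightarrow> 'a \<Rightarrow> real \<Rightarrow> 'b" where
  "upto f r w u = (if u \<in> {0..T} \<and> u \<le> r then f (u, w) else 0)"

lemma upto_product_measurable:
  fixes f :: "real \<times> 'a \<Rightarrow> 'b::{topological_space, zero}"
  assumes f: "f \<in> borel_measurable pred_sigma" and \<rho>[measurable]: "\<rho> \<in> borel_measurable P"
  shows "(\<lambda>(w, u). upto f (\<rho> w) w u) \<in> borel_measurable (P \<Otimes>\<^sub>M borel)"
proof -
  define g where "g x = (if (snd x, fst x) \<in> {0..T} \<times> space P then f (snd x, fst x) else 0)" for x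
  have "g \<in> borel_measurable (P \<Otimes>\<^sub>M borel)"
    using measurable_compose[OF measurable_pair_swap' pred_measurable_product_P[OF f]]
    by (simp only: case_prod_beta' g_def[abs_def])
  then have "(\<lambda>x. if snd x \<le> \<rho> (fst x) then g x else 0) \<in> borel_measurable (P \<Otimes>\<^sub>M borel)"
    by (rule measurable_If) simp_all
  moreover have "(case x of (w, u) \<Rightarrow> upto f (\<rho> w) w u) = (if snd x \<le> \<rho> (fst x) then g x else 0)"
    if "x \<in> space (P \<Otimes>\<^sub>M borel)" for x
    using that by (auto simp: upto_def g_def space_pair_measure)
  ultimately show ?thesis by (simp cong: measurable_cong)
qed

lemma upto_section_measurable:
  fixes f :: "real \<times> 'a \<Rightarrow> 'b::{topological_space, zero}"
  assumes "f \<in> borel_measurable pred_sigma" "w \<in> space P"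
  shows "upto f r w \<in> borel_measurable borel"
  using measurable_compose[OF measurable_Pair1'[OF assms(2)] upto_product_measurable[OF assms(1), of "\<lambda>_. r"]]
  by simp

text \<open>
  The complement consists of the \<open>(u, w)\<close> with \<open>\<rho> w \<le> q < u\<close> for some rational \<open>q\<close>, a countable union of
  predictable rectangles.
\<close>

lemma stochastic_interval_predictable:
  assumes \<rho>: "stopping_time F \<rho>" and nn: "\<And>w. w \<in> space P \<Longrightarrow> 0 \<le> \<rho> w"
  shows "{x \<in> space pred_sigma. fst x \<le> \<rho> (snd x)} \<in> sets pred_sigma"
proof -
  have "{x \<in> space pred_sigma. fst x \<le> \<rho> (snd x)} =
    space pred_sigma - (\<Union>q\<in>\<rat> \<inter> {0..T}. {q<..T} \<times> {w \<in> space (F q). \<rho> w \<le> q})" (is "_ = _ - ?U")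
  proof -
    have "\<rho> w < u \<longleftrightarrow> (u, w) \<in> ?U" if u: "0 \<le> u" "u \<le> T" and w: "w \<in> space P" for u w
    proof
      assume "\<rho> w < u"
      then obtain q where q: "q \<in> \<rat>" "\<rho> w < q" "q < u" using Rats_dense_in_real by blast
      then show "(u, w) \<in> ?U" using u w nn[OF w] by (auto simp: space_F intro!: bexI[of _ q])
    qed (auto simp: space_F)
    then show ?thesis by (auto simp: space_pred not_less[symmetric])
  qed
  moreover have "?U \<in> sets pred_sigma"
    using stopping_timeD[OF \<rho>]
    by (intro sets.countable_UN' countable_Int1 countable_rat) (auto intro!: pred_rectangleI simp: pred_def)
  ultimately show ?thesis by auto
qed

end

context adapted_random_measure begin

abbreviation integral_upto :: "(real \<times> 'a \<Rightarrow> real) \<Rightarrow> real \<Rightarrow> 'a \<Rightarrow> real" where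
  "integral_upto f r w \<equiv> \<integral>u. upto f r w u \<partial>\<kappa> w"

definition stopped_mean :: "('a \<Rightarrow> real) \<Rightarrow> (real \<times> 'a \<Rightarrow> ennreal) \<Rightarrow> ennreal" where
  "stopped_mean \<rho> f = (\<integral>\<^sup>+w. \<integral>\<^sup>+u. upto f (\<rho> w) w u \<partial>\<kappa> w \<partial>P)"

lemma upto_measurable_\<kappa>:
  fixes f :: "real \<times> 'a \<Rightarrow> 'b::{topological_space, zero}"
  assumes "f \<in> borel_measurable pred_sigma" "w \<in> space P"
  shows "upto f r w \<in> borel_measurable (\<kappa> w)"
  using upto_section_measurable[OF assms] sets_\<kappa>[OF assms(2)] by (simp cong: measurable_cong_sets)

lemma nn_integral_upto_measurable:
  fixes f :: "real \<times> 'a \<Rightarrow> ennreal"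
  assumes "f \<in> borel_measurable pred_sigma" "\<rho> \<in> borel_measurable P"
  shows "(\<lambda>w. \<integral>\<^sup>+u. upto f (\<rho> w) w u \<partial>\<kappa> w) \<in> borel_measurable P"
  using nn_integral_kernel_measurable[OF measurable_ident_sets[OF refl] upto_product_measurable[OF assms]] .

context
  fixes \<rho> :: "'a \<Rightarrow> real"
  assumes \<rho>_meas: "\<rho> \<in> borel_measurable P"
begin

lemma stopped_mean_add:
  assumes f: "f \<in> borel_measurable pred_sigma" and g: "g \<in> borel_measurable pred_sigma"
  shows "stopped_mean \<rho> (\<lambda>x. f x + g x) = stopped_mean \<rho> f + stopped_mean \<rho> g"
proof -
  have "stopped_mean \<rho> (\<lambda>x. f x + g x) =
      (\<integral>\<^sup>+w. (\<integral>\<^sup>+u. upto f (\<rho> w) w u \<partial>\<kappa> w) + (\<integral>\<^sup>+u. upto g (\<rho> w) w u \<partial>\<kappa> w) \<partial>P)"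
    unfolding stopped_mean_def
  proof (rule nn_integral_cong)
    fix w assume w: "w \<in> space P"
    have "upto (\<lambda>x. f x + g x) (\<rho> w) w = (\<lambda>u. upto f (\<rho> w) w u + upto g (\<rho> w) w u)"
      by (auto simp: upto_def)
    then show "(\<integral>\<^sup>+u. upto (\<lambda>x. f x + g x) (\<rho> w) w u \<partial>\<kappa> w) =
        (\<integral>\<^sup>+u. upto f (\<rho> w) w u \<partial>\<kappa> w) + (\<integral>\<^sup>+u. upto g (\<rho> w) w u \<partial>\<kappa> w)"
      using upto_measurable_\<kappa>[OF f w] upto_measurable_\<kappa>[OF g w] by (simp add: nn_integral_add)
  qed
  then show ?thesis
    using nn_integral_upto_measurable[OF f \<rho>_meas] nn_integral_upto_measurable[OF g \<rho>_meas]
    by (simp add: stopped_mean_def nn_integral_add)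
qed

lemma stopped_mean_cmult:
  assumes f: "f \<in> borel_measurable pred_sigma"
  shows "stopped_mean \<rho> (\<lambda>x. c * f x) = c * stopped_mean \<rho> f"
proof -
  have "stopped_mean \<rho> (\<lambda>x. c * f x) = (\<integral>\<^sup>+w. c * (\<integral>\<^sup>+u. upto f (\<rho> w) w u \<partial>\<kappa> w) \<partial>P)"
    unfolding stopped_mean_def
  proof (rule nn_integral_cong)
    fix w assume w: "w \<in> space P"
    have "upto (\<lambda>x. c * f x) (\<rho> w) w = (\<lambda>u. c * upto f (\<rho> w) w u)" by (auto simp: upto_def)
    then show "(\<integral>\<^sup>+u. upto (\<lambda>x. c * f x) (\<rho> w) w u \<partial>\<kappa> w) = c * (\<integral>\<^sup>+u. upto f (\<rho> w) w u \<partial>\<kappa> w)"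
      using upto_measurable_\<kappa>[OF f w] by (simp add: nn_integral_cmult)
  qed
  then show ?thesis
    using nn_integral_upto_measurable[OF f \<rho>_meas] by (simp add: stopped_mean_def nn_integral_cmult)
qed

lemma stopped_mean_SUP:
  fixes U :: "nat \<Rightarrow> real \<times> 'a \<Rightarrow> ennreal"
  assumes U: "\<And>i. U i \<in> borel_measurable pred_sigma" and inc: "incseq U"
  shows "stopped_mean \<rho> (SUP i. U i) = (SUP i. stopped_mean \<rho> (U i))"
proof -
  have inc': "incseq (\<lambda>i. upto (U i) r w)" for r w
    using inc by (auto simp: incseq_def le_fun_def upto_def)
  have "stopped_mean \<rho> (SUP i. U i) = (\<integral>\<^sup>+w. (SUP i. \<integral>\<^sup>+u. upto (U i) (\<rho> w) w u \<partial>\<kappa> w) \<partial>P)"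
    unfolding stopped_mean_def
  proof (rule nn_integral_cong)
    fix w assume w: "w \<in> space P"
    have "upto (SUP i. U i) (\<rho> w) w u = (SUP i. upto (U i) (\<rho> w) w u)" for u
      by (simp add: upto_def image_comp)
    then show "(\<integral>\<^sup>+u. upto (SUP i. U i) (\<rho> w) w u \<partial>\<kappa> w) = (SUP i. \<integral>\<^sup>+u. upto (U i) (\<rho> w) w u \<partial>\<kappa> w)"
      using upto_measurable_\<kappa>[OF U w] inc' by (simp add: nn_integral_monotone_convergence_SUP)
  qed
  also have "\<dots> = (SUP i. stopped_mean \<rho> (U i))"
    unfolding stopped_mean_def
  proof (rule nn_integral_monotone_convergence_SUP)
    show "incseq (\<lambda>i w. \<integral>\<^sup>+u. upto (U i) (\<rho> w) w u \<partial>\<kappa> w)"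
      using inc' by (auto simp: incseq_def le_fun_def intro!: nn_integral_mono)
  qed (rule nn_integral_upto_measurable[OF U \<rho>_meas])
  finally show ?thesis .
qed

lemma stopped_mean_cong:
  assumes "\<And>x. x \<in> space pred_sigma \<Longrightarrow> f x = g x"
  shows "stopped_mean \<rho> f = stopped_mean \<rho> g"
  unfolding stopped_mean_def
  by (intro nn_integral_cong) (auto simp: upto_def space_pred intro!: assms)

lemma stopped_mean_suminf:
  fixes f :: "nat \<Rightarrow> real \<times> 'a \<Rightarrow> ennreal"
  assumes f: "\<And>i. f i \<in> borel_measurable pred_sigma"
  shows "stopped_mean \<rho> (\<lambda>x. \<Sum>i. f i x) = (\<Sum>i. stopped_mean \<rho> (f i))"
proof -
  have "stopped_mean \<rho> (\<lambda>x. \<Sum>i. f i x) = (\<integral>\<^sup>+w. (\<Sum>i. \<integral>\<^sup>+u. upto (f i) (\<rho> w) w u \<partial>\<kappa> w) \<partial>P)"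
    unfolding stopped_mean_def
  proof (rule nn_integral_cong)
    fix w assume w: "w \<in> space P"
    have "upto (\<lambda>x. \<Sum>i. f i x) (\<rho> w) w = (\<lambda>u. \<Sum>i. upto (f i) (\<rho> w) w u)"
    proof
      show "upto (\<lambda>x. \<Sum>i. f i x) (\<rho> w) w u = (\<Sum>i. upto (f i) (\<rho> w) w u)" for u
        by (cases "u \<in> {0..T} \<and> u \<le> \<rho> w") (auto simp: upto_def)
    qed
    then show "(\<integral>\<^sup>+u. upto (\<lambda>x. \<Sum>i. f i x) (\<rho> w) w u \<partial>\<kappa> w) = (\<Sum>i. \<integral>\<^sup>+u. upto (f i) (\<rho> w) w u \<partial>\<kappa> w)"
      using upto_measurable_\<kappa>[OF f w] by (simp add: nn_integral_suminf)
  qed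
  then show ?thesis
    using nn_integral_upto_measurable[OF f \<rho>_meas] by (simp add: stopped_mean_def nn_integral_suminf)
qed

end

lemma integral_upto_bound:
  fixes f :: "real \<times> 'a \<Rightarrow> real"
  assumes f: "f \<in> borel_measurable pred_sigma" and bd: "\<And>x. x \<in> space pred_sigma \<Longrightarrow> \<bar>f x\<bar> \<le> c"
    and c: "0 \<le> c" and w: "w \<in> space P"
  shows "integrable (\<kappa> w) (upto f r w)" "\<bar>integral_upto f r w\<bar> \<le> c * mass r w"
proof -
  interpret finite_measure "\<kappa> w" by (rule finite_\<kappa>[OF w])
  have le: "\<bar>upto f r w u\<bar> \<le> c * indicator {..r} u" for u
    using bd[of "(u, w)"] c w by (auto simp: upto_def space_pred)
  have le': "\<bar>upto f r w u\<bar> \<le> c" for u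
    by (rule order_trans[OF le]) (simp add: indicator_def c)
  show int: "integrable (\<kappa> w) (upto f r w)"
    using upto_measurable_\<kappa>[OF f w] le' by (intro integrable_const_bound[where B=c]) auto
  have "\<bar>integral_upto f r w\<bar> \<le> (\<integral>u. \<bar>upto f r w u\<bar> \<partial>\<kappa> w)"
    using integral_norm_bound[of "\<kappa> w" "upto f r w"] by simp
  also have "\<dots> \<le> (\<integral>u. c * indicator {..r} u \<partial>\<kappa> w)"
    using int le sets_\<kappa>[OF w]
    by (intro integral_mono integrable_mult_right integrable_real_indicator) (auto simp: less_top[symmetric])
  also have "\<dots> = c * mass r w" using sets_eq_imp_space_eq[OF sets_\<kappa>[OF w]] by simp
  finally show "\<bar>integral_upto f r w\<bar> \<le> c * mass r w" .
qed

lemma integral_upto_measurable: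
  fixes f :: "real \<times> 'a \<Rightarrow> real"
  assumes f: "f \<in> borel_measurable pred_sigma" and bd: "\<And>x. x \<in> space pred_sigma \<Longrightarrow> \<bar>f x\<bar> \<le> c"
    and c: "0 \<le> c" and \<rho>: "\<rho> \<in> borel_measurable P"
  shows "(\<lambda>w. integral_upto f (\<rho> w) w) \<in> borel_measurable P"
proof (rule integral_kernel_measurable[OF measurable_ident_sets[OF refl] upto_product_measurable[OF f \<rho>]])
  show "\<bar>upto f (\<rho> w) w u\<bar> \<le> c" if "w \<in> space P" for w u
    using bd[of "(u, w)"] c that by (auto simp: upto_def space_pred)
qed

lemma integrable_integral_upto:
  fixes f :: "real \<times> 'a \<Rightarrow> real"
  assumes f: "f \<in> borel_measurable pred_sigma" and bd: "\<And>x. x \<in> space pred_sigma \<Longrightarrow> \<bar>f x\<bar> \<le> c"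
    and c: "0 \<le> c" and \<rho>: "\<rho> \<in> borel_measurable P"
    and mass: "\<And>w. w \<in> space P \<Longrightarrow> mass (\<rho> w) w \<le> b"
  shows "integrable P (\<lambda>w. integral_upto f (\<rho> w) w)"
proof (rule integrable_const_bound[where B="c * b"])
  show "AE w in P. norm (integral_upto f (\<rho> w) w) \<le> c * b"
  proof (rule AE_I2)
    fix w assume w: "w \<in> space P"
    have "\<bar>integral_upto f (\<rho> w) w\<bar> \<le> c * mass (\<rho> w) w"
      by (rule integral_upto_bound(2)[OF f bd c w])
    also have "\<dots> \<le> c * b" using mass[OF w] c by (rule mult_left_mono)
    finally show "norm (integral_upto f (\<rho> w) w) \<le> c * b" by simp
  qed
qed (rule integral_upto_measurable[OF f bd c \<rho>])

lemma stopped_mean_ennreal: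
  fixes f :: "real \<times> 'a \<Rightarrow> real"
  assumes f: "f \<in> borel_measurable pred_sigma" and bd: "\<And>x. x \<in> space pred_sigma \<Longrightarrow> \<bar>f x\<bar> \<le> c"
    and nn: "\<And>x. x \<in> space pred_sigma \<Longrightarrow> 0 \<le> f x"
    and c: "0 \<le> c" and \<rho>: "\<rho> \<in> borel_measurable P"
    and mass: "\<And>w. w \<in> space P \<Longrightarrow> mass (\<rho> w) w \<le> b"
  shows "stopped_mean \<rho> (\<lambda>x. ennreal (f x)) = ennreal (\<integral>w. integral_upto f (\<rho> w) w \<partial>P)"
proof -
  have nn': "0 \<le> upto f r w u" if "w \<in> space P" for r w u
    using nn[of "(u, w)"] that by (auto simp: upto_def space_pred)
  have "stopped_mean \<rho> (\<lambda>x. ennreal (f x)) = (\<integral>\<^sup>+w. ennreal (integral_upto f (\<rho> w) w) \<partial>P)"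
    unfolding stopped_mean_def
  proof (rule nn_integral_cong)
    fix w assume w: "w \<in> space P"
    have "upto (\<lambda>x. ennreal (f x)) (\<rho> w) w = (\<lambda>u. ennreal (upto f (\<rho> w) w u))" by (auto simp: upto_def)
    then show "(\<integral>\<^sup>+u. upto (\<lambda>x. ennreal (f x)) (\<rho> w) w u \<partial>\<kappa> w) = ennreal (integral_upto f (\<rho> w) w)"
      using nn_integral_eq_integral[OF integral_upto_bound(1)[OF f bd c w]] nn'[OF w] by simp
  qed
  also have "\<dots> = ennreal (\<integral>w. integral_upto f (\<rho> w) w \<partial>P)"
    using nn' by (intro nn_integral_eq_integral integrable_integral_upto[OF f bd c \<rho> mass] AE_I2
      Bochner_Integration.integral_nonneg) auto
  finally show ?thesis .
qed

lemma measure_Ioc_stopped: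
  assumes w: "w \<in> space P" and "s \<le> t"
  shows "measure (\<kappa> w) ({s<..t} \<inter> {..r}) = mass (min t r) w - mass (min s r) w"
proof -
  interpret finite_measure "\<kappa> w" by (rule finite_\<kappa>[OF w])
  have "{s<..t} \<inter> {..r} = {..min t r} - {..min s r}" by auto
  then show ?thesis using assms sets_\<kappa>[OF w] by (simp add: finite_measure_Diff)
qed

end

section \<open>The compensator formula for predictable integrands\<close>

text \<open>
  One member of a localizing sequence is fixed. Up to \<open>\<rho>\<close> both random measures have mass at most \<open>b\<close>,
  so bounded predictable functions have finite means.
\<close>

locale localized_counting_model = counting_model P T F N lam
  for P :: "'a measure" and T F N lam +
  fixes \<rho> :: "'a \<Rightarrow> real" and b :: real
  assumes \<rho>_stopping: "stopping_time F \<rho>"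
    and \<rho>_range: "w \<in> space P \<Longrightarrow> \<rho> w \<in> {0..T}"
    and mass_\<rho>: "w \<in> space P \<Longrightarrow> total_mass (\<rho> w) w \<le> b"
    and increments: "0 \<le> s \<Longrightarrow> s \<le> t \<Longrightarrow> t \<le> T \<Longrightarrow> A \<in> sets (F s) \<Longrightarrow>
      (\<integral>w. indicator A w * (jump.mass (min t (\<rho> w)) w - jump.mass (min s (\<rho> w)) w) \<partial>P) =
      (\<integral>w. indicator A w * (comp.mass (min t (\<rho> w)) w - comp.mass (min s (\<rho> w)) w) \<partial>P)"
begin

lemma \<rho>_measurable [measurable]: "\<rho> \<in> borel_measurable P"
  using \<rho>_stopping by (rule measurable_stopping_time) (auto simp: space_F intro: sets_F_P)

lemma mass_\<rho>_each:
  assumes "w \<in> space P"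
  shows "jump.mass (\<rho> w) w \<le> b" "comp.mass (\<rho> w) w \<le> b"
  using mass_\<rho>[OF assms] measure_nonneg[of "jump_measure w" "{..\<rho> w}"]
    measure_nonneg[of "comp_measure w" "{..\<rho> w}"] by linarith+

text \<open>
  On a rectangle \<open>(s,t] \<times> A\<close> with \<open>A\<close> known at time \<open>s\<close>, both sides are the means over \<open>A\<close> of the stopped
  increments, so the martingale property is the claim.
\<close>

lemma stopped_mean_rectangle:
  assumes st: "0 \<le> s" "s \<le> t" "t \<le> T" and A: "A \<in> sets (F s)"
  shows "jump.stopped_mean \<rho> (indicator ({s<..t} \<times> A)) = comp.stopped_mean \<rho> (indicator ({s<..t} \<times> A))"
proof -
  let ?R = "{s<..t} \<times> A"
  let ?f = "indicator ?R :: real \<times> 'a \<Rightarrow> real"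
  have m: "?f \<in> borel_measurable pred_sigma"
    using pred_rectangleI[OF st A] by simp
  have e: "(\<lambda>x. ennreal (?f x)) = indicator ?R" by (auto simp: indicator_def)
  have up: "upto ?f r w = (\<lambda>u. indicator A w * indicator ({s<..t} \<inter> {..r}) u)" for r w
    using st by (auto simp: upto_def indicator_def)
  have "jump.stopped_mean \<rho> (\<lambda>x. ennreal (?f x)) = ennreal (\<integral>w. jump.integral_upto ?f (\<rho> w) w \<partial>P)"
    by (rule jump.stopped_mean_ennreal[OF m _ _ _ \<rho>_measurable mass_\<rho>_each(1), where c=1]) auto
  also have "(\<integral>w. jump.integral_upto ?f (\<rho> w) w \<partial>P) =
    (\<integral>w. indicator A w * (jump.mass (min t (\<rho> w)) w - jump.mass (min s (\<rho> w)) w) \<partial>P)"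
    using sets_eq_imp_space_eq[OF sets_jump]
    by (intro Bochner_Integration.integral_cong refl) (simp add: up jump.measure_Ioc_stopped[OF _ st(2)])
  also have "\<dots> = (\<integral>w. indicator A w * (comp.mass (min t (\<rho> w)) w - comp.mass (min s (\<rho> w)) w) \<partial>P)"
    by (rule increments[OF st A])
  also have "\<dots> = (\<integral>w. comp.integral_upto ?f (\<rho> w) w \<partial>P)"
    using sets_eq_imp_space_eq[OF sets_comp]
    by (intro Bochner_Integration.integral_cong refl) (simp add: up comp.measure_Ioc_stopped[OF _ st(2)])
  also have "ennreal \<dots> = comp.stopped_mean \<rho> (\<lambda>x. ennreal (?f x))"
    by (rule comp.stopped_mean_ennreal[OF m _ _ _ \<rho>_measurable mass_\<rho>_each(2), where c=1, symmetric]) auto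
  finally show ?thesis by (simp only: e)
qed

lemma stopped_mean_zero_slice:
  "jump.stopped_mean \<rho> (indicator ({0} \<times> A)) = 0" "comp.stopped_mean \<rho> (indicator ({0} \<times> A)) = 0"
proof -
  have z: "(\<integral>\<^sup>+u. upto (indicator ({0} \<times> A)) r w u \<partial>m) = 0"
    if m: "sets m = sets borel" "emeasure m {..0} = 0" for r w and m :: "real measure"
  proof -
    have "(\<integral>\<^sup>+u. upto (indicator ({0} \<times> A)) r w u \<partial>m) \<le> (\<integral>\<^sup>+u. indicator {..0} u \<partial>m)"
      by (intro nn_integral_mono) (auto simp: upto_def indicator_def)
    then show ?thesis using m by simp
  qed
  show "jump.stopped_mean \<rho> (indicator ({0} \<times> A)) = 0"
    unfolding jump.stopped_mean_def using z[OF sets_jump jump.\<kappa>_atMost_0] by (simp cong: nn_integral_cong)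
  show "comp.stopped_mean \<rho> (indicator ({0} \<times> A)) = 0"
    unfolding comp.stopped_mean_def using z[OF sets_comp comp.\<kappa>_atMost_0] by (simp cong: nn_integral_cong)
qed

text \<open>
  Finiteness of the total mean allows subtraction, which the passage to complements requires.
\<close>

lemma stopped_mean_one:
  "jump.stopped_mean \<rho> (indicator ({0..T} \<times> space P)) = comp.stopped_mean \<rho> (indicator ({0..T} \<times> space P))"
  "comp.stopped_mean \<rho> (indicator ({0..T} \<times> space P)) < \<top>"
proof -
  let ?S = "{0} \<times> space P" and ?R = "{0<..T} \<times> space P"
  have m: "?S \<in> sets pred_sigma" "?R \<in> sets pred_sigma"
    using T_pos sets.top[of "F 0"] unfolding sets_pred
    by (auto intro!: sigma_sets.Basic pred_rectanglesI simp: space_F)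
  have split: "(indicator ({0..T} \<times> space P) :: real \<times> 'a \<Rightarrow> ennreal) = (\<lambda>x. indicator ?S x + indicator ?R x)"
    using T_pos by (auto simp: indicator_def fun_eq_iff)
  have R: "jump.stopped_mean \<rho> (indicator ?R) = comp.stopped_mean \<rho> (indicator ?R)"
    using T_pos sets.top[of "F 0"] by (intro stopped_mean_rectangle) (auto simp: space_F)
  show "jump.stopped_mean \<rho> (indicator ({0..T} \<times> space P)) = comp.stopped_mean \<rho> (indicator ({0..T} \<times> space P))"
    unfolding split using m R
    by (simp add: jump.stopped_mean_add[OF \<rho>_measurable] comp.stopped_mean_add[OF \<rho>_measurable] stopped_mean_zero_slice)
  have "comp.stopped_mean \<rho> (\<lambda>x. ennreal 1) = ennreal (\<integral>w. comp.integral_upto (\<lambda>_. 1::real) (\<rho> w) w \<partial>P)"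
    by (rule comp.stopped_mean_ennreal[OF _ _ _ _ \<rho>_measurable mass_\<rho>_each(2), where c=1]) auto
  moreover have "comp.stopped_mean \<rho> (indicator ({0..T} \<times> space P)) = comp.stopped_mean \<rho> (\<lambda>x. ennreal 1)"
    by (intro comp.stopped_mean_cong \<rho>_measurable) (auto simp: space_pred)
  ultimately show "comp.stopped_mean \<rho> (indicator ({0..T} \<times> space P)) < \<top>" by simp
qed

lemma stopped_mean_indicator:
  assumes "A \<in> sets pred_sigma"
  shows "jump.stopped_mean \<rho> (indicator A) = comp.stopped_mean \<rho> (indicator A)"
  using pred_rectangles_Int_stable pred_rectangles_Pow assms[unfolded sets_pred]
proof (induction rule: sigma_sets_induct_disjoint)
  case (basic A)
  then show ?case
    by (cases rule: pred_rectangles_cases) (auto simp only: stopped_mean_rectangle stopped_mean_zero_slice)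
next
  case empty
  then show ?case using stopped_mean_zero_slice[of "{}"] by (simp only: Sigma_empty2)
next
  case (compl A)
  let ?O = "{0..T} \<times> space P"
  have A: "A \<in> sets pred_sigma" "?O \<in> sets pred_sigma" using compl(1) sets.top[of pred_sigma] by (simp_all add: sets_pred space_pred)
  have sub: "A \<subseteq> ?O" using sets.sets_into_space[OF A(1)] by (simp add: space_pred)
  have m: "indicator A \<in> borel_measurable pred_sigma" "indicator (?O - A) \<in> borel_measurable pred_sigma"
    using A by auto
  have split: "(indicator ?O :: real \<times> 'a \<Rightarrow> ennreal) = (\<lambda>x. indicator A x + indicator (?O - A) x)"
    using sub by (auto simp: indicator_def fun_eq_iff)
  have J: "jump.stopped_mean \<rho> (indicator ?O) = jump.stopped_mean \<rho> (indicator A) + jump.stopped_mean \<rho> (indicator (?O - A))"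
    unfolding split using m by (rule jump.stopped_mean_add[OF \<rho>_measurable])
  have C: "comp.stopped_mean \<rho> (indicator ?O) = comp.stopped_mean \<rho> (indicator A) + comp.stopped_mean \<rho> (indicator (?O - A))"
    unfolding split using m by (rule comp.stopped_mean_add[OF \<rho>_measurable])
  have "comp.stopped_mean \<rho> (indicator A) < \<top>" using stopped_mean_one(2) unfolding C by simp
  then show ?case using J C stopped_mean_one(1) compl(2)
    by (metis ennreal_add_left_cancel less_irrefl infinity_ennreal_def)
next
  case (union A)
  have m: "indicator (A i) \<in> borel_measurable pred_sigma" for i using union(2) by (auto simp: sets_pred[symmetric])
  have "(indicator (\<Union>i. A i) :: real \<times> 'a \<Rightarrow> ennreal) = (\<lambda>x. \<Sum>i. indicator (A i) x)"
    using suminf_indicator[OF union(1)] by (auto simp: fun_eq_iff)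
  then show ?case
    by (simp only: jump.stopped_mean_suminf[OF \<rho>_measurable m] comp.stopped_mean_suminf[OF \<rho>_measurable m] union(3))
qed

text \<open>
  The compensator formula: in the mean a predictable function cannot tell the jumps from their
  compensator. Rectangles determine the predictable sets by Dynkin's argument, and sets determine
  nonnegative functions.
\<close>

lemma stopped_mean_eq:
  fixes f :: "real \<times> 'a \<Rightarrow> ennreal"
  assumes "f \<in> borel_measurable pred_sigma"
  shows "jump.stopped_mean \<rho> f = comp.stopped_mean \<rho> f"
  using assms
proof (induction rule: borel_measurable_induct)
  case (cong f g)
  have "jump.stopped_mean \<rho> f = jump.stopped_mean \<rho> g"
    using cong.hyps(3) by (rule jump.stopped_mean_cong[OF \<rho>_measurable])
  moreover have "comp.stopped_mean \<rho> f = comp.stopped_mean \<rho> g"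
    using cong.hyps(3) by (rule comp.stopped_mean_cong[OF \<rho>_measurable])
  ultimately show ?case using cong.IH by simp
next
  case (set A)
  then show ?case by (rule stopped_mean_indicator)
next
  case (mult u c)
  then show ?case
    by (simp add: jump.stopped_mean_cmult[OF \<rho>_measurable] comp.stopped_mean_cmult[OF \<rho>_measurable])
next
  case (add u v)
  then show ?case
    by (simp add: jump.stopped_mean_add[OF \<rho>_measurable] comp.stopped_mean_add[OF \<rho>_measurable])
next
  case (seq U)
  show ?case
    unfolding jump.stopped_mean_SUP[OF \<rho>_measurable seq.hyps(1,3)] comp.stopped_mean_SUP[OF \<rho>_measurable seq.hyps(1,3)]
    by (simp only: seq.IH)
qed

text \<open>
  The signed version reduces to the nonnegative one by adding the constant \<open>c\<close>.
\<close>

lemma expectation_integral_eq: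
  fixes f :: "real \<times> 'a \<Rightarrow> real"
  assumes f[measurable]: "f \<in> borel_measurable pred_sigma"
    and bd: "\<And>x. x \<in> space pred_sigma \<Longrightarrow> \<bar>f x\<bar> \<le> c" and c: "0 \<le> c"
  shows "(\<integral>w. jump.integral_upto f (\<rho> w) w \<partial>P) = (\<integral>w. comp.integral_upto f (\<rho> w) w \<partial>P)"
proof -
  have nonneg: "(\<integral>w. jump.integral_upto g (\<rho> w) w \<partial>P) = (\<integral>w. comp.integral_upto g (\<rho> w) w \<partial>P)"
    if g[measurable]: "g \<in> borel_measurable pred_sigma" and gb: "\<And>x. x \<in> space pred_sigma \<Longrightarrow> \<bar>g x\<bar> \<le> k"
      and nn: "\<And>x. x \<in> space pred_sigma \<Longrightarrow> 0 \<le> g x" and k: "0 \<le> k" for g :: "real \<times> 'a \<Rightarrow> real" and k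
  proof -
    have "jump.stopped_mean \<rho> (\<lambda>x. ennreal (g x)) = comp.stopped_mean \<rho> (\<lambda>x. ennreal (g x))"
      by (rule stopped_mean_eq) measurable
    then have "ennreal (\<integral>w. jump.integral_upto g (\<rho> w) w \<partial>P) = ennreal (\<integral>w. comp.integral_upto g (\<rho> w) w \<partial>P)"
      by (simp only: jump.stopped_mean_ennreal[OF g gb nn k \<rho>_measurable mass_\<rho>_each(1)]
          comp.stopped_mean_ennreal[OF g gb nn k \<rho>_measurable mass_\<rho>_each(2)])
    moreover have "0 \<le> upto g r w u" if "w \<in> space P" for r w u
      using nn[of "(u, w)"] that by (auto simp: upto_def space_pred)
    then have "0 \<le> (\<integral>w. jump.integral_upto g (\<rho> w) w \<partial>P)" "0 \<le> (\<integral>w. comp.integral_upto g (\<rho> w) w \<partial>P)"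
      by (auto intro!: integral_nonneg_AE AE_I2)
    ultimately show ?thesis by simp
  qed
  define f1 where "f1 x = f x + c" for x
  define f2 where "f2 = (\<lambda>x :: real \<times> 'a. c)"
  have f1: "f1 \<in> borel_measurable pred_sigma" "\<And>x. x \<in> space pred_sigma \<Longrightarrow> \<bar>f1 x\<bar> \<le> 2 * c"
    "\<And>x. x \<in> space pred_sigma \<Longrightarrow> 0 \<le> f1 x"
  proof -
    show "f1 \<in> borel_measurable pred_sigma" unfolding f1_def by measurable
    show "\<bar>f1 x\<bar> \<le> 2 * c" "0 \<le> f1 x" if "x \<in> space pred_sigma" for x
      using bd[OF that] by (auto simp: f1_def)
  qed
  have f2: "f2 \<in> borel_measurable pred_sigma" "\<And>x. x \<in> space pred_sigma \<Longrightarrow> \<bar>f2 x\<bar> \<le> c"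
    "\<And>x. x \<in> space pred_sigma \<Longrightarrow> 0 \<le> f2 x"
    using c by (auto simp: f2_def)
  have up: "upto f r w = (\<lambda>u. upto f1 r w u - upto f2 r w u)" for r w
    by (auto simp: upto_def f1_def f2_def)
  have c2: "0 \<le> 2 * c" using c by simp
  have "(\<integral>w. jump.integral_upto f (\<rho> w) w \<partial>P) =
    (\<integral>w. (jump.integral_upto f1 (\<rho> w) w) - (jump.integral_upto f2 (\<rho> w) w) \<partial>P)"
    unfolding up by (intro Bochner_Integration.integral_cong refl Bochner_Integration.integral_diff
      jump.integral_upto_bound(1)[OF f1(1,2) c2] jump.integral_upto_bound(1)[OF f2(1,2) c])
  also have "\<dots> = (\<integral>w. jump.integral_upto f1 (\<rho> w) w \<partial>P) - (\<integral>w. jump.integral_upto f2 (\<rho> w) w \<partial>P)"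
    by (intro Bochner_Integration.integral_diff jump.integrable_integral_upto[OF f1(1,2) c2 \<rho>_measurable mass_\<rho>_each(1)]
        jump.integrable_integral_upto[OF f2(1,2) c \<rho>_measurable mass_\<rho>_each(1)])
  also have "\<dots> = (\<integral>w. comp.integral_upto f1 (\<rho> w) w \<partial>P) - (\<integral>w. comp.integral_upto f2 (\<rho> w) w \<partial>P)"
    using nonneg[OF f1 c2] nonneg[OF f2 c] by simp
  also have "\<dots> = (\<integral>w. (comp.integral_upto f1 (\<rho> w) w) - (comp.integral_upto f2 (\<rho> w) w) \<partial>P)"
    by (intro Bochner_Integration.integral_diff[symmetric] comp.integrable_integral_upto[OF f1(1,2) c2 \<rho>_measurable mass_\<rho>_each(2)]
        comp.integrable_integral_upto[OF f2(1,2) c \<rho>_measurable mass_\<rho>_each(2)])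
  also have "\<dots> = (\<integral>w. comp.integral_upto f (\<rho> w) w \<partial>P)"
    unfolding up by (intro Bochner_Integration.integral_cong refl Bochner_Integration.integral_diff[symmetric]
      comp.integral_upto_bound(1)[OF f1(1,2) c2] comp.integral_upto_bound(1)[OF f2(1,2) c])
  finally show ?thesis .
qed

section \<open>The second moment of a compensated integral\<close>

text \<open>
  In the pathwise formula \<open>X\<^sup>2 = 2 \<integral> X\<^sub>- dX + \<integral> f\<^sup>2 dN\<close> the integrand \<open>f X\<^sub>-\<close> is predictable and bounded,
  so the first term has mean zero by the compensator formula. The same formula replaces \<open>dN\<close> by the
  compensator in the second term.
\<close>

lemma stopped_second_moment:
  fixes f :: "real \<times> 'a \<Rightarrow> real"
  assumes f[measurable]: "f \<in> borel_measurable pred_sigma"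
    and bd: "\<And>x. x \<in> space pred_sigma \<Longrightarrow> \<bar>f x\<bar> \<le> c" and c: "0 \<le> c"
  shows "(\<integral>w. ((jump.integral_upto f (\<rho> w) w) - (comp.integral_upto f (\<rho> w) w))\<^sup>2 \<partial>P)
    = (\<integral>w. comp.integral_upto (\<lambda>x. (f x)\<^sup>2) (\<rho> w) w \<partial>P)"
proof -
  \<comment> \<open>\<open>X\<close> is the left limit of the stopped integral process; it is predictable because \<open>g\<close>, the
    integrand cut off at the stopping time, is.\<close>
  define g where "g x = (if fst x \<le> \<rho> (snd x) then f x else 0)" for x
  have "{x \<in> space pred_sigma. fst x \<le> \<rho> (snd x)} \<in> sets pred_sigma"
    using stochastic_interval_predictable[OF \<rho>_stopping] \<rho>_range by auto
  then have g: "g \<in> borel_measurable pred_sigma"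
    unfolding g_def by (intro measurable_If f) auto
  have g_bd: "\<bar>g x\<bar> \<le> c" if "x \<in> space pred_sigma" for x
    using bd[OF that] c by (auto simp: g_def)
  define X where "X = (\<lambda>(s, w). (\<integral>u. cut g s w u \<partial>jump_measure w) - (\<integral>u. cut g s w u \<partial>comp_measure w))"
  have X_meas: "X \<in> borel_measurable pred_sigma"
    using borel_measurable_diff[OF jump.left_integral_predictable[OF g g_bd] comp.left_integral_predictable[OF g g_bd]]
    unfolding X_def by (simp add: case_prod_beta')
  have cut: "cut g s w u = upto f (\<rho> w) w u * indicator {..<s} u" for s w u
    by (auto simp: cut_def upto_def g_def indicator_def)
  have cut_le: "\<bar>cut g s w u\<bar> \<le> c * indicator {..\<rho> w} u" if "w \<in> space P" for s w u
    using bd[of "(u, w)"] c that by (auto simp: cut upto_def space_pred indicator_def)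
  have cut_int: "\<bar>\<integral>u. cut g s w u \<partial>m\<bar> \<le> c * b"
    if w: "w \<in> space P" and m: "finite_measure m" "sets m = sets borel" "measure m {..\<rho> w} \<le> b"
      and meas: "cut g s w \<in> borel_measurable m" for s w m
  proof -
    interpret finite_measure m by fact
    have bdc: "\<bar>cut g s w u\<bar> \<le> c" for u
      by (rule order_trans[OF cut_le[OF w]]) (simp add: c indicator_def)
    have int: "integrable m (cut g s w)"
      using meas bdc by (intro integrable_const_bound[where B=c]) auto
    have "\<bar>\<integral>u. cut g s w u \<partial>m\<bar> \<le> (\<integral>u. \<bar>cut g s w u\<bar> \<partial>m)"
      using integral_norm_bound[of m "cut g s w"] by simp
    also have "\<dots> \<le> (\<integral>u. c * indicator {..\<rho> w} u \<partial>m)"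
      using int cut_le[OF w] m(2)
      by (intro integral_mono integrable_mult_right integrable_real_indicator) (auto simp: less_top[symmetric])
    also have "\<dots> = c * measure m {..\<rho> w}" using sets_eq_imp_space_eq[OF m(2)] by simp
    also have "\<dots> \<le> c * b" using m(3) c by (rule mult_left_mono)
    finally show ?thesis .
  qed
  have X_bd: "\<bar>X x\<bar> \<le> 2 * (c * b)" if "x \<in> space pred_sigma" for x
  proof -
    obtain s w where x: "x = (s, w)" by (cases x)
    with that have w: "w \<in> space P" by (simp add: space_pred)
    have "\<bar>\<integral>u. cut g s w u \<partial>jump_measure w\<bar> \<le> c * b"
      by (rule cut_int[OF w jump.finite_\<kappa>[OF w] sets_jump mass_\<rho>_each(1)[OF w] jump.cut_measurable[OF g w]])
    moreover have "\<bar>\<integral>u. cut g s w u \<partial>comp_measure w\<bar> \<le> c * b"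
      by (rule cut_int[OF w comp.finite_\<kappa>[OF w] sets_comp mass_\<rho>_each(2)[OF w] comp.cut_measurable[OF g w]])
    ultimately show ?thesis unfolding x X_def prod.case by linarith
  qed
  define h where "h x = f x * X x" for x
  have h: "h \<in> borel_measurable pred_sigma" unfolding h_def using X_meas by measurable
  have h_bd: "\<bar>h x\<bar> \<le> c * (2 * (c * b))" if "x \<in> space pred_sigma" for x
    unfolding h_def abs_mult using bd[OF that] X_bd[OF that] c by (intro mult_mono) auto
  have b: "0 \<le> b"
  proof -
    obtain w where w: "w \<in> space P" using not_empty by blast
    show ?thesis by (rule order_trans[OF measure_nonneg mass_\<rho>_each(1)[OF w]])
  qed
  have hc: "0 \<le> c * (2 * (c * b))" using c b by simp
  have sq: "(\<lambda>x. (f x)\<^sup>2) \<in> borel_measurable pred_sigma" by measurable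
  have sq_bd: "\<bar>(f x)\<^sup>2\<bar> \<le> c\<^sup>2" if "x \<in> space pred_sigma" for x
    using power_mono[OF bd[OF that] abs_ge_zero, of 2] by simp
  have sqc: "0 \<le> c\<^sup>2" by simp
  have path: "((jump.integral_upto f (\<rho> w) w) - (comp.integral_upto f (\<rho> w) w))\<^sup>2 =
    2 * ((jump.integral_upto h (\<rho> w) w) - (comp.integral_upto h (\<rho> w) w))
    + (jump.integral_upto (\<lambda>x. (f x)\<^sup>2) (\<rho> w) w)" if w: "w \<in> space P" for w
  proof -
    have hX: "upto h (\<rho> w) w = (\<lambda>s. upto f (\<rho> w) w s *
        ((\<integral>u. upto f (\<rho> w) w u * indicator {..<s} u \<partial>jump_measure w) - (\<integral>u. upto f (\<rho> w) w u * indicator {..<s} u \<partial>comp_measure w)))"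
      by (auto simp: upto_def[of h] upto_def[of f _ _ _] h_def X_def cut fun_eq_iff)
    have fsq: "upto (\<lambda>x. (f x)\<^sup>2) (\<rho> w) w = (\<lambda>u. (upto f (\<rho> w) w u)\<^sup>2)"
      by (auto simp: upto_def)
    show ?thesis
      unfolding hX fsq
    proof (rule sqr_integral_difference)
      show "\<bar>upto f (\<rho> w) w u\<bar> \<le> c" for u
        using bd[of "(u, w)"] c w by (auto simp: upto_def space_pred)
      show "measure (comp_measure w) {u} = 0" for u
        using emeasure_comp_singleton[OF w] by (simp add: measure_def)
    qed (use w jump.finite_\<kappa> comp.finite_\<kappa> upto_section_measurable[OF f w] jump_measure_path(4)[OF w] in auto)
  qed
  have "(\<integral>w. ((jump.integral_upto f (\<rho> w) w) - (comp.integral_upto f (\<rho> w) w))\<^sup>2 \<partial>P) =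
    (\<integral>w. 2 * ((jump.integral_upto h (\<rho> w) w) - (comp.integral_upto h (\<rho> w) w))
      + (jump.integral_upto (\<lambda>x. (f x)\<^sup>2) (\<rho> w) w) \<partial>P)"
    by (intro Bochner_Integration.integral_cong refl path)
  also have "\<dots> = 2 * ((\<integral>w. jump.integral_upto h (\<rho> w) w \<partial>P) - (\<integral>w. comp.integral_upto h (\<rho> w) w \<partial>P))
      + (\<integral>w. jump.integral_upto (\<lambda>x. (f x)\<^sup>2) (\<rho> w) w \<partial>P)"
    using jump.integrable_integral_upto[OF h h_bd hc \<rho>_measurable mass_\<rho>_each(1)]
      comp.integrable_integral_upto[OF h h_bd hc \<rho>_measurable mass_\<rho>_each(2)]
      jump.integrable_integral_upto[OF sq sq_bd sqc \<rho>_measurable mass_\<rho>_each(1)] by simp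
  also have "\<dots> = (\<integral>w. comp.integral_upto (\<lambda>x. (f x)\<^sup>2) (\<rho> w) w \<partial>P)"
    using expectation_integral_eq[OF h h_bd hc] expectation_integral_eq[OF sq sq_bd sqc] by simp
  finally show ?thesis .
qed

end

context counting_model begin

text \<open>
  Almost surely the localizing times eventually equal \<open>T\<close>, so Fatou's lemma carries the stopped
  identity to the whole interval. Only an inequality survives, which is all the risk bound needs.
\<close>

lemma compensated_second_moment:
  fixes f :: "real \<times> 'a \<Rightarrow> real"
  assumes f[measurable]: "f \<in> borel_measurable pred_sigma"
    and bd: "\<And>x. x \<in> space pred_sigma \<Longrightarrow> \<bar>f x\<bar> \<le> c" and c: "0 \<le> c"
  shows "(\<integral>\<^sup>+w. ennreal (((jump.integral_upto f T w) - (comp.integral_upto f T w))\<^sup>2) \<partial>P)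
    \<le> (\<integral>\<^sup>+w. (\<integral>\<^sup>+u\<in>{0..T}. ennreal (lam u w * (f (u, w))\<^sup>2) \<partial>lborel) \<partial>P)" (is "_ \<le> ?R")
proof -
  obtain \<rho> where \<rho>: "\<And>k. stopping_time F (\<rho> k)"
    "\<And>k w. w \<in> space P \<Longrightarrow> \<rho> k w \<in> {0..T}"
    "AE w in P. \<forall>\<^sub>F k in sequentially. \<rho> k w = T"
    "\<And>k w. w \<in> space P \<Longrightarrow> total_mass (\<rho> k w) w \<le> real k + 1"
    "\<And>k s t A. 0 \<le> s \<Longrightarrow> s \<le> t \<Longrightarrow> t \<le> T \<Longrightarrow> A \<in> sets (F s) \<Longrightarrow>
      (\<integral>w. indicator A w * (jump.mass (min t (\<rho> k w)) w - jump.mass (min s (\<rho> k w)) w) \<partial>P) =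
      (\<integral>w. indicator A w * (comp.mass (min t (\<rho> k w)) w - comp.mass (min s (\<rho> k w)) w) \<partial>P)"
    using localizing_sequence by blast
  define D where "D r w = ((jump.integral_upto f r w) - (comp.integral_upto f r w))\<^sup>2" for r w
  have sq: "(\<lambda>x. (f x)\<^sup>2) \<in> borel_measurable pred_sigma" by measurable
  have sq_bd: "\<bar>(f x)\<^sup>2\<bar> \<le> c\<^sup>2" if "x \<in> space pred_sigma" for x
    using power_mono[OF bd[OF that] abs_ge_zero, of 2] by simp
  have D_meas: "(\<lambda>w. D (\<rho>' w) w) \<in> borel_measurable P" if "\<rho>' \<in> borel_measurable P" for \<rho>'
    using jump.integral_upto_measurable[OF f bd c that] comp.integral_upto_measurable[OF f bd c that]
    unfolding D_def by measurable
  have stopped: "(\<integral>\<^sup>+w. ennreal (D (\<rho> k w) w) \<partial>P) \<le> ?R" for k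
  proof -
    interpret L: localized_counting_model P T F N lam "\<rho> k" "real k + 1"
      by unfold_locales (use \<rho> in auto)
    have "integrable P (\<lambda>w. D (\<rho> k w) w)"
    proof (rule integrable_const_bound[where B="(2 * (c * (real k + 1)))\<^sup>2"])
      show "AE w in P. norm (D (\<rho> k w) w) \<le> (2 * (c * (real k + 1)))\<^sup>2"
      proof (rule AE_I2)
        fix w assume w: "w \<in> space P"
        have "\<bar>jump.integral_upto f (\<rho> k w) w\<bar> \<le> c * (real k + 1)"
          by (rule order_trans[OF jump.integral_upto_bound(2)[OF f bd c w] mult_left_mono[OF L.mass_\<rho>_each(1)[OF w] c]])
        moreover have "\<bar>comp.integral_upto f (\<rho> k w) w\<bar> \<le> c * (real k + 1)"
          by (rule order_trans[OF comp.integral_upto_bound(2)[OF f bd c w] mult_left_mono[OF L.mass_\<rho>_each(2)[OF w] c]])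
        ultimately have "\<bar>(jump.integral_upto f (\<rho> k w) w) - (comp.integral_upto f (\<rho> k w) w)\<bar> \<le> 2 * (c * (real k + 1))"
          by linarith
        from power_mono[OF this abs_ge_zero, of 2]
        show "norm (D (\<rho> k w) w) \<le> (2 * (c * (real k + 1)))\<^sup>2" by (simp add: D_def)
      qed
    qed (rule D_meas[OF L.\<rho>_measurable])
    then have "(\<integral>\<^sup>+w. ennreal (D (\<rho> k w) w) \<partial>P) = ennreal (\<integral>w. D (\<rho> k w) w \<partial>P)"
      by (intro nn_integral_eq_integral) (auto simp: D_def)
    also have "\<dots> = ennreal (\<integral>w. comp.integral_upto (\<lambda>x. (f x)\<^sup>2) (\<rho> k w) w \<partial>P)"
      unfolding D_def by (simp only: L.stopped_second_moment[OF f bd c])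
    also have "\<dots> = comp.stopped_mean (\<rho> k) (\<lambda>x. ennreal ((f x)\<^sup>2))"
      by (rule comp.stopped_mean_ennreal[OF sq sq_bd _ _ L.\<rho>_measurable L.mass_\<rho>_each(2), symmetric]) auto
    also have "\<dots> \<le> ?R"
      unfolding comp.stopped_mean_def
    proof (rule nn_integral_mono)
      fix w assume w: "w \<in> space P"
      have m: "upto (\<lambda>x. ennreal ((f x)\<^sup>2)) (\<rho> k w) w \<in> borel_measurable borel"
        by (rule upto_section_measurable[OF _ w]) measurable
      show "(\<integral>\<^sup>+u. upto (\<lambda>x. ennreal ((f x)\<^sup>2)) (\<rho> k w) w u \<partial>comp_measure w)
        \<le> (\<integral>\<^sup>+u\<in>{0..T}. ennreal (lam u w * (f (u, w))\<^sup>2) \<partial>lborel)"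
        unfolding nn_integral_comp[OF w m]
        using lam_nonneg[OF _ w]
        by (intro nn_integral_mono) (auto simp: upto_def indicator_def ennreal_mult)
    qed
    finally show ?thesis .
  qed
  have "(\<integral>\<^sup>+w. ennreal (D T w) \<partial>P) \<le> (\<integral>\<^sup>+w. liminf (\<lambda>k. ennreal (D (\<rho> k w) w)) \<partial>P)"
  proof (rule nn_integral_mono_AE)
    show "AE w in P. ennreal (D T w) \<le> liminf (\<lambda>k. ennreal (D (\<rho> k w) w))"
      using \<rho>(3)
    proof eventually_elim
      case (elim w)
      then have "\<forall>\<^sub>F k in sequentially. ennreal (D T w) \<le> ennreal (D (\<rho> k w) w)"
        by eventually_elim simp
      then show ?case by (rule Liminf_bounded)
    qed
  qed
  also have "\<dots> \<le> liminf (\<lambda>k. \<integral>\<^sup>+w. ennreal (D (\<rho> k w) w) \<partial>P)"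
  proof (rule nn_integral_liminf)
    fix k
    have "\<rho> k \<in> borel_measurable P"
      using \<rho>(1) by (rule measurable_stopping_time) (auto simp: space_F intro: sets_F_P)
    from D_meas[OF this] show "(\<lambda>w. ennreal (D (\<rho> k w) w)) \<in> borel_measurable P" by measurable
  qed
  also have "\<dots> \<le> liminf (\<lambda>k::nat. ?R)"
    by (intro Liminf_mono always_eventually allI stopped)
  also have "\<dots> = ?R" by (simp add: Liminf_const)
  finally show ?thesis unfolding D_def .
qed

end

section \<open>Predictability of the coordinates and changes on null sets\<close>

context filtered_prob_space begin

lemma fst_predictable: "fst \<in> borel_measurable pred_sigma"
proof (rule borel_measurableI_le)
  fix a :: real
  show "{x \<in> space pred_sigma. fst x \<le> a} \<in> sets pred_sigma"
  proof (cases "0 \<le> a")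
    case True
    then show ?thesis using stochastic_interval_predictable[OF stopping_time_const[of F a]] by simp
  next
    case False
    then have "{x \<in> space pred_sigma. fst x \<le> a} = {}" by (auto simp: space_pred)
    then show ?thesis by (simp only: sets.empty_sets)
  qed
qed

lemma snd_predictable:
  assumes A: "A \<in> sets (F 0)"
  shows "{x \<in> space pred_sigma. snd x \<in> A} \<in> sets pred_sigma"
proof -
  have "{x \<in> space pred_sigma. snd x \<in> A} = {0} \<times> A \<union> {0<..T} \<times> A"
    using sets_F_into_space[OF A] T_pos by (auto simp: space_pred)
  moreover have "{0} \<times> A \<in> sets pred_sigma" "{0<..T} \<times> A \<in> sets pred_sigma"
    using A T_pos unfolding sets_pred by (auto intro!: sigma_sets.Basic pred_rectanglesI)
  ultimately show ?thesis by auto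
qed

lemma null_subset_F0: "Z \<in> null_sets P \<Longrightarrow> B \<subseteq> Z \<Longrightarrow> B \<in> sets (F 0)"
  using usual unfolding usual_filtration_def by blast

text \<open>
  The filtration contains all subsets of null sets, so changing a process on a null set keeps it
  adapted. In this way the intensity can be made integrable on every path.
\<close>

lemma measurable_F_modify_null:
  fixes X X' :: "'a \<Rightarrow> real"
  assumes X: "X \<in> borel_measurable (F t)" and t: "0 \<le> t" and Z: "Z \<in> null_sets P"
    and eq: "\<And>w. w \<in> space P - Z \<Longrightarrow> X' w = X w"
  shows "X' \<in> borel_measurable (F t)"
proof (rule measurableI)
  fix B :: "real set" assume B: "B \<in> sets borel"
  have "X' -` B \<inter> space (F t) = (X -` B \<inter> space (F t) - Z) \<union> (X' -` B \<inter> Z)"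
    using eq null_setsD2[OF Z, THEN sets.sets_into_space] by (auto simp: space_F)
  moreover have "Z \<in> sets (F t)" "X' -` B \<inter> Z \<in> sets (F t)"
    by (rule sets_F_mono[OF t null_subset_F0[OF Z]]; blast)+
  ultimately show "X' -` B \<inter> space (F t) \<in> sets (F t)"
    using measurable_sets[OF X B] by auto
qed simp

lemma martingale_on_modify_null:
  assumes X: "martingale_on P T F X" and Z: "Z \<in> null_sets P"
    and eq: "\<And>w t. w \<in> space P - Z \<Longrightarrow> t \<in> {0..T} \<Longrightarrow> X' t w = X t w"
  shows "martingale_on P T F X'"
proof -
  have ae: "AE w in P. X' t w = X t w" if "t \<in> {0..T}" for t
    using AE_not_in[OF Z] AE_space by eventually_elim (use eq that in auto)
  have m: "X' t \<in> borel_measurable (F t)" if "t \<in> {0..T}" for t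
  proof (rule measurable_F_modify_null[OF _ _ Z])
    show "X t \<in> borel_measurable (F t)" using X that by (simp add: martingale_on_def adapted_def)
    show "X' t w = X t w" if "w \<in> space P - Z" for w by (rule eq) (fact that \<open>t \<in> {0..T}\<close>)+
  qed (use that in simp)
  have int: "integrable P (X' t)" if t: "t \<in> {0..T}" for t
  proof (subst integrable_cong_AE[OF _ _ ae[OF t]])
    show "integrable P (X t)" "X t \<in> borel_measurable P" "X' t \<in> borel_measurable P"
      using X t measurable_F_P[OF m[OF t]] by (auto simp: martingale_on_def)
  qed
  have "AE w in P. real_cond_exp P (F s) (X' t) w = X' s w" if s: "s \<in> {0..T}" and t: "t \<in> {s..T}" for s t
  proof -
    interpret finite_measure_subalgebra P "F s"
      using usual by unfold_locales (auto simp: usual_filtration_def)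
    have t0: "t \<in> {0..T}" using s t by auto
    have "AE w in P. real_cond_exp P (F s) (X' t) w = real_cond_exp P (F s) (X t) w"
      using X t0 measurable_F_P[OF m[OF t0]]
      by (intro real_cond_exp_cong ae) (auto simp: martingale_on_def)
    moreover have "AE w in P. real_cond_exp P (F s) (X t) w = X s w"
      using X s t by (auto simp: martingale_on_def)
    ultimately show ?thesis using ae[OF s] by eventually_elim simp
  qed
  with m int show ?thesis by (auto simp: martingale_on_def adapted_def)
qed

lemma local_martingale_on_modify_null:
  assumes X: "local_martingale_on P T F X" and Z: "Z \<in> null_sets P"
    and eq: "\<And>w t. w \<in> space P - Z \<Longrightarrow> t \<in> {0..T} \<Longrightarrow> X' t w = X t w"
  shows "local_martingale_on P T F X'"
proof -
  obtain \<tau> :: "nat \<Rightarrow> 'a \<Rightarrow> real" where \<tau>: "\<And>k. stopping_time F (\<tau> k)"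
    "\<And>k w. w \<in> space P \<Longrightarrow> \<tau> k w \<in> {0..T}"
    "AE w in P. incseq (\<lambda>k. \<tau> k w)"
    "AE w in P. eventually (\<lambda>k. \<tau> k w = T) sequentially"
    "\<And>k. martingale_on P T F (\<lambda>t w. X (min t (\<tau> k w)) w)"
    using X unfolding local_martingale_on_def by blast
  have "martingale_on P T F (\<lambda>t w. X' (min t (\<tau> k w)) w)" for k
  proof (rule martingale_on_modify_null[OF \<tau>(5) Z])
    fix w t assume "w \<in> space P - Z" "t \<in> {0..T}"
    then show "X' (min t (\<tau> k w)) w = X (min t (\<tau> k w)) w"
      using \<tau>(2)[of w k] by (intro eq) auto
  qed
  with \<tau>(1-4) show ?thesis unfolding local_martingale_on_def by blast
qed

end

section \<open>The risk of a kernel estimator\<close>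

context counting_model begin

lemma integral_comp:
  fixes f :: "real \<Rightarrow> real"
  assumes w: "w \<in> space P" and f: "f \<in> borel_measurable borel"
  shows "(\<integral>u. f u \<partial>comp_measure w) = (\<integral>u. (if u \<in> {0..T} then lam u w else 0) * f u \<partial>lborel)"
proof -
  have "comp_measure w = density lborel (\<lambda>u. ennreal (if u \<in> {0..T} then lam u w else 0))"
    by (simp add: comp_measure_def if_distrib cong: if_cong)
  then show ?thesis
    using lam_section[OF w] f lam_nonneg[OF _ w] by (simp add: integral_density)
qed

context
  fixes k :: "real \<Rightarrow> real \<Rightarrow> real" and z :: "real \<times> 'a \<Rightarrow> real" and kc zc :: real
  assumes k: "(\<lambda>(t, u). k t u) \<in> borel_measurable (borel \<Otimes>\<^sub>M borel)" and k_bd: "\<And>t u. \<bar>k t u\<bar> \<le> kc"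
    and z: "z \<in> borel_measurable pred_sigma" and z_bd: "\<And>x. x \<in> space pred_sigma \<Longrightarrow> \<bar>z x\<bar> \<le> zc"
    and zc: "0 \<le> zc"
begin

text \<open>
  The stochastic part of the estimation error at \<open>t\<close>, with \<open>z\<close> in the role of \<open>J / Y\<close>.
\<close>

definition smoothed_noise :: "real \<Rightarrow> 'a \<Rightarrow> real" where
  "smoothed_noise t w = (\<integral>u. k t u * upto z T w u \<partial>jump_measure w) - (\<integral>u. k t u * upto z T w u \<partial>comp_measure w)"

lemma smoothed_noise_measurable: "(\<lambda>(t, w). smoothed_noise t w) \<in> borel_measurable (borel \<Otimes>\<^sub>M P)"
proof -
  have kc: "0 \<le> kc" using k_bd[of 0 0] by linarith
  have up: "(\<lambda>x. upto z T (snd (fst x)) (snd x)) \<in> borel_measurable ((borel \<Otimes>\<^sub>M P) \<Otimes>\<^sub>M borel)"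
  proof -
    have "(\<lambda>x. (snd (fst x), snd x)) \<in> ((borel \<Otimes>\<^sub>M P) \<Otimes>\<^sub>M borel) \<rightarrow>\<^sub>M (P \<Otimes>\<^sub>M borel)" by measurable
    from measurable_compose[OF this upto_product_measurable[OF z, of "\<lambda>_. T"]] show ?thesis by simp
  qed
  have kk: "(\<lambda>x. k (fst (fst x)) (snd x)) \<in> borel_measurable ((borel \<Otimes>\<^sub>M P) \<Otimes>\<^sub>M borel)"
  proof -
    have "(\<lambda>x. (fst (fst x), snd x)) \<in> ((borel \<Otimes>\<^sub>M P) \<Otimes>\<^sub>M borel) \<rightarrow>\<^sub>M (borel \<Otimes>\<^sub>M borel)" by measurable
    from measurable_compose[OF this k] show ?thesis by simp
  qed
  have prod: "(\<lambda>(x, u). k (fst x) u * upto z T (snd x) u) \<in> borel_measurable ((borel \<Otimes>\<^sub>M P) \<Otimes>\<^sub>M borel)"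
    using borel_measurable_times[OF kk up] by (simp add: case_prod_beta')
  have bd: "\<bar>k (fst x) u * upto z T (snd x) u\<bar> \<le> kc * zc" if "x \<in> space (borel \<Otimes>\<^sub>M P)" for x u
    unfolding abs_mult using that z_bd[of "(u, snd x)"] zc
    by (intro mult_mono k_bd kc) (auto simp: upto_def space_pred space_pair_measure)
  have "(\<lambda>x. (\<integral>u. k (fst x) u * upto z T (snd x) u \<partial>jump_measure (snd x))
      - (\<integral>u. k (fst x) u * upto z T (snd x) u \<partial>comp_measure (snd x))) \<in> borel_measurable (borel \<Otimes>\<^sub>M P)"
    by (intro borel_measurable_diff jump.integral_kernel_measurable[OF measurable_snd prod bd]
        comp.integral_kernel_measurable[OF measurable_snd prod bd])
  then show ?thesis by (simp add: smoothed_noise_def case_prod_beta')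
qed

lemma smoothed_noise_second_moment:
  "(\<integral>\<^sup>+w. ennreal ((smoothed_noise t w)\<^sup>2) \<partial>P)
    \<le> (\<integral>\<^sup>+w. (\<integral>\<^sup>+u\<in>{0..T}. ennreal (lam u w * (k t u * z (u, w))\<^sup>2) \<partial>lborel) \<partial>P)"
proof -
  have kc: "0 \<le> kc" using k_bd[of 0 0] by linarith
  define f where "f x = k t (fst x) * z x" for x
  have "k t \<in> borel_measurable borel"
    using measurable_compose[OF measurable_Pair1' k, of t] by simp
  then have f: "f \<in> borel_measurable pred_sigma"
    unfolding f_def by (intro borel_measurable_times z measurable_compose[OF fst_predictable])
  have bd: "\<bar>f x\<bar> \<le> kc * zc" if "x \<in> space pred_sigma" for x
    unfolding f_def abs_mult using z_bd[OF that] kc by (intro mult_mono k_bd) auto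
  have up: "upto f T w = (\<lambda>u. k t u * upto z T w u)" for w by (auto simp: upto_def f_def)
  have "0 \<le> kc * zc" using kc zc by simp
  from compensated_second_moment[OF f bd this] show ?thesis
    unfolding up unfolding smoothed_noise_def f_def by simp
qed

end

end

text \<open>
  The error splits into the compensated integral of \<open>k t u / Y u\<close> and the bias of the smoothed
  intensity. The second moment of the first is at most the mean of the variance formula for each
  fixed \<open>t\<close>, hence at most \<open>V\<close>, and Tonelli's theorem integrates this over \<open>t\<close>. The factor two comes
  from \<open>(a + b)\<^sup>2 \<le> 2 a\<^sup>2 + 2 b\<^sup>2\<close>.
\<close>

lemma (in filtered_prob_space) kernel_estimator_risk:
  fixes N Y :: "real \<Rightarrow> 'a \<Rightarrow> real" and \<alpha> :: "real \<Rightarrow> real" and k :: "real \<Rightarrow> real \<Rightarrow> real"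
  assumes counting: "counting_process P T F N"
    and Y_pred: "predictable P T F Y"
    and intensity: "has_intensity P T F N (\<lambda>t w. \<alpha> t * Y t w)"
    and \<alpha>_meas: "\<alpha> \<in> borel_measurable borel" and \<alpha>_nonneg: "\<And>t. t \<in> {0..T} \<Longrightarrow> 0 \<le> \<alpha> t"
    and Y_nonneg: "\<And>t w. t \<in> {0..T} \<Longrightarrow> w \<in> space P \<Longrightarrow> 0 \<le> Y t w"
    and k: "(\<lambda>(t, u). k t u) \<in> borel_measurable (borel \<Otimes>\<^sub>M borel)" and k_bd: "\<And>t u. \<bar>k t u\<bar> \<le> kc"
    and y0: "0 < y0" "AE w in P. \<forall>t\<in>{0..T}. y0 \<le> Y t w"
    and V: "0 \<le> V" "\<And>t. t \<in> {0..T} \<Longrightarrow> AE w in P.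
      (LINT s:{0..T}|lborel. (k t s)\<^sup>2 * (at_risk_indicator Y s w / (Y s w)\<^sup>2) * (\<alpha> s * Y s w)) \<le> V"
  defines "est \<equiv> \<lambda>t w. LINT s:{0..T}|interval_measure (\<lambda>x. N (max 0 (min x T)) w).
      k t s * (at_risk_indicator Y s w / Y s w)"
    and "smooth \<equiv> \<lambda>t. LINT s:{0..T}|lborel. k t s * \<alpha> s"
  shows "(\<integral>\<^sup>+w. (\<integral>\<^sup>+t\<in>{0..T}. ennreal ((est t w - \<alpha> t)\<^sup>2) \<partial>lborel) \<partial>P)
    \<le> ennreal (2 * T * V) + 2 * (\<integral>\<^sup>+t\<in>{0..T}. ennreal ((smooth t - \<alpha> t)\<^sup>2) \<partial>lborel)"
proof -
  have "AE w in P. (\<forall>t\<in>{0..T}. y0 \<le> Y t w) \<and> set_integrable lborel {0..T} (\<lambda>s. \<alpha> s * Y s w)"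
    using y0(2) intensity by (simp add: has_intensity_def)
  then obtain Z where Z_sub: "{w \<in> space P. \<not> ((\<forall>t\<in>{0..T}. y0 \<le> Y t w) \<and> set_integrable lborel {0..T} (\<lambda>s. \<alpha> s * Y s w))} \<subseteq> Z"
    and Z: "Z \<in> null_sets P"
    by (rule AE_E) (use null_setsI in blast)
  have good: "y0 \<le> Y t w" if "w \<in> space P - Z" "t \<in> {0..T}" for w t
    using Z_sub that by auto
  have good_int: "set_integrable lborel {0..T} (\<lambda>s. \<alpha> s * Y s w)" if "w \<in> space P - Z" for w
    using Z_sub that by auto
  define lam where "lam t w = (if w \<in> Z then 0 else \<alpha> t * Y t w)" for t w
  have lam_pred: "predictable P T F lam"
  proof -
    have "{x \<in> space pred_sigma. snd x \<in> Z} \<in> sets pred_sigma"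
      by (rule snd_predictable[OF null_subset_F0[OF Z order_refl]])
    moreover have "(\<lambda>x. \<alpha> (fst x) * Y (fst x) (snd x)) \<in> borel_measurable pred_sigma"
      using intensity by (simp add: has_intensity_def predictable_def case_prod_beta')
    ultimately have "(\<lambda>x. if snd x \<in> Z then 0 else \<alpha> (fst x) * Y (fst x) (snd x)) \<in> borel_measurable pred_sigma"
      by (intro measurable_If) auto
    then show ?thesis by (simp add: predictable_def lam_def case_prod_beta')
  qed
  have lam_int: "set_integrable lborel {0..T} (\<lambda>s. lam s w)" if "w \<in> space P" for w
    using good_int[of w] that by (cases "w \<in> Z") (auto simp: lam_def set_integrable_def)
  interpret C: counting_model P T F N lam
  proof unfold_locales
    show "counting_process P T F N" by fact
    show "has_intensity P T F N lam"
      unfolding has_intensity_def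
    proof (intro conjI lam_pred AE_I2 lam_int)
      show "local_martingale_on P T F (\<lambda>t \<omega>. N t \<omega> - (LINT s:{0..t}|lborel. lam s \<omega>))"
        using intensity unfolding has_intensity_def
        by (elim conjE local_martingale_on_modify_null[OF _ Z]) (simp add: lam_def)
    qed
    show "0 \<le> lam t w" if "t \<in> {0..T}" "w \<in> space P" for t w
      using that \<alpha>_nonneg Y_nonneg by (simp add: lam_def)
  qed (rule lam_int)
  \<comment> \<open>The cutoff at \<open>y0\<close> makes \<open>1 / Y\<close> bounded on every path and changes nothing outside \<open>Z\<close>.\<close>
  define z where "z x = (if y0 \<le> Y (fst x) (snd x) then 1 / Y (fst x) (snd x) else 0)" for x
  have z: "z \<in> borel_measurable pred_sigma"
  proof -
    have [measurable]: "(\<lambda>x. Y (fst x) (snd x)) \<in> borel_measurable pred_sigma"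
      using Y_pred by (simp add: predictable_def case_prod_beta')
    show ?thesis unfolding z_def by measurable
  qed
  have z_bd: "\<bar>z x\<bar> \<le> 1 / y0" for x
    using y0(1) by (auto simp: z_def intro!: divide_left_mono mult_pos_pos)
  have zc: "0 \<le> 1 / y0" using y0(1) by simp
  define D where "D = C.smoothed_noise k z"
  have D_def': "D t w = (\<integral>u. k t u * upto z T w u \<partial>C.jump_measure w) - (\<integral>u. k t u * upto z T w u \<partial>C.comp_measure w)" for t w
    unfolding D_def by (rule C.smoothed_noise_def[OF k k_bd z z_bd zc])
  have D_meas[measurable]: "(\<lambda>(t, w). D t w) \<in> borel_measurable (borel \<Otimes>\<^sub>M P)"
    unfolding D_def by (rule C.smoothed_noise_measurable[OF k k_bd z z_bd zc])
  have k_sec[measurable]: "k t \<in> borel_measurable borel" for t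
    using measurable_compose[OF measurable_Pair1' k, of t] by simp
  have z_Y: "upto z T w u = 1 / Y u w" "at_risk_indicator Y u w = 1" "0 < Y u w"
    if "w \<in> space P - Z" "u \<in> {0..T}" for w u
    using good[OF that] that y0(1) by (auto simp: upto_def z_def at_risk_indicator_def)
  have up_sec[measurable]: "upto z T w \<in> borel_measurable borel" if "w \<in> space P" for w
    using upto_section_measurable[OF z that] .
  have error: "est t w - \<alpha> t = D t w + (smooth t - \<alpha> t)" if w: "w \<in> space P - Z" for t w
  proof -
    have "est t w = (\<integral>u. k t u * upto z T w u \<partial>C.jump_measure w)"
      unfolding est_def set_lebesgue_integral_def C.jump_measure_def
      using z_Y[OF w] by (intro Bochner_Integration.integral_cong refl)
        (auto simp: indicator_def upto_def)
    moreover have "(\<integral>u. k t u * upto z T w u \<partial>C.comp_measure w) = smooth t"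
    proof -
      have "(\<integral>u. k t u * upto z T w u \<partial>C.comp_measure w) =
          (\<integral>u. (if u \<in> {0..T} then lam u w else 0) * (k t u * upto z T w u) \<partial>lborel)"
        using w by (intro C.integral_comp borel_measurable_times k_sec up_sec) auto
      also have "\<dots> = smooth t"
        unfolding smooth_def set_lebesgue_integral_def
        using z_Y[OF w] w by (intro Bochner_Integration.integral_cong refl)
          (force simp: indicator_def lam_def)
      finally show ?thesis .
    qed
    ultimately show ?thesis by (simp add: D_def')
  qed
  have smooth_meas[measurable]: "smooth \<in> borel_measurable borel"
  proof -
    have "(\<lambda>(t, u). indicator {0..T} u *\<^sub>R (k t u * \<alpha> u)) \<in> borel_measurable (borel \<Otimes>\<^sub>M lborel)"
      using k \<alpha>_meas by measurable
    then show ?thesis unfolding smooth_def set_lebesgue_integral_def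
      by (rule lborel.borel_measurable_lebesgue_integral)
  qed
  have var: "(\<integral>\<^sup>+w. ennreal ((D t w)\<^sup>2) \<partial>P) \<le> ennreal V" if t: "t \<in> {0..T}" for t
  proof -
    have "(\<integral>\<^sup>+w. ennreal ((D t w)\<^sup>2) \<partial>P) \<le> (\<integral>\<^sup>+w. (\<integral>\<^sup>+u\<in>{0..T}. ennreal (lam u w * (k t u * z (u, w))\<^sup>2) \<partial>lborel) \<partial>P)"
      unfolding D_def by (rule C.smoothed_noise_second_moment[OF k k_bd z z_bd zc])
    also have "\<dots> \<le> (\<integral>\<^sup>+w. ennreal V \<partial>P)"
    proof (rule nn_integral_mono_AE)
      show "AE w in P. (\<integral>\<^sup>+u\<in>{0..T}. ennreal (lam u w * (k t u * z (u, w))\<^sup>2) \<partial>lborel) \<le> ennreal V"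
        using V(2)[OF t] AE_not_in[OF Z] AE_space
      proof eventually_elim
        case (elim w)
        then have w: "w \<in> space P - Z" "w \<in> space P" by auto
        define q where "q u = (if u \<in> {0..T} then lam u w else 0) * (k t u * upto z T w u)\<^sup>2" for u
        have q_eq: "indicator {0..T} u *\<^sub>R ((k t u)\<^sup>2 * (at_risk_indicator Y u w / (Y u w)\<^sup>2) * (\<alpha> u * Y u w)) = q u" for u
          using z_Y[OF w(1), of u] w by (auto simp: q_def indicator_def lam_def power_mult_distrib power_divide)
        have q_nn: "0 \<le> q u" for u using C.lam_nonneg[OF _ w(2)] by (auto simp: q_def)
        have q_int: "integrable lborel q"
        proof (rule Bochner_Integration.integrable_bound)
          show "integrable lborel (\<lambda>u. (kc * (1 / y0))\<^sup>2 * (indicator {0..T} u *\<^sub>R lam u w))"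
            using lam_int[OF w(2)] unfolding set_integrable_def by (rule integrable_mult_right)
          show "q \<in> borel_measurable lborel"
            unfolding q_def using C.lam_section[OF w(2)] up_sec[OF w(2)] k_sec[of t] by measurable
          have "(k t u * upto z T w u)\<^sup>2 \<le> (kc * (1 / y0))\<^sup>2" for u
          proof -
            have "\<bar>upto z T w u\<bar> \<le> 1 / y0" using z_bd zc by (simp add: upto_def)
            then have "\<bar>k t u * upto z T w u\<bar> \<le> kc * (1 / y0)"
              unfolding abs_mult using k_bd[of t u] by (intro mult_mono) auto
            from power_mono[OF this abs_ge_zero, of 2] show ?thesis by simp
          qed
          then show "AE u in lborel. norm (q u) \<le> norm ((kc * (1 / y0))\<^sup>2 * (indicator {0..T} u *\<^sub>R lam u w))"
            using C.lam_nonneg[OF _ w(2)]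
            by (intro AE_I2) (auto simp: q_def indicator_def abs_mult mult.commute intro!: mult_left_mono)
        qed
        have "(\<integral>\<^sup>+u\<in>{0..T}. ennreal (lam u w * (k t u * z (u, w))\<^sup>2) \<partial>lborel) = (\<integral>\<^sup>+u. ennreal (q u) \<partial>lborel)"
          by (intro nn_integral_cong) (auto simp: q_def indicator_def upto_def)
        also have "\<dots> = ennreal (\<integral>u. q u \<partial>lborel)"
          using q_int q_nn by (intro nn_integral_eq_integral) auto
        also have "\<dots> \<le> ennreal V"
          using elim(1) unfolding set_lebesgue_integral_def q_eq by (rule ennreal_leI)
        finally show ?case .
      qed
    qed
    also have "\<dots> = ennreal V" by (simp add: emeasure_space_1)
    finally show ?thesis .
  qed
  let ?B = "\<integral>\<^sup>+t\<in>{0..T}. ennreal ((smooth t - \<alpha> t)\<^sup>2) \<partial>lborel"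
  have "(\<integral>\<^sup>+w. (\<integral>\<^sup>+t\<in>{0..T}. ennreal ((est t w - \<alpha> t)\<^sup>2) \<partial>lborel) \<partial>P)
    \<le> (\<integral>\<^sup>+w. 2 * (\<integral>\<^sup>+t\<in>{0..T}. ennreal ((D t w)\<^sup>2) \<partial>lborel) + 2 * ?B \<partial>P)"
  proof (rule nn_integral_mono_AE)
    show "AE w in P. (\<integral>\<^sup>+t\<in>{0..T}. ennreal ((est t w - \<alpha> t)\<^sup>2) \<partial>lborel)
      \<le> 2 * (\<integral>\<^sup>+t\<in>{0..T}. ennreal ((D t w)\<^sup>2) \<partial>lborel) + 2 * ?B"
      using AE_not_in[OF Z] AE_space
    proof eventually_elim
      case (elim w)
      then have w: "w \<in> space P - Z" by simp
      have [measurable]: "(\<lambda>t. D t w) \<in> borel_measurable borel"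
        using measurable_compose[OF measurable_Pair2'[OF elim(2)] D_meas] by simp
      have "(\<integral>\<^sup>+t\<in>{0..T}. ennreal ((est t w - \<alpha> t)\<^sup>2) \<partial>lborel)
        \<le> (\<integral>\<^sup>+t. 2 * (ennreal ((D t w)\<^sup>2) * indicator {0..T} t) + 2 * (ennreal ((smooth t - \<alpha> t)\<^sup>2) * indicator {0..T} t) \<partial>lborel)"
      proof (rule nn_integral_mono)
        fix t
        have "(est t w - \<alpha> t)\<^sup>2 \<le> 2 * (D t w)\<^sup>2 + 2 * (smooth t - \<alpha> t)\<^sup>2"
          unfolding error[OF w] using sum_squares_bound[of "D t w" "smooth t - \<alpha> t"] by (simp add: power2_sum)
        then have "ennreal ((est t w - \<alpha> t)\<^sup>2) \<le> ennreal (2 * (D t w)\<^sup>2 + 2 * (smooth t - \<alpha> t)\<^sup>2)"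
          by (rule ennreal_leI)
        also have "\<dots> = 2 * ennreal ((D t w)\<^sup>2) + 2 * ennreal ((smooth t - \<alpha> t)\<^sup>2)"
          by (simp add: ennreal_mult)
        finally show "ennreal ((est t w - \<alpha> t)\<^sup>2) * indicator {0..T} t
          \<le> 2 * (ennreal ((D t w)\<^sup>2) * indicator {0..T} t) + 2 * (ennreal ((smooth t - \<alpha> t)\<^sup>2) * indicator {0..T} t)"
          by (simp add: indicator_def)
      qed
      also have "\<dots> = 2 * (\<integral>\<^sup>+t\<in>{0..T}. ennreal ((D t w)\<^sup>2) \<partial>lborel) + 2 * ?B"
        using \<alpha>_meas by (simp add: nn_integral_add nn_integral_cmult)
      finally show ?case .
    qed
  qed
  also have "\<dots> = 2 * (\<integral>\<^sup>+w. (\<integral>\<^sup>+t\<in>{0..T}. ennreal ((D t w)\<^sup>2) \<partial>lborel) \<partial>P) + 2 * ?B"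
  proof -
    have "(\<lambda>(w, t). ennreal ((D t w)\<^sup>2) * indicator {0..T} t) \<in> borel_measurable (P \<Otimes>\<^sub>M lborel)"
      by measurable
    from lborel.borel_measurable_nn_integral[OF this]
    show ?thesis by (simp add: nn_integral_add nn_integral_cmult emeasure_space_1)
  qed
  also have "(\<integral>\<^sup>+w. (\<integral>\<^sup>+t\<in>{0..T}. ennreal ((D t w)\<^sup>2) \<partial>lborel) \<partial>P)
      = (\<integral>\<^sup>+t. (\<integral>\<^sup>+w. ennreal ((D t w)\<^sup>2) * indicator {0..T} t \<partial>P) \<partial>lborel)"
  proof -
    interpret pair_sigma_finite lborel P ..
    have "(\<lambda>(t, w). ennreal ((D t w)\<^sup>2) * indicator {0..T} t) \<in> borel_measurable (lborel \<Otimes>\<^sub>M P)"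
      by measurable
    then show ?thesis by (rule Fubini')
  qed
  also have "\<dots> \<le> (\<integral>\<^sup>+t. ennreal V * indicator {0..T} t \<partial>lborel)"
    by (intro nn_integral_mono) (auto simp: indicator_def var)
  also have "\<dots> = ennreal (T * V)"
    using T_pos V(1) by (simp add: nn_integral_cmult ennreal_mult mult.commute)
  finally show ?thesis
    using V(1) T_pos by (auto simp: ennreal_mult mult.assoc add_mono mult_left_mono intro: order_trans)
qed

section \<open>The rate of convergence\<close>

lemma L2_norm_square: "(L2_norm T f)\<^sup>2 = (\<integral>\<^sup>+t\<in>{0..T}. ennreal ((f t)\<^sup>2) \<partial>lborel)"
  by (cases "\<integral>\<^sup>+t\<in>{0..T}. ennreal ((f t)\<^sup>2) \<partial>lborel")
    (auto simp: L2_norm_def ennreal_power power2_eq_square ennreal_top_mult simp flip: ennreal_mult)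

text \<open>
  Clamping the time to \<open>[0,T]\<close> extends functions on the interval to Borel functions on the line.
\<close>

lemma measurable_clamp:
  fixes T :: real
  assumes "0 < T"
  shows "(\<lambda>t. max 0 (min t T)) \<in> borel \<rightarrow>\<^sub>M restrict_space borel {0..T}"
  using assms by (intro measurable_restrict_space2) auto

lemma (in filtered_prob_space) has_intensity_cong:
  assumes int: "has_intensity P T F N lam"
    and eq: "\<And>t w. t \<in> {0..T} \<Longrightarrow> w \<in> space P \<Longrightarrow> lam' t w = lam t w"
  shows "has_intensity P T F N lam'"
  unfolding has_intensity_def
proof (intro conjI)
  have "(\<lambda>(t, w). lam t w) \<in> borel_measurable pred_sigma"
    using int by (simp add: has_intensity_def predictable_def)
  moreover have "(case x of (t, w) \<Rightarrow> lam' t w) = (case x of (t, w) \<Rightarrow> lam t w)" if "x \<in> space pred_sigma" for x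
    using that eq by (auto simp: space_pred)
  ultimately show "predictable P T F lam'"
    unfolding predictable_def by (simp cong: measurable_cong)
  have "AE w in P. set_integrable lborel {0..T} (\<lambda>s. lam s w)"
    using int by (simp add: has_intensity_def)
  then show "AE w in P. set_integrable lborel {0..T} (\<lambda>s. lam' s w)"
    using AE_space
  proof eventually_elim
    case (elim w)
    have "(\<lambda>s. indicator {0..T} s *\<^sub>R lam' s w) = (\<lambda>s. indicator {0..T} s *\<^sub>R lam s w)"
      using eq[OF _ elim(2)] by (auto simp: indicator_def)
    with elim(1) show ?case by (simp only: set_integrable_def)
  qed
  show "local_martingale_on P T F (\<lambda>t w. N t w - (LINT s:{0..t}|lborel. lam' s w))"
  proof (rule local_martingale_on_modify_null)
    show "local_martingale_on P T F (\<lambda>t w. N t w - (LINT s:{0..t}|lborel. lam s w))"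
      using int by (simp add: has_intensity_def)
    show "{} \<in> null_sets P" by simp
    fix w t assume "w \<in> space P - {}" "t \<in> {0..T}"
    then have "(LINT s:{0..t}|lborel. lam' s w) = (LINT s:{0..t}|lborel. lam s w)"
      by (intro set_lebesgue_integral_cong) (auto intro!: eq)
    then show "N t w - (LINT s:{0..t}|lborel. lam' s w) = N t w - (LINT s:{0..t}|lborel. lam s w)" by simp
  qed
qed

lemma twin_kernel_measurable:
  assumes d: "(\<lambda>(t, u). d t u) \<in> borel_measurable (restrict_space borel {0..T} \<Otimes>\<^sub>M restrict_space borel {0..T})"
    and \<phi>: "inv_into {0..T} \<phi> \<in> restrict_space borel {0..T} \<rightarrow>\<^sub>M restrict_space borel {0..T}"
    and K[measurable]: "K \<in> borel_measurable borel"
  shows "(\<lambda>(t, s). twin_kernel T d \<phi> K h j t s) \<in> borel_measurable (restrict_space borel {0..T} \<Otimes>\<^sub>M restrict_space borel {0..T})"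
proof -
  let ?I = "restrict_space borel {0..T} :: real measure"
  have "(inv_into {0..T} \<phi> ^^ i) \<in> ?I \<rightarrow>\<^sub>M ?I" for i
    by (induction i) (auto intro: measurable_comp[OF _ \<phi>, unfolded comp_def] simp: comp_def)
  then have "(\<lambda>x. ((inv_into {0..T} \<phi> ^^ j) (fst x), (inv_into {0..T} \<phi> ^^ j) (snd x))) \<in> (?I \<Otimes>\<^sub>M ?I) \<rightarrow>\<^sub>M (?I \<Otimes>\<^sub>M ?I)"
    by measurable
  from measurable_compose[OF this d]
  have "(\<lambda>x. d ((inv_into {0..T} \<phi> ^^ j) (fst x)) ((inv_into {0..T} \<phi> ^^ j) (snd x))) \<in> borel_measurable (?I \<Otimes>\<^sub>M ?I)"
    by simp
  then show ?thesis unfolding twin_kernel_def case_prod_beta' by measurable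
qed

lemma twin_kernel_bound:
  assumes K: "bdd_above (range (\<lambda>u. \<bar>K u\<bar>))" and h: "0 < h j"
  shows "\<bar>twin_kernel T d \<phi> K h j t s\<bar> \<le> sup_norm K / h j"
proof -
  have "\<bar>K u\<bar> \<le> sup_norm K" for u unfolding sup_norm_def by (rule cSUP_upper[OF _ K]) simp
  then show ?thesis using h by (simp add: twin_kernel_def abs_mult divide_right_mono)
qed

theorem theorem4p7:
  fixes T s deff :: real
    and d :: "real \<Rightarrow> real \<Rightarrow> real"
    and \<phi> K \<alpha> y :: "real \<Rightarrow> real"
    and h :: "nat \<Rightarrow> real"
    and P :: "nat \<Rightarrow> 'a measure"
    and F :: "nat \<Rightarrow> real \<Rightarrow> 'a measure"
    and N Y :: "nat \<Rightarrow> real \<Rightarrow> 'a \<Rightarrow> real"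
  assumes T_pos: "0 < T"
    and metric: "Metric_space {0..T} d"
    and metric_measurable:
      "(\<lambda>(t, u). d t u) \<in> borel_measurable (restrict_space borel {0..T} \<Otimes>\<^sub>M restrict_space borel {0..T})"
    and bandwidth: "\<And>j. 0 < h j" "decseq h"
    \<comment> \<open>multiplicative intensity model\<close>
    and prob: "\<And>n. n \<ge> 1 \<Longrightarrow> prob_space (P n)"
    and filt: "\<And>n. n \<ge> 1 \<Longrightarrow> usual_filtration (P n) T (F n)"
    and counting: "\<And>n. n \<ge> 1 \<Longrightarrow> counting_process (P n) T (F n) (N n)"
    and alpha_measurable: "\<alpha> \<in> borel_measurable (restrict_space borel {0..T})"
    and alpha_nonneg: "\<And>t. t \<in> {0..T} \<Longrightarrow> 0 \<le> \<alpha> t"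
    and Y_predictable: "\<And>n. n \<ge> 1 \<Longrightarrow> predictable (P n) T (F n) (Y n)"
    and Y_nonneg: "\<And>n t \<omega>. n \<ge> 1 \<Longrightarrow> t \<in> {0..T} \<Longrightarrow> \<omega> \<in> space (P n) \<Longrightarrow> 0 \<le> Y n t \<omega>"
    and intensity: "\<And>n. n \<ge> 1 \<Longrightarrow> has_intensity (P n) T (F n) (N n) (\<lambda>t \<omega>. \<alpha> t * Y n t \<omega>)"
    \<comment> \<open>group\<close>
    and G1: "bij_betw \<phi> {0..T} {0..T}"
      "\<phi> \<in> restrict_space borel {0..T} \<rightarrow>\<^sub>M restrict_space borel {0..T}"
      "inv_into {0..T} \<phi> \<in> restrict_space borel {0..T} \<rightarrow>\<^sub>M restrict_space borel {0..T}"
    and G2: "\<exists>c1>0. \<exists>c2>0. \<forall>A\<in>sets borel. A \<subseteq> {0..T} \<longrightarrow>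
      c1 * measure lborel A \<le> measure lborel (\<phi> ` A) \<and>
      measure lborel (\<phi> ` A) \<le> c2 * measure lborel A"
    \<comment> \<open>kernel\<close>
    and K_nonneg: "\<And>u. 0 \<le> K u"
    and K1: "has_bochner_integral lborel K 1"
    and K2: "bdd_above (range (\<lambda>u. \<bar>K u\<bar>))"
    and K3: "closure {u. K u \<noteq> 0} \<subseteq> {-1..1}"
    and K4: "\<exists>L. L-lipschitz_on UNIV K"
    \<comment> \<open>at-risk process\<close>
    and Y1: "\<exists>ymin>0. \<forall>n\<ge>1. AE \<omega> in P n. \<forall>t\<in>{0..T}. real n * ymin \<le> Y n t \<omega>"
    and y_pos: "\<And>t. t \<in> {0..T} \<Longrightarrow> 0 < y t"
    and Y2: "unif_conv_in_prob P T (\<lambda>n t \<omega>. Y n t \<omega> / real n) y"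
    and Y3: "\<exists>c1>0. \<exists>c2>0. \<forall>n\<ge>1. AE \<omega> in P n. \<forall>t\<in>{0..T}.
      c1 * Y n t \<omega> \<le> Y n (\<phi> t) \<omega> \<and> Y n (\<phi> t) \<omega> \<le> c2 * Y n t \<omega>"
    \<comment> \<open>baseline intensity\<close>
    and A1: "bdd_above ((\<lambda>t. \<bar>\<alpha> t\<bar>) ` {0..T})"
    and A2: "\<exists>a>0. \<forall>t\<in>{0..T}. \<alpha> t \<noteq> 0 \<longrightarrow> a \<le> \<alpha> t"
    and eff_dim: "effective_dimension P T d \<phi> K h \<alpha> Y deff"
    and s_pos: "0 < s"
    and holder: "twin_holder T d \<phi> K h s \<alpha>"
  shows "\<exists>C. \<forall>n\<ge>1. \<forall>j. h j = real n powr (- 1 / (2 * s + deff)) \<longrightarrow>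
    (\<integral>\<^sup>+ \<omega>. (L2_norm T (\<lambda>t. twin_estimator T d \<phi> K h (N n) (Y n) j t \<omega> - \<alpha> t))\<^sup>2 \<partial>P n)
      \<le> ennreal (C * real n powr (- (2 * s) / (2 * s + deff)))"
proof -
  obtain y0 where y0: "0 < y0" "\<And>n. n \<ge> 1 \<Longrightarrow> AE \<omega> in P n. \<forall>t\<in>{0..T}. real n * y0 \<le> Y n t \<omega>"
    using Y1 by blast
  obtain C1' where C1': "\<And>n j t. n \<ge> 1 \<Longrightarrow> t \<in> {0..T} \<Longrightarrow> AE \<omega> in P n.
        twin_cond_variance T d \<phi> K h \<alpha> (Y n) j t \<omega> \<le> C1' * (sup_norm K)\<^sup>2 * \<alpha> t / (real n * h j powr deff)"
    and deff: "0 \<le> deff"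
    using eff_dim unfolding effective_dimension_def by blast
  \<comment> \<open>The given constants may be negative.\<close>
  define C1 where "C1 = max 0 C1'"
  obtain C2' where C2': "\<And>j. L2_norm T (\<lambda>t. twin_smooth T d \<phi> K h \<alpha> j t - \<alpha> t) \<le> ennreal (C2' * h j powr s)"
    using holder unfolding twin_holder_def by blast
  define C2 where "C2 = max 0 C2'"
  obtain A where "\<And>t. t \<in> {0..T} \<Longrightarrow> \<bar>\<alpha> t\<bar> \<le> A"
    using A1 unfolding bdd_above_def by blast
  then have A: "\<alpha> t \<le> A" if "t \<in> {0..T}" for t
    using that abs_ge_self[of "\<alpha> t"] order_trans by blast
  have A0: "0 \<le> A" using A[of 0] alpha_nonneg[of 0] T_pos by auto
  define \<beta> where "\<beta> = 2 * s + deff"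
  have \<beta>: "0 < \<beta>" using s_pos deff by (simp add: \<beta>_def)
  define c where "c t = max 0 (min t T)" for t
  have c: "c \<in> borel \<rightarrow>\<^sub>M restrict_space borel {0..T}"
    unfolding c_def by (rule measurable_clamp[OF T_pos])
  have c_id: "c t = t" if "t \<in> {0..T}" for t using that by (simp add: c_def)
  have K_meas: "K \<in> borel_measurable borel"
    using K4 by (auto intro: borel_measurable_continuous_onI lipschitz_on_continuous_on)
  show ?thesis
  proof (intro exI allI impI)
    fix n j :: nat
    assume n: "1 \<le> n" and hj: "h j = real n powr (- 1 / (2 * s + deff))"
    interpret prob_space "P n" by (rule prob[OF n])
    interpret filtered_prob_space "P n" T "F n"
      by unfold_locales (fact T_pos, rule filt[OF n])
    define k where "k t u = twin_kernel T d \<phi> K h j (c t) (c u)" for t u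
    have k: "(\<lambda>(t, u). k t u) \<in> borel_measurable (borel \<Otimes>\<^sub>M borel)"
    proof -
      have "(\<lambda>x. (c (fst x), c (snd x))) \<in> borel \<Otimes>\<^sub>M borel \<rightarrow>\<^sub>M restrict_space borel {0..T} \<Otimes>\<^sub>M restrict_space borel {0..T}"
        using c by measurable
      from measurable_compose[OF this twin_kernel_measurable[OF metric_measurable G1(3) K_meas]]
      show ?thesis by (simp add: k_def case_prod_beta')
    qed
    \<comment> \<open>With \<open>h j\<close> as prescribed, \<open>n * h j powr deff\<close> is the inverse of \<open>(h j powr s)\<^sup>2\<close>, so variance and
      squared bias are of the same order.\<close>
    define V where "V = C1 * (sup_norm K)\<^sup>2 * A / (real n * h j powr deff)"
    have V0: "0 \<le> V" using A0 by (auto simp: V_def C1_def)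
    have var: "AE \<omega> in P n. (LINT u:{0..T}|lborel. (k t u)\<^sup>2 * (at_risk_indicator (Y n) u \<omega> / (Y n u \<omega>)\<^sup>2) * (\<alpha> (c u) * Y n u \<omega>)) \<le> V"
      if t: "t \<in> {0..T}" for t
      using C1'[OF n t, of j]
    proof eventually_elim
      case (elim \<omega>)
      have "(LINT u:{0..T}|lborel. (k t u)\<^sup>2 * (at_risk_indicator (Y n) u \<omega> / (Y n u \<omega>)\<^sup>2) * (\<alpha> (c u) * Y n u \<omega>))
          = twin_cond_variance T d \<phi> K h \<alpha> (Y n) j t \<omega>"
        unfolding twin_cond_variance_def using t
        by (intro set_lebesgue_integral_cong) (auto simp: k_def c_id)
      also have "\<dots> \<le> C1' * (sup_norm K)\<^sup>2 * \<alpha> t / (real n * h j powr deff)" by (rule elim)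
      also have "\<dots> \<le> V"
        unfolding V_def using A[OF t] alpha_nonneg[OF t]
        by (intro divide_right_mono mult_mono) (auto simp: C1_def)
      finally show ?case .
    qed
    let ?B = "\<integral>\<^sup>+t\<in>{0..T}. ennreal (((LINT u:{0..T}|lborel. k t u * \<alpha> (c u)) - \<alpha> (c t))\<^sup>2) \<partial>lborel"
    have risk: "(\<integral>\<^sup>+\<omega>. (\<integral>\<^sup>+t\<in>{0..T}. ennreal (((LINT u:{0..T}|interval_measure (\<lambda>x. N n (max 0 (min x T)) \<omega>).
        k t u * (at_risk_indicator (Y n) u \<omega> / Y n u \<omega>)) - \<alpha> (c t))\<^sup>2) \<partial>lborel) \<partial>P n) \<le> ennreal (2 * T * V) + 2 * ?B"
    proof (rule kernel_estimator_risk[OF counting[OF n] Y_predictable[OF n] _ _ _ _ k _ _ y0(2)[OF n] V0 var])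
      show "has_intensity (P n) T (F n) (N n) (\<lambda>t \<omega>. \<alpha> (c t) * Y n t \<omega>)"
        by (rule has_intensity_cong[OF intensity[OF n]]) (simp add: c_id)
      show "(\<lambda>t. \<alpha> (c t)) \<in> borel_measurable borel"
        by (rule measurable_compose[OF c alpha_measurable])
      show "\<bar>k t u\<bar> \<le> sup_norm K / h j" for t u
        unfolding k_def by (rule twin_kernel_bound[OF K2 bandwidth(1)])
    qed (use n y0(1) Y_nonneg[OF n] alpha_nonneg in \<open>auto simp: c_id\<close>)
    have bias: "?B \<le> ennreal ((C2 * h j powr s)\<^sup>2)"
    proof -
      have "?B = (L2_norm T (\<lambda>t. twin_smooth T d \<phi> K h \<alpha> j t - \<alpha> t))\<^sup>2"
        unfolding L2_norm_square
      proof (rule nn_integral_cong)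
        fix t
        have "(LINT u:{0..T}|lborel. k t u * \<alpha> (c u)) = twin_smooth T d \<phi> K h \<alpha> j t" if "t \<in> {0..T}"
          unfolding twin_smooth_def using that by (intro set_lebesgue_integral_cong) (auto simp: k_def c_id)
        then show "ennreal (((LINT u:{0..T}|lborel. k t u * \<alpha> (c u)) - \<alpha> (c t))\<^sup>2) * indicator {0..T} t
          = ennreal ((twin_smooth T d \<phi> K h \<alpha> j t - \<alpha> t)\<^sup>2) * indicator {0..T} t"
          by (cases "t \<in> {0..T}") (auto simp: c_id)
      qed
      also have "\<dots> \<le> (ennreal (C2 * h j powr s))\<^sup>2"
        by (intro power_mono order_trans[OF C2'] ennreal_leI mult_right_mono) (auto simp: C2_def)
      also have "\<dots> = ennreal ((C2 * h j powr s)\<^sup>2)" by (simp add: C2_def ennreal_power)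
      finally show ?thesis .
    qed
    have "(\<integral>\<^sup>+\<omega>. (L2_norm T (\<lambda>t. twin_estimator T d \<phi> K h (N n) (Y n) j t \<omega> - \<alpha> t))\<^sup>2 \<partial>P n) =
      (\<integral>\<^sup>+\<omega>. (\<integral>\<^sup>+t\<in>{0..T}. ennreal (((LINT u:{0..T}|interval_measure (\<lambda>x. N n (max 0 (min x T)) \<omega>).
        k t u * (at_risk_indicator (Y n) u \<omega> / Y n u \<omega>)) - \<alpha> (c t))\<^sup>2) \<partial>lborel) \<partial>P n)"
      unfolding L2_norm_square
    proof (intro nn_integral_cong)
      fix \<omega> t
      have "(LINT u:{0..T}|interval_measure (\<lambda>x. N n (max 0 (min x T)) \<omega>). k t u * (at_risk_indicator (Y n) u \<omega> / Y n u \<omega>))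
          = twin_estimator T d \<phi> K h (N n) (Y n) j t \<omega>" if "t \<in> {0..T}"
        unfolding twin_estimator_def using that by (intro set_lebesgue_integral_cong) (auto simp: k_def c_id)
      then show "ennreal ((twin_estimator T d \<phi> K h (N n) (Y n) j t \<omega> - \<alpha> t)\<^sup>2) * indicator {0..T} t =
        ennreal (((LINT u:{0..T}|interval_measure (\<lambda>x. N n (max 0 (min x T)) \<omega>).
        k t u * (at_risk_indicator (Y n) u \<omega> / Y n u \<omega>)) - \<alpha> (c t))\<^sup>2) * indicator {0..T} t"
        by (cases "t \<in> {0..T}") (auto simp: c_id)
    qed
    also have "\<dots> \<le> ennreal (2 * T * V) + 2 * ?B" by (rule risk)
    also have "\<dots> \<le> ennreal (2 * T * V) + 2 * ennreal ((C2 * h j powr s)\<^sup>2)"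
      by (intro add_left_mono mult_left_mono bias) simp
    also have "\<dots> = ennreal (2 * T * V + 2 * (C2 * h j powr s)\<^sup>2)"
      using T_pos V0 by (simp add: ennreal_mult)
    also have "2 * T * V + 2 * (C2 * h j powr s)\<^sup>2 =
        (2 * T * C1 * (sup_norm K)\<^sup>2 * A + 2 * C2\<^sup>2) * real n powr (- (2 * s) / (2 * s + deff))"
    proof -
      have h: "h j = real n powr (- 1 / \<beta>)" using hj by (simp add: \<beta>_def)
      have "(h j powr s)\<^sup>2 = real n powr (- (2 * s) / \<beta>)"
        unfolding h by (simp add: powr_powr power2_eq_square flip: powr_add)
      moreover have "real n * h j powr deff = real n powr ((2 * s) / \<beta>)"
      proof -
        have "real n * h j powr deff = real n powr 1 * real n powr (- deff / \<beta>)"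
          unfolding h using n by (simp add: powr_powr)
        also have "\<dots> = real n powr (1 + - deff / \<beta>)" by (rule powr_add[symmetric])
        also have "1 + - deff / \<beta> = 2 * s / \<beta>" using \<beta> by (simp add: field_simps) (simp add: \<beta>_def)
        finally show ?thesis .
      qed
      ultimately show ?thesis
        unfolding V_def \<beta>_def[symmetric] by (simp add: power_mult_distrib powr_minus divide_inverse algebra_simps)
    qed
    finally show "(\<integral>\<^sup>+ \<omega>. (L2_norm T (\<lambda>t. twin_estimator T d \<phi> K h (N n) (Y n) j t \<omega> - \<alpha> t))\<^sup>2 \<partial>P n)
      \<le> ennreal ((2 * T * C1 * (sup_norm K)\<^sup>2 * A + 2 * C2\<^sup>2) * real n powr (- (2 * s) / (2 * s + deff)))" .
  qed
qed

end
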